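(* Let $\mathcal M_1\subset\mathcal E$ be an affine subspace, let $\mathcal M_2\subset\mathcal E$ be a $C^{3,1}$ embedded submanifold, let $\mathcal M=\mathcal M_1\cap\mathcal M_2$ and $\bar x\in\mathcal M$, and assume that $\mathcal M_1$ and $\mathcal M_2$ intersect transversally at $\bar x$. Let $\varphi$ be the standard NewtonSLRA map $$\varphi(x)=\mathcal P_{\mathcal M_1\cap(\tilde x+\mathrm T_{\tilde x}\mathcal M_2)}(\tilde x),\qquad \tilde x=\mathcal P_{\mathcal M_2}(x),$$ defined for $x$ near $\bar x$. Then there exists $r_N>0$ such that the limiting map $$\psi(x,\eta)=\lim_{k\to\infty}\varphi^k(x+\eta),\qquad (x,\eta)\in\mathrm T\mathcal M,\quad \|\eta\|<r_N,$$ is a second-order retraction on $\mathcal M$ near $\bar x$, i.e., for $x$ in a neighborhood of $\bar x$ in $\mathcal M$.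
   Context: Notation. $\mathcal E$ is a Euclidean space. $\mathcal P_D$ is the orthogonal projection onto a closed set $D$ (locally single-valued near a submanifold and treated as such), $\mathrm T_x\mathcal M$ is the tangent space, and $\mathrm T\mathcal M=\{(x,\eta):x\in\mathcal M,\ \eta\in\mathrm T_x\mathcal M\}$ is the tangent bundle. $C^{3,1}$ means three times continuously differentiable with locally Lipschitz third derivative. $\mathcal M_1,\mathcal M_2$ intersect transversally at $x$ if $\mathrm T_x\mathcal M_1+\mathrm T_x\mathcal M_2=\mathcal E$; then near such a point $\mathcal M$ is an embedded submanifold with $\mathrm T_x\mathcal M=\mathrm T_x\mathcal M_1\cap\mathrm T_x\mathcal M_2$, and $\mathcal M_1\cap(\tilde x+\mathrm T_{\tilde x}\mathcal M_2)\neq\emptyset$ for $x$ near $\bar x$. The following known facts about NewtonSLRA (from the literature, valid when $\mathcal M$ is $C^3$ near $\bar x$ and the intersection is transversal at $\bar x$) are part of the setting: there exist $\delta_N,\rho_N>0$ and $\mu,\mu',\gamma,\gamma'>0$ such that for all $x\in\mathbb B(\bar x,\delta_N)$ (open ball), $\varphi(x)\in\mathbb B(\bar x,\rho_N)$, $\|\varphi(x)-\mathcal P_{\mathcal M}(x)\|\le\mu\|x-\mathcal P_{\mathcal M}(x)\|^2$ and $\|\mathcal P_{\mathcal M}(\varphi(x))-\mathcal P_{\mathcal M}(x)\|\le\mu'\|x-\mathcal P_{\mathcal M}(x)\|^2$; and for any $x_0\in\mathbb B(\bar x,\delta_N)$ the sequence $x_{k+1}=\varphi(x_k)$ is well-defined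 and converges to some $x^*\in\mathcal M$ with $\|x_{k+1}-x^*\|\le\gamma\|x_k-x^*\|^2$ for $k\ge0$ and $\|x^*-\mathcal P_{\mathcal M}(x_0)\|\le\gamma'\|x_0-\mathcal P_{\mathcal M}(x_0)\|^2$. Second-order retraction on $\mathcal M$ near $\bar x$: a $C^2$ map $\psi$, defined on a set $\{(x,\eta)\in\mathrm T\mathcal M:x\in\Omega,\ \|\eta\|<r\}$ with $\Omega$ an open neighborhood of $\bar x$ in $\mathcal M$, with values in $\mathcal M$, such that every curve $c(t)=\psi(x,t\eta)$ satisfies $c(t)=x+t\eta+o(t)$ and $\mathcal P_{\mathrm T_x\mathcal M}(c(t)-(x+t\eta))=o(t^2)$ as $t\to0$ (equivalently, $c(0)=x$, $c'(0)=\eta$ and zero intrinsic acceleration at $t=0$). *)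

theory Defs
  imports "HOL-Analysis.Analysis" "HOL-Library.Landau_Symbols"
begin

section \<open>Differentiability classes\<close>

definition C2_on :: "('a::real_normed_vector \<Rightarrow> 'b::real_normed_vector) \<Rightarrow> 'a set \<Rightarrow> bool" where
  "C2_on f U \<longleftrightarrow>
     (\<exists>(f1 :: 'a \<Rightarrow> 'a \<Rightarrow>\<^sub>L 'b) (f2 :: 'a \<Rightarrow> 'a \<Rightarrow>\<^sub>L 'a \<Rightarrow>\<^sub>L 'b).
        (\<forall>x\<in>U. (f has_derivative blinfun_apply (f1 x)) (at x)) \<and>
        (\<forall>x\<in>U. (f1 has_derivative blinfun_apply (f2 x)) (at x)) \<and>
        continuous_on U f2)"

definition locally_lipschitz_on :: "('a::metric_space \<Rightarrow> 'b::metric_space) \<Rightarrow> 'a set \<Rightarrow> bool" where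
  "locally_lipschitz_on f U \<longleftrightarrow> (\<forall>x\<in>U. \<exists>e>0. \<exists>L. L-lipschitz_on (ball x e \<inter> U) f)"

text \<open>Continuity of the third derivative follows from its local Lipschitz continuity.\<close>

definition C31_on :: "('a::real_normed_vector \<Rightarrow> 'b::real_normed_vector) \<Rightarrow> 'a set \<Rightarrow> bool" where
  "C31_on f U \<longleftrightarrow>
     (\<exists>(f1 :: 'a \<Rightarrow> 'a \<Rightarrow>\<^sub>L 'b) (f2 :: 'a \<Rightarrow> 'a \<Rightarrow>\<^sub>L 'a \<Rightarrow>\<^sub>L 'b)
       (f3 :: 'a \<Rightarrow> 'a \<Rightarrow>\<^sub>L 'a \<Rightarrow>\<^sub>L 'a \<Rightarrow>\<^sub>L 'b).
        (\<forall>x\<in>U. (f has_derivative blinfun_apply (f1 x)) (at x)) \<and>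
        (\<forall>x\<in>U. (f1 has_derivative blinfun_apply (f2 x)) (at x)) \<and>
        (\<forall>x\<in>U. (f2 has_derivative blinfun_apply (f3 x)) (at x)) \<and>
        locally_lipschitz_on f3 U)"

text \<open>A map on a subset \<open>S\<close> (not necessarily open) of the ambient space, such as a piece of an
  embedded submanifold, is \<open>C\<^sup>2\<close> if it locally extends to a \<open>C\<^sup>2\<close> map on an open set.\<close>

definition C2_map_on_subset :: "('a::real_normed_vector \<Rightarrow> 'b::real_normed_vector) \<Rightarrow> 'a set \<Rightarrow> bool" where
  "C2_map_on_subset f S \<longleftrightarrow>
     (\<forall>p\<in>S. \<exists>U g. open U \<and> p \<in> U \<and> C2_on g U \<and> (\<forall>q\<in>U \<inter> S. g q = f q))"

section \<open>Embedded submanifolds\<close>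

text \<open>Around each of its points the set is flattened to a piece of a \<open>d\<close>-dimensional subspace by
  a \<open>C\<^sup>3\<^sup>,\<^sup>1\<close> diffeomorphism between open subsets of the ambient space.\<close>

definition C31_embedded_submanifold :: "'a::euclidean_space set \<Rightarrow> bool" where
  "C31_embedded_submanifold M \<longleftrightarrow>
     (\<exists>d. \<forall>p\<in>M. \<exists>U V (\<Phi> :: 'a \<Rightarrow> 'a) (\<Psi> :: 'a \<Rightarrow> 'a) L.
        open U \<and> p \<in> U \<and> open V \<and> homeomorphism U V \<Phi> \<Psi> \<and>
        C31_on \<Phi> U \<and> C31_on \<Psi> V \<and>
        subspace L \<and> dim L = d \<and> \<Phi> ` (U \<inter> M) = V \<inter> L)"

text \<open>Velocities at \<open>x\<close> of \<open>C\<^sup>1\<close> curves in \<open>M\<close> through \<open>x\<close>.\<close>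

definition tangent_space :: "'a::real_normed_vector set \<Rightarrow> 'a \<Rightarrow> 'a set" where
  "tangent_space M x =
     {v. \<exists>e>0. \<exists>(c :: real \<Rightarrow> 'a) c'.
           c 0 = x \<and> c' 0 = v \<and> continuous_on {-e<..<e} c' \<and>
           (\<forall>t\<in>{-e<..<e}. c t \<in> M \<and> (c has_vector_derivative c' t) (at t))}"

definition transversal_at :: "'a::real_normed_vector set \<Rightarrow> 'a set \<Rightarrow> 'a \<Rightarrow> bool" where
  "transversal_at M1 M2 x \<longleftrightarrow>
     {u + v | u v. u \<in> tangent_space M1 x \<and> v \<in> tangent_space M2 x} = UNIV"

section \<open>Second-order retractions\<close>

definition retraction_domain :: "'a::real_normed_vector set \<Rightarrow> 'a set \<Rightarrow> real \<Rightarrow> ('a \<times> 'a) set" where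
  "retraction_domain M \<Omega> r = {(x, \<eta>). x \<in> M \<and> \<eta> \<in> tangent_space M x \<and> x \<in> \<Omega> \<and> norm \<eta> < r}"

text \<open>The clause \<open>\<psi> (x, 0) = x\<close> is the expansion \<open>c t = x + t \<eta> + o(t)\<close> at \<open>t = 0\<close>, which the
  punctured filter \<open>at 0\<close> does not see.\<close>

definition second_order_retraction_near ::
  "'a::euclidean_space set \<Rightarrow> 'a \<Rightarrow> 'a set \<Rightarrow> real \<Rightarrow> ('a \<times> 'a \<Rightarrow> 'a) \<Rightarrow> bool" where
  "second_order_retraction_near M xbar \<Omega> r \<psi> \<longleftrightarrow>
     openin (top_of_set M) \<Omega> \<and> xbar \<in> \<Omega> \<and> r > 0 \<and>
     \<psi> ` retraction_domain M \<Omega> r \<subseteq> M \<and>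
     C2_map_on_subset \<psi> (retraction_domain M \<Omega> r) \<and>
     (\<forall>x\<in>\<Omega>. \<forall>\<eta>\<in>tangent_space M x.
        \<psi> (x, 0) = x \<and>
        (\<lambda>t. norm (\<psi> (x, t *\<^sub>R \<eta>) - (x + t *\<^sub>R \<eta>))) \<in> o[at 0](\<lambda>t::real. t) \<and>
        (\<lambda>t. norm (closest_point (tangent_space M x) (\<psi> (x, t *\<^sub>R \<eta>) - (x + t *\<^sub>R \<eta>))))
          \<in> o[at 0](\<lambda>t::real. t\<^sup>2))"

section \<open>The NewtonSLRA map\<close>

text \<open>\<^const>\<open>closest_point\<close> is total: it chooses a nearest point if there is one and is unspecified
  otherwise.  Hence \<open>newton_slra\<close> is meaningful only where \<open>newton_slra_defined\<close> below holds; the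
  second projection there is onto a nonempty affine subspace, so it is single-valued.\<close>

definition newton_slra :: "'a::euclidean_space set \<Rightarrow> 'a set \<Rightarrow> 'a \<Rightarrow> 'a" where
  "newton_slra M1 M2 x =
     (let xt = closest_point M2 x
      in closest_point (M1 \<inter> (+) xt ` tangent_space M2 xt) xt)"

definition newton_slra_defined :: "'a::euclidean_space set \<Rightarrow> 'a set \<Rightarrow> 'a \<Rightarrow> bool" where
  "newton_slra_defined M1 M2 x \<longleftrightarrow>
     (\<exists>!y. y \<in> M2 \<and> (\<forall>z\<in>M2. dist x y \<le> dist x z)) \<and>
     (let xt = closest_point M2 x in M1 \<inter> (+) xt ` tangent_space M2 xt \<noteq> {})"

definition newton_slra_limit :: "'a::euclidean_space set \<Rightarrow> 'a set \<Rightarrow> 'a \<times> 'a \<Rightarrow> 'a" where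
  "newton_slra_limit M1 M2 = (\<lambda>(x, \<eta>). lim (\<lambda>k. (newton_slra M1 M2 ^^ k) (x + \<eta>)))"

end

theory Submission
  imports Defs
begin

text \<open>Write \<open>\<phi>\<close> for the NewtonSLRA map and \<open>r y = norm (\<phi> y - y)\<close> for the length of its step.  The whole
dynamics near \<open>xbar\<close> is governed by two facts: \<open>\<phi>\<close> is \<open>C\<^sup>2\<close> with Lipschitz second derivative, and its
steps shrink quadratically, \<open>r (\<phi> y) \<le> C * (r y)\<^sup>2\<close>.

Any map with these two properties has a \<open>C\<^sup>2\<close> limit map (\<open>quadratic_iteration_limit_C2\<close>).  Indeed
\<open>v = \<phi>\<^sup>3 - \<phi>\<^sup>2\<close> is of size \<open>O(r\<^sup>4)\<close>, and a function that is this small and has a Lipschitz second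
derivative must have small first and second derivatives as well: interpolation between the size of a
function and the Lipschitz constant of its derivative (\<open>derivative_bound_from_values\<close>), used twice,
shows that both are \<open>O(r)\<close>.  The limit is the sum of \<open>\<phi>\<^sup>2\<close> and the terms \<open>v \<circ> \<phi>\<^sup>k\<close>.  By the chain rule
the first two derivatives of \<open>\<phi>\<^sup>k\<close> grow at most like \<open>Q\<^sup>k\<close>, whereas \<open>r \<circ> \<phi>\<^sup>k\<close> decays faster than every
geometric sequence, so the series converges together with its first two derivatives.

The two facts about \<open>\<phi>\<close> come from an explicit description.  Parametrising a tubular neighbourhood
of \<open>M2\<close> by its normal bundle and inverting with the inverse function theorem costs one derivative,
so that the metric projection \<open>P\<close> and the orthogonal projection \<open>T y\<close> onto the tangent space at
\<open>P y\<close> are \<open>C\<^sup>2\<close> with Lipschitz second derivative (\<open>submanifold_projection_C21\<close>).  If \<open>A\<close> projects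
onto the orthogonal complement of the direction of \<open>M1\<close>, then
\<open>\<phi> y = P y - T y A (1 - A + A T y A)\<^sup>-\<^sup>1 A (P y - xbar)\<close>, where transversality makes the operator
in the middle invertible.  The step estimate holds because \<open>\<phi> y\<close> is obtained from \<open>P y\<close> by moving
tangentially to \<open>M2\<close>, hence is only quadratically far from \<open>M2\<close>, and because this tangential move is
orthogonal to \<open>y - P y\<close> and thus not longer than \<open>r y\<close> (\<open>newton_slra_local\<close>).

For the second-order property let \<open>x \<in> M1 \<inter> M2\<close>, let \<open>\<eta>\<close> be tangent and \<open>y = x + t \<eta>\<close>.  Then
\<open>r y = O(t\<^sup>2)\<close>, the limit differs from \<open>\<phi> y\<close> by \<open>O((r y)\<^sup>2) = O(t\<^sup>4)\<close>, and \<open>\<phi> y - y\<close> is a sum of a vector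
orthogonal to \<open>M1\<close> and a vector normal to \<open>M2\<close> at \<open>P y\<close>.  The normal spaces at \<open>P y\<close> and at \<open>x\<close> differ
by \<open>O(t)\<close>, so the component of \<open>\<phi> y - y\<close> tangent to \<open>M1 \<inter> M2\<close> at \<open>x\<close> is \<open>O(t\<^sup>3)\<close>.\<close>

section \<open>Maps whose highest derivative is locally Lipschitz\<close>

lemma locally_lipschitz_on_subset:
  assumes "locally_lipschitz_on f U" "V \<subseteq> U"
  shows "locally_lipschitz_on f V"
  unfolding locally_lipschitz_on_def
proof
  fix x assume "x \<in> V"
  then obtain e K where "e > 0" "K-lipschitz_on (ball x e \<inter> U) f"
    using assms unfolding locally_lipschitz_on_def by blast
  then show "\<exists>e>0. \<exists>K. K-lipschitz_on (ball x e \<inter> V) f"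
    using assms(2) by (meson Int_mono lipschitz_on_subset order_refl)
qed

lemma locally_lipschitz_on_ball:
  assumes "locally_lipschitz_on f U" "open U" "x \<in> U"
  obtains e K where "e > 0" "ball x e \<subseteq> U" "K-lipschitz_on (ball x e) f"
proof -
  obtain e K where e: "e > 0" "K-lipschitz_on (ball x e \<inter> U) f"
    using assms unfolding locally_lipschitz_on_def by blast
  obtain d where d: "d > 0" "ball x d \<subseteq> U"
    using assms(2,3) open_contains_ball by blast
  show thesis
  proof
    show "min e d > 0" "ball x (min e d) \<subseteq> U" using e d by auto
    show "K-lipschitz_on (ball x (min e d)) f"
      using e(2) d(2) by (rule_tac lipschitz_on_subset[OF e(2)]) auto
  qed
qed

lemma locally_lipschitz_onI_ball:
  assumes "\<And>x. x \<in> U \<Longrightarrow> \<exists>e>0. \<exists>K. K-lipschitz_on (ball x e) f"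
  shows "locally_lipschitz_on f U"
  unfolding locally_lipschitz_on_def
  by (meson assms inf_le1 lipschitz_on_subset)

lemma locally_lipschitz_on_isCont:
  assumes "locally_lipschitz_on f U" "open U" "x \<in> U"
  shows "isCont f x"
proof -
  obtain e K where e: "e > 0" "K-lipschitz_on (ball x e) f"
    using locally_lipschitz_on_ball[OF assms] by metis
  then have "continuous_on (ball x e) f" by (rule_tac lipschitz_on_continuous_on)
  with e show ?thesis by (simp add: continuous_on_eq_continuous_at)
qed

lemma locally_lipschitz_on_compose:
  assumes f: "locally_lipschitz_on f V" "open V"
    and g: "locally_lipschitz_on g U" "open U" "g ` U \<subseteq> V"
  shows "locally_lipschitz_on (\<lambda>x. f (g x)) U"
proof (rule locally_lipschitz_onI_ball)
  fix x assume x: "x \<in> U"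
  obtain d K where d: "d > 0" "K-lipschitz_on (ball (g x) d) f"
    using locally_lipschitz_on_ball[OF f] g(3) x by (metis image_subset_iff)
  obtain e1 N where e1: "e1 > 0" "N-lipschitz_on (ball x e1) g"
    using locally_lipschitz_on_ball[OF g(1,2) x] by metis
  obtain e2 where e2: "e2 > 0" "g ` ball x e2 \<subseteq> ball (g x) d"
    using locally_lipschitz_on_isCont[OF g(1,2) x] d(1)
    by (metis continuous_at_ball)
  have "(K * N)-lipschitz_on (ball x (min e1 e2)) (\<lambda>x. f (g x))"
  proof (rule lipschitz_on_compose2[where f = g and g = f])
    show "N-lipschitz_on (ball x (min e1 e2)) g"
      by (rule lipschitz_on_subset[OF e1(2)]) auto
    show "K-lipschitz_on (g ` ball x (min e1 e2)) f"
      by (rule lipschitz_on_subset[OF d(2)]) (use e2 in auto)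
  qed
  then show "\<exists>e>0. \<exists>K. K-lipschitz_on (ball x e) (\<lambda>x. f (g x))"
    using e1 e2 by (metis min_less_iff_conj)
qed

lemma locally_lipschitz_on_const: "locally_lipschitz_on (\<lambda>x. c) U"
  by (intro locally_lipschitz_onI_ball exI[of _ 1] conjI exI[of _ 0] lipschitz_intros) auto

lemma bounded_linear_locally_lipschitz_on:
  assumes "bounded_linear T"
  shows "locally_lipschitz_on T U"
proof (rule locally_lipschitz_onI_ball)
  fix x
  obtain B where "B-lipschitz_on (ball x 1) T"
    using bounded_linear.lipschitz_boundE[OF assms] by metis
  then show "\<exists>e>0. \<exists>K. K-lipschitz_on (ball x e) T" by (meson zero_less_one)
qed

lemma locally_lipschitz_on_linear:
  assumes "bounded_linear T" "locally_lipschitz_on f U" "open U"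
  shows "locally_lipschitz_on (\<lambda>x. T (f x)) U"
  using locally_lipschitz_on_compose[OF bounded_linear_locally_lipschitz_on[OF assms(1)] open_UNIV assms(2,3)]
  by simp

lemma locally_lipschitz_on_add:
  fixes f g :: "_ \<Rightarrow> 'b::real_normed_vector"
  assumes "locally_lipschitz_on f U" "locally_lipschitz_on g U" "open U"
  shows "locally_lipschitz_on (\<lambda>x. f x + g x) U"
proof (rule locally_lipschitz_onI_ball)
  fix x assume x: "x \<in> U"
  obtain d K where d: "d > 0" "K-lipschitz_on (ball x d) f"
    using locally_lipschitz_on_ball[OF assms(1,3) x] by metis
  obtain e N where e: "e > 0" "N-lipschitz_on (ball x e) g"
    using locally_lipschitz_on_ball[OF assms(2,3) x] by metis
  have "(K + N)-lipschitz_on (ball x (min d e)) (\<lambda>x. f x + g x)"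
    by (rule lipschitz_on_add; (rule lipschitz_on_subset[OF d(2)] lipschitz_on_subset[OF e(2)])) auto
  then show "\<exists>e>0. \<exists>K. K-lipschitz_on (ball x e) (\<lambda>x. f x + g x)"
    using d e by (metis min_less_iff_conj)
qed

lemma lipschitz_on_ball_bounded:
  assumes "K-lipschitz_on (ball x e) f" "y \<in> ball x e"
  shows "norm (f y) \<le> norm (f x) + K * e"
proof -
  have "e > 0" using assms(2) by (metis ball_eq_empty empty_iff linorder_not_le)
  then have "dist (f y) (f x) \<le> K * dist y x"
    using assms by (intro lipschitz_onD[OF assms(1)]) auto
  also have "\<dots> \<le> K * e"
    using assms lipschitz_on_nonneg[OF assms(1)] by (intro mult_left_mono) (auto simp: dist_commute)
  finally have "norm (f y - f x) \<le> K * e" by (simp add: dist_norm)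
  then show ?thesis using norm_triangle_ineq2[of "f y" "f x"] by linarith
qed

lemma locally_lipschitz_on_bilinear:
  assumes bl: "bounded_bilinear bop"
    and f: "locally_lipschitz_on f U" and g: "locally_lipschitz_on g U" and U: "open U"
  shows "locally_lipschitz_on (\<lambda>x. bop (f x) (g x)) U"
proof (rule locally_lipschitz_onI_ball)
  fix x assume x: "x \<in> U"
  interpret bounded_bilinear bop by fact
  obtain B where B: "B > 0" "\<And>a b. norm (bop a b) \<le> norm a * norm b * B"
    using pos_bounded by blast
  obtain d0 K where d0: "d0 > 0" "K-lipschitz_on (ball x d0) f"
    using locally_lipschitz_on_ball[OF f U x] by metis
  obtain e0 N where e0: "e0 > 0" "N-lipschitz_on (ball x e0) g"
    using locally_lipschitz_on_ball[OF g U x] by metis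
  define d where "d = min d0 e0"
  have d: "d > 0" "K-lipschitz_on (ball x d) f" "N-lipschitz_on (ball x d) g"
    using d0 e0 by (auto simp: d_def intro: lipschitz_on_subset[OF d0(2)] lipschitz_on_subset[OF e0(2)])
  define F G where "F = norm (f x) + K * d" and "G = norm (g x) + N * d"
  have F: "norm (f y) \<le> F" if "y \<in> ball x d" for y
    using lipschitz_on_ball_bounded[OF d(2) that] by (simp add: F_def)
  have G: "norm (g y) \<le> G" if "y \<in> ball x d" for y
    using lipschitz_on_ball_bounded[OF d(3) that] by (simp add: G_def)
  have K: "K \<ge> 0" "N \<ge> 0" using d lipschitz_on_nonneg by blast+
  then have FG: "F \<ge> 0" "G \<ge> 0" using d by (auto simp: F_def G_def)
  have "(B * (F * N + K * G))-lipschitz_on (ball x d) (\<lambda>x. bop (f x) (g x))"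
  proof (rule lipschitz_onI)
    fix y z assume y: "y \<in> ball x d" and z: "z \<in> ball x d"
    have f1: "norm (f y - f z) \<le> K * dist y z"
      using lipschitz_onD[OF d(2) y z] by (simp add: dist_norm)
    have g1: "norm (g y - g z) \<le> N * dist y z"
      using lipschitz_onD[OF d(3) y z] by (simp add: dist_norm)
    have "dist (bop (f y) (g y)) (bop (f z) (g z)) =
        norm (bop (f y) (g y - g z) + bop (f y - f z) (g z))"
      by (simp add: dist_norm diff_left diff_right)
    also have "\<dots> \<le> norm (f y) * norm (g y - g z) * B + norm (f y - f z) * norm (g z) * B"
      by (meson B(2) add_mono norm_triangle_ineq order_trans)
    also have "\<dots> \<le> F * (N * dist y z) * B + (K * dist y z) * G * B"
      using F[OF y] G[OF z] f1 g1 FG K B(1)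
      by (intro add_mono mult_right_mono mult_mono) auto
    finally show "dist (bop (f y) (g y)) (bop (f z) (g z)) \<le> B * (F * N + K * G) * dist y z"
      by (simp add: algebra_simps)
  qed (use B FG K in auto)
  then show "\<exists>e>0. \<exists>K. K-lipschitz_on (ball x e) (\<lambda>x. bop (f x) (g x))"
    using d(1) by blast
qed

lemma isCont_tendsto_nhds: "isCont f x \<Longrightarrow> (f \<longlongrightarrow> f x) (nhds x)"
  by (simp add: isCont_def tendsto_at_iff_tendsto_nhds)

lemma continuous_derivative_imp_locally_lipschitz:
  fixes f1 :: "'a::real_normed_vector \<Rightarrow> 'a \<Rightarrow>\<^sub>L 'b::real_normed_vector"
  assumes "open U" and f1: "\<And>x. x \<in> U \<Longrightarrow> (f has_derivative blinfun_apply (f1 x)) (at x)"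
    and cont: "\<And>x. x \<in> U \<Longrightarrow> isCont f1 x"
  shows "locally_lipschitz_on f U"
proof (rule locally_lipschitz_onI_ball)
  fix x assume x: "x \<in> U"
  obtain d where d: "d > 0" "ball x d \<subseteq> U" using assms(1) x open_contains_ball by blast
  have "isCont (\<lambda>y. norm (f1 y)) x" using cont[OF x] by simp
  then have "\<forall>\<^sub>F y in nhds x. norm (f1 y) < norm (f1 x) + 1"
    by (intro order_tendstoD(2)[OF isCont_tendsto_nhds]) auto
  then obtain e0 where e0: "e0 > 0" "\<And>y. dist y x < e0 \<Longrightarrow> norm (f1 y) < norm (f1 x) + 1"
    unfolding eventually_nhds_metric by blast
  define e where "e = min d e0"
  have e: "e > 0" "ball x e \<subseteq> U" using d e0 by (auto simp: e_def)
  have "(norm (f1 x) + 1)-lipschitz_on (ball x e) f"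
  proof (rule lipschitz_onI)
    fix y z assume y: "y \<in> ball x e" and z: "z \<in> ball x e"
    have "norm (f y - f z) \<le> (norm (f1 x) + 1) * norm (y - z)"
    proof (rule differentiable_bound[OF convex_ball _ _ y z, where f' = "\<lambda>x. blinfun_apply (f1 x)"])
      fix w assume w: "w \<in> ball x e"
      show "(f has_derivative blinfun_apply (f1 w)) (at w within ball x e)"
        using f1[OF subsetD[OF e(2) w]] has_derivative_at_withinI by blast
      show "onorm (blinfun_apply (f1 w)) \<le> norm (f1 x) + 1"
        using e0(2)[of w] w by (simp add: norm_blinfun.rep_eq e_def dist_commute less_imp_le)
    qed
    then show "dist (f y) (f z) \<le> (norm (f1 x) + 1) * dist y z" by (simp add: dist_norm)
  qed simp
  then show "\<exists>e>0. \<exists>K. K-lipschitz_on (ball x e) f" using e(1) by blast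
qed

text \<open>The classes \<open>C\<^sup>1\<^sup>,\<^sup>1\<close> and \<open>C\<^sup>2\<^sup>,\<^sup>1\<close> are defined one on top of the other, so that closure under
products, composition and inversion follows level by level from the formula for the derivative.\<close>

definition C11_on :: "('a::real_normed_vector \<Rightarrow> 'b::real_normed_vector) \<Rightarrow> 'a set \<Rightarrow> bool" where
  "C11_on f U \<longleftrightarrow> (\<exists>f1 :: 'a \<Rightarrow> 'a \<Rightarrow>\<^sub>L 'b.
     (\<forall>x\<in>U. (f has_derivative blinfun_apply (f1 x)) (at x)) \<and> locally_lipschitz_on f1 U)"

definition C21_on :: "('a::real_normed_vector \<Rightarrow> 'b::real_normed_vector) \<Rightarrow> 'a set \<Rightarrow> bool" where
  "C21_on f U \<longleftrightarrow> (\<exists>f1 :: 'a \<Rightarrow> 'a \<Rightarrow>\<^sub>L 'b.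
     (\<forall>x\<in>U. (f has_derivative blinfun_apply (f1 x)) (at x)) \<and> C11_on f1 U)"

lemma C11_onI:
  assumes "\<And>x. x \<in> U \<Longrightarrow> (f has_derivative blinfun_apply (f1 x)) (at x)" "locally_lipschitz_on f1 U"
  shows "C11_on f U"
  unfolding C11_on_def by (rule exI[of _ f1]) (simp add: assms)

lemma C11_onE:
  assumes "C11_on f U"
  obtains f1 where "\<And>x. x \<in> U \<Longrightarrow> (f has_derivative blinfun_apply (f1 x)) (at x)" "locally_lipschitz_on f1 U"
  using assms unfolding C11_on_def by (elim exE conjE) (rule that, auto)

lemma C21_onI:
  assumes "\<And>x. x \<in> U \<Longrightarrow> (f has_derivative blinfun_apply (f1 x)) (at x)" "C11_on f1 U"
  shows "C21_on f U"
  unfolding C21_on_def by (rule exI[of _ f1]) (simp add: assms)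

lemma C21_onE:
  assumes "C21_on f U"
  obtains f1 where "\<And>x. x \<in> U \<Longrightarrow> (f has_derivative blinfun_apply (f1 x)) (at x)" "C11_on f1 U"
  using assms unfolding C21_on_def by (elim exE conjE) (rule that, auto)

lemma C11_on_subset: "C11_on f U \<Longrightarrow> V \<subseteq> U \<Longrightarrow> C11_on f V"
  by (erule C11_onE, rule C11_onI) (auto intro: locally_lipschitz_on_subset)

lemma C21_on_subset: "C21_on f U \<Longrightarrow> V \<subseteq> U \<Longrightarrow> C21_on f V"
  by (erule C21_onE, rule C21_onI) (auto intro: C11_on_subset)

lemma C11_on_imp_locally_lipschitz:
  assumes "C11_on f U" "open U"
  shows "locally_lipschitz_on f U"
proof -
  from assms(1) obtain f1 where f1: "\<And>x. x \<in> U \<Longrightarrow> (f has_derivative blinfun_apply (f1 x)) (at x)"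
    "locally_lipschitz_on f1 U" by (rule C11_onE) (rule that, auto)
  show ?thesis
    by (rule continuous_derivative_imp_locally_lipschitz[OF assms(2) f1(1)
        locally_lipschitz_on_isCont[OF f1(2) assms(2)]])
qed

lemma C21_on_imp_C11_on: "C21_on f U \<Longrightarrow> open U \<Longrightarrow> C11_on f U"
  by (erule C21_onE, rule C11_onI) (auto intro: C11_on_imp_locally_lipschitz)

lemma C21_on_imp_locally_lipschitz: "C21_on f U \<Longrightarrow> open U \<Longrightarrow> locally_lipschitz_on f U"
  by (simp add: C21_on_imp_C11_on C11_on_imp_locally_lipschitz)

lemma C21_on_cong:
  assumes "C21_on f U" "open U" "\<And>x. x \<in> U \<Longrightarrow> f x = g x"
  shows "C21_on g U"
proof -
  from assms(1) obtain f1 where f1: "\<And>x. x \<in> U \<Longrightarrow> (f has_derivative blinfun_apply (f1 x)) (at x)"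
    "C11_on f1 U" by (rule C21_onE) (rule that, auto)
  show ?thesis
    by (rule C21_onI[OF _ f1(2)]) (use has_derivative_transform_within_open[OF f1(1) assms(2)] assms(3) in blast)
qed

lemma C11_on_linear:
  assumes "bounded_linear T"
  shows "C11_on T U"
  by (rule C11_onI[of _ _ "\<lambda>_. Blinfun T"])
     (simp_all add: assms bounded_linear_Blinfun_apply bounded_linear_imp_has_derivative locally_lipschitz_on_const)

lemma C11_on_const: "C11_on (\<lambda>x. c) U"
  by (rule C11_onI[of _ _ "\<lambda>x. 0"]) (auto simp: locally_lipschitz_on_const zero_blinfun.rep_eq)

lemma C21_on_const: "C21_on (\<lambda>x. c) U"
  by (rule C21_onI[of _ _ "\<lambda>x. 0"]) (auto simp: C11_on_const zero_blinfun.rep_eq)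

lemma C21_on_linear:
  assumes "bounded_linear T"
  shows "C21_on T U"
  by (rule C21_onI[of _ _ "\<lambda>_. Blinfun T"])
     (simp_all add: assms bounded_linear_Blinfun_apply bounded_linear_imp_has_derivative C11_on_const)

lemma has_derivative_blinfun_add:
  assumes "(f has_derivative blinfun_apply f1) F" "(g has_derivative blinfun_apply g1) F"
  shows "((\<lambda>x. f x + g x) has_derivative blinfun_apply (f1 + g1)) F"
  using has_derivative_add[OF assms] by (simp add: plus_blinfun.rep_eq)

lemma C11_on_add:
  assumes "C11_on f U" "C11_on g U" "open U"
  shows "C11_on (\<lambda>x. f x + g x) U"
proof -
  from assms(1) obtain f1 where f1: "\<And>x. x \<in> U \<Longrightarrow> (f has_derivative blinfun_apply (f1 x)) (at x)"
    "locally_lipschitz_on f1 U" by (rule C11_onE) (rule that, auto)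
  from assms(2) obtain g1 where g1: "\<And>x. x \<in> U \<Longrightarrow> (g has_derivative blinfun_apply (g1 x)) (at x)"
    "locally_lipschitz_on g1 U" by (rule C11_onE) (rule that, auto)
  show ?thesis
    by (rule C11_onI[OF has_derivative_blinfun_add[OF f1(1) g1(1)]])
       (auto intro: locally_lipschitz_on_add f1 g1 assms)
qed

lemma C21_on_add:
  assumes "C21_on f U" "C21_on g U" "open U"
  shows "C21_on (\<lambda>x. f x + g x) U"
proof -
  from assms(1) obtain f1 where f1: "\<And>x. x \<in> U \<Longrightarrow> (f has_derivative blinfun_apply (f1 x)) (at x)"
    "C11_on f1 U" by (rule C21_onE) (rule that, auto)
  from assms(2) obtain g1 where g1: "\<And>x. x \<in> U \<Longrightarrow> (g has_derivative blinfun_apply (g1 x)) (at x)"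
    "C11_on g1 U" by (rule C21_onE) (rule that, auto)
  show ?thesis
    by (rule C21_onI[OF has_derivative_blinfun_add[OF f1(1) g1(1)]])
       (auto intro: C11_on_add f1 g1 assms)
qed

lemma has_derivative_blinfun_bilinear:
  assumes bl: "bounded_bilinear bop"
    and "(f has_derivative blinfun_apply f1) (at x)" "(g has_derivative blinfun_apply g1) (at x)"
  shows "((\<lambda>x. bop (f x) (g x)) has_derivative
    blinfun_apply ((bounded_bilinear.prod_right bop (f x) o\<^sub>L g1) + (bounded_bilinear.prod_left bop (g x) o\<^sub>L f1))) (at x)"
  using bounded_bilinear.FDERIV[OF assms]
  by (simp add: plus_blinfun.rep_eq bounded_bilinear.prod_right.rep_eq[OF bl] bounded_bilinear.prod_left.rep_eq[OF bl])

lemma C11_on_bilinear: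
  assumes bl: "bounded_bilinear bop" and "C11_on f U" "C11_on g U" and U: "open U"
  shows "C11_on (\<lambda>x. bop (f x) (g x)) U"
proof -
  from assms(2) obtain f1 where f1: "\<And>x. x \<in> U \<Longrightarrow> (f has_derivative blinfun_apply (f1 x)) (at x)"
    "locally_lipschitz_on f1 U" by (rule C11_onE) (rule that, auto)
  from assms(3) obtain g1 where g1: "\<And>x. x \<in> U \<Longrightarrow> (g has_derivative blinfun_apply (g1 x)) (at x)"
    "locally_lipschitz_on g1 U" by (rule C11_onE) (rule that, auto)
  note l = bounded_bilinear.bounded_linear_prod_left[OF bl] bounded_bilinear.bounded_linear_prod_right[OF bl]
  show ?thesis
    by (rule C11_onI[OF has_derivative_blinfun_bilinear[OF bl f1(1) g1(1)]])
       (auto intro!: locally_lipschitz_on_add locally_lipschitz_on_bilinear[OF bounded_bilinear_blinfun_compose]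
         locally_lipschitz_on_linear[OF l(1)] locally_lipschitz_on_linear[OF l(2)] f1(2) g1(2) U
         C11_on_imp_locally_lipschitz[OF assms(2)] C11_on_imp_locally_lipschitz[OF assms(3)])
qed

lemma C11_on_compose:
  assumes "C11_on f V" "open V" "C11_on g U" "open U" "g ` U \<subseteq> V"
  shows "C11_on (\<lambda>x. f (g x)) U"
proof -
  from assms(1) obtain f1 where f1: "\<And>x. x \<in> V \<Longrightarrow> (f has_derivative blinfun_apply (f1 x)) (at x)"
    "locally_lipschitz_on f1 V" by (rule C11_onE) (rule that, auto)
  from assms(3) obtain g1 where g1: "\<And>x. x \<in> U \<Longrightarrow> (g has_derivative blinfun_apply (g1 x)) (at x)"
    "locally_lipschitz_on g1 U" by (rule C11_onE) (rule that, auto)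
  show ?thesis
  proof (rule C11_onI)
    show "((\<lambda>x. f (g x)) has_derivative blinfun_apply (f1 (g x) o\<^sub>L g1 x)) (at x)" if "x \<in> U" for x
      using has_derivative_compose[OF g1(1)[OF that] f1(1)] that assms(5)
      by (simp add: image_subset_iff blinfun_compose.rep_eq o_def)
    show "locally_lipschitz_on (\<lambda>x. f1 (g x) o\<^sub>L g1 x) U"
      by (intro locally_lipschitz_on_bilinear[OF bounded_bilinear_blinfun_compose] g1(2) assms
        locally_lipschitz_on_compose[OF f1(2)] C11_on_imp_locally_lipschitz)
  qed
qed

lemma C11_on_linear_compose:
  assumes "bounded_linear T" "C11_on f U" "open U"
  shows "C11_on (\<lambda>x. T (f x)) U"
  using C11_on_compose[OF C11_on_linear[OF assms(1)] open_UNIV assms(2,3)] by simp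

lemma C21_on_bilinear:
  assumes bl: "bounded_bilinear bop" and "C21_on f U" "C21_on g U" and U: "open U"
  shows "C21_on (\<lambda>x. bop (f x) (g x)) U"
proof -
  from assms(2) obtain f1 where f1: "\<And>x. x \<in> U \<Longrightarrow> (f has_derivative blinfun_apply (f1 x)) (at x)"
    "C11_on f1 U" by (rule C21_onE) (rule that, auto)
  from assms(3) obtain g1 where g1: "\<And>x. x \<in> U \<Longrightarrow> (g has_derivative blinfun_apply (g1 x)) (at x)"
    "C11_on g1 U" by (rule C21_onE) (rule that, auto)
  note l = bounded_bilinear.bounded_linear_prod_left[OF bl] bounded_bilinear.bounded_linear_prod_right[OF bl]
  show ?thesis
    by (rule C21_onI[OF has_derivative_blinfun_bilinear[OF bl f1(1) g1(1)]])
       (auto intro!: C11_on_add C11_on_bilinear[OF bounded_bilinear_blinfun_compose]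
         C11_on_linear_compose[OF l(1)] C11_on_linear_compose[OF l(2)] f1(2) g1(2) U
         C21_on_imp_C11_on[OF assms(2)] C21_on_imp_C11_on[OF assms(3)])
qed

lemma C21_on_compose:
  assumes "C21_on f V" "open V" "C21_on g U" "open U" "g ` U \<subseteq> V"
  shows "C21_on (\<lambda>x. f (g x)) U"
proof -
  from assms(1) obtain f1 where f1: "\<And>x. x \<in> V \<Longrightarrow> (f has_derivative blinfun_apply (f1 x)) (at x)"
    "C11_on f1 V" by (rule C21_onE) (rule that, auto)
  from assms(3) obtain g1 where g1: "\<And>x. x \<in> U \<Longrightarrow> (g has_derivative blinfun_apply (g1 x)) (at x)"
    "C11_on g1 U" by (rule C21_onE) (rule that, auto)
  show ?thesis
  proof (rule C21_onI)
    show "((\<lambda>x. f (g x)) has_derivative blinfun_apply (f1 (g x) o\<^sub>L g1 x)) (at x)" if "x \<in> U" for x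
      using has_derivative_compose[OF g1(1)[OF that] f1(1)] that assms(5)
      by (simp add: image_subset_iff blinfun_compose.rep_eq o_def)
    show "C11_on (\<lambda>x. f1 (g x) o\<^sub>L g1 x) U"
      by (intro C11_on_bilinear[OF bounded_bilinear_blinfun_compose] g1(2) assms
        C11_on_compose[OF f1(2)] C21_on_imp_C11_on)
  qed
qed

lemma C21_on_linear_compose:
  assumes "bounded_linear T" "C21_on f U" "open U"
  shows "C21_on (\<lambda>x. T (f x)) U"
  using C21_on_compose[OF C21_on_linear[OF assms(1)] open_UNIV assms(2,3)] by simp

lemma C21_on_diff:
  assumes "C21_on f U" "C21_on g U" "open U"
  shows "C21_on (\<lambda>x. f x - g x) U"
proof -
  have "bounded_linear (\<lambda>x::'b. - x)" using bounded_linear_minus bounded_linear_ident by blast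
  from C21_on_add[OF assms(1) C21_on_linear_compose[OF this assms(2,3)] assms(3)]
  show ?thesis by simp
qed

text \<open>The identity \<open>Y t - Y s = Y t (X s - X t) Y s\<close> transfers a Lipschitz bound from \<open>X\<close> to \<open>Y\<close> once
\<open>Y\<close> is known to be bounded near \<open>x\<close>; with \<open>s = x\<close> the same identity gives \<open>norm (Y t) \<le> 2 * norm (Y x)\<close>
as soon as \<open>X t\<close> is close to \<open>X x\<close>.\<close>

lemma locally_lipschitz_on_blinfun_inverse:
  fixes X Y :: "'a::metric_space \<Rightarrow> 'b::real_normed_vector \<Rightarrow>\<^sub>L 'b"
  assumes X: "locally_lipschitz_on X U" and U: "open U"
    and inv: "\<And>x. x \<in> U \<Longrightarrow> X x o\<^sub>L Y x = id_blinfun" "\<And>x. x \<in> U \<Longrightarrow> Y x o\<^sub>L X x = id_blinfun"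
  shows "locally_lipschitz_on Y U"
proof (rule locally_lipschitz_onI_ball)
  fix x assume x: "x \<in> U"
  obtain e K where e: "e > 0" "ball x e \<subseteq> U" "K-lipschitz_on (ball x e) X"
    using locally_lipschitz_on_ball[OF X U x] by metis
  have K: "K \<ge> 0" using e(3) lipschitz_on_nonneg by blast
  have id: "X s (Y s v) = v" "Y s (X s v) = v" if "s \<in> U" for s v
    using inv[OF that] by (metis blinfun_apply_blinfun_compose blinfun_apply_id_blinfun)+
  have diff: "Y t - Y s = Y t o\<^sub>L ((X s - X t) o\<^sub>L Y s)" if "s \<in> U" "t \<in> U" for s t
    using that by (intro blinfun_eqI) (simp add: blinfun.bilinear_simps id)
  have ndiff: "norm (Y t - Y s) \<le> norm (Y t) * (K * dist t s) * norm (Y s)"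
    if "s \<in> ball x e" "t \<in> ball x e" for s t
  proof -
    have "norm (Y t - Y s) \<le> norm (Y t) * (norm (X s - X t) * norm (Y s))"
      unfolding diff[OF subsetD[OF e(2) that(1)] subsetD[OF e(2) that(2)]]
      by (meson mult_left_mono norm_blinfun_compose norm_ge_zero order_trans)
    also have "norm (X s - X t) \<le> K * dist s t"
      using lipschitz_onD[OF e(3) that] by (simp add: dist_norm)
    finally show ?thesis by (simp add: mult_left_mono mult_right_mono dist_commute mult.assoc)
  qed
  define N where "N = norm (Y x)"
  define d where "d = min e (1 / (2 * (K * N + 1)))"
  have KN: "K * N \<ge> 0" by (simp add: N_def K)
  have d: "d > 0" "d \<le> e" using e(1) KN by (auto simp: d_def)
  have dK: "K * d * N \<le> 1/2"
  proof -
    have "d \<le> 1 / (2 * (K * N + 1))" by (simp add: d_def)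
    then have "d * (K * N) \<le> 1 / (2 * (K * N + 1)) * (K * N)" using KN by (rule mult_right_mono)
    also have "\<dots> \<le> 1/2" using KN by (simp add: field_simps)
    finally show ?thesis by (simp add: mult_ac)
  qed
  have bd: "norm (Y t) \<le> 2 * N" if t: "t \<in> ball x d" for t
  proof -
    have "norm (Y t - Y x) \<le> norm (Y t) * (K * dist t x) * norm (Y x)"
      using ndiff[of x t] t d by auto
    also have "\<dots> \<le> norm (Y t) * (K * d) * N"
      using t K d(1) by (auto simp: N_def dist_commute intro!: mult_mono)
    also have "\<dots> = norm (Y t) * (K * d * N)" by simp
    also have "\<dots> \<le> norm (Y t) * (1/2)" using dK by (intro mult_left_mono) auto
    finally show ?thesis using norm_triangle_ineq2[of "Y t" "Y x"] by (simp add: N_def)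
  qed
  have "(4 * N * N * K)-lipschitz_on (ball x d) Y"
  proof (rule lipschitz_onI)
    fix t s assume ts: "t \<in> ball x d" "s \<in> ball x d"
    have "norm (Y t - Y s) \<le> norm (Y t) * (K * dist t s) * norm (Y s)"
      using ndiff[of s t] ts d by auto
    also have "\<dots> \<le> (2 * N) * (K * dist t s) * (2 * N)"
      using bd ts K by (intro mult_mono) (auto simp: N_def)
    finally show "dist (Y t) (Y s) \<le> 4 * N * N * K * dist t s" by (simp add: dist_norm mult_ac)
  qed (use K in \<open>auto simp: N_def\<close>)
  then show "\<exists>e>0. \<exists>K. K-lipschitz_on (ball x e) Y" using d by blast
qed

text \<open>Compared with the claimed derivative, \<open>Y y - Y x = - Y y (X y - X x) Y x\<close> differs by two terms: one
contains the remainder of \<open>X\<close>, the other is \<open>(Y y - Y x) (X1 (y - x)) Y x\<close>.  Divided by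
\<open>norm (y - x)\<close> the latter tends to \<open>0\<close> because \<open>Y\<close> is continuous at \<open>x\<close>.\<close>

lemma has_derivative_blinfun_inverse:
  fixes X Y :: "'a::real_normed_vector \<Rightarrow> 'b::real_normed_vector \<Rightarrow>\<^sub>L 'b"
  assumes der: "(X has_derivative blinfun_apply X1) (at x)"
    and Y: "isCont Y x" and U: "open U" "x \<in> U"
    and inv: "\<And>x. x \<in> U \<Longrightarrow> X x o\<^sub>L Y x = id_blinfun" "\<And>x. x \<in> U \<Longrightarrow> Y x o\<^sub>L X x = id_blinfun"
  shows "(Y has_derivative (\<lambda>h. - (Y x o\<^sub>L (X1 h o\<^sub>L Y x)))) (at x)"
proof -
  have id: "X s (Y s v) = v" "Y s (X s v) = v" if "s \<in> U" for s v
    using inv[OF that] by (metis blinfun_apply_blinfun_compose blinfun_apply_id_blinfun)+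
  have lin: "bounded_linear (\<lambda>h. - (Y x o\<^sub>L (X1 h o\<^sub>L Y x)))"
    by (intro bounded_linear_minus bounded_linear_intros)
  have Yt: "(Y \<longlongrightarrow> Y x) (at x)" using Y by (simp add: isCont_def)
  have XD: "((\<lambda>y. (1 / norm (y - x)) *\<^sub>R (X y - X x - X1 (y - x))) \<longlongrightarrow> 0) (at x)"
    using der by (simp add: has_derivative_at_within divide_inverse)
  have X1b: "\<forall>\<^sub>F y in at x. norm ((1 / norm (y - x)) *\<^sub>R X1 (y - x)) \<le> norm X1"
    by (simp add: eventually_at_filter divide_simps)
       (metis (mono_tags, lifting) always_eventually mult.commute norm_blinfun)
  have Z: "((\<lambda>y. (Y y - Y x) o\<^sub>L (((1 / norm (y - x)) *\<^sub>R X1 (y - x)) o\<^sub>L Y x)) \<longlongrightarrow> 0) (at x)"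
  proof (rule tendsto_norm_zero_cancel, rule tendsto_sandwich[of "\<lambda>_. 0"])
    show "\<forall>\<^sub>F y in at x. norm ((Y y - Y x) o\<^sub>L (((1 / norm (y - x)) *\<^sub>R X1 (y - x)) o\<^sub>L Y x))
        \<le> norm (Y y - Y x) * (norm X1 * norm (Y x))"
      using X1b
    proof eventually_elim
      case (elim y)
      then show ?case
        by (meson norm_blinfun_compose mult_left_mono mult_right_mono norm_ge_zero order_trans)
    qed
    have "((\<lambda>y. Y y - Y x) \<longlongrightarrow> 0) (at x)" using Yt LIM_zero by blast
    then show "((\<lambda>y. norm (Y y - Y x) * (norm X1 * norm (Y x))) \<longlongrightarrow> 0) (at x)"
      by (intro tendsto_mult_left_zero tendsto_norm_zero)
  qed auto
  have main: "((\<lambda>y. - (Y y o\<^sub>L (((1 / norm (y - x)) *\<^sub>R (X y - X x - X1 (y - x))) o\<^sub>L Y x))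
      - ((Y y - Y x) o\<^sub>L (((1 / norm (y - x)) *\<^sub>R X1 (y - x)) o\<^sub>L Y x))) \<longlongrightarrow> - (Y x o\<^sub>L (0 o\<^sub>L Y x)) - 0) (at x)"
    by (intro tendsto_intros Yt XD Z)
  have "((\<lambda>y. (1 / norm (y - x)) *\<^sub>R (Y y - Y x - - (Y x o\<^sub>L (X1 (y - x) o\<^sub>L Y x)))) \<longlongrightarrow> 0) (at x)"
  proof (rule Lim_transform_eventually)
    show "((\<lambda>y. - (Y y o\<^sub>L (((1 / norm (y - x)) *\<^sub>R (X y - X x - X1 (y - x))) o\<^sub>L Y x))
      - ((Y y - Y x) o\<^sub>L (((1 / norm (y - x)) *\<^sub>R X1 (y - x)) o\<^sub>L Y x))) \<longlongrightarrow> 0) (at x)"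
      using main by simp
    have "\<forall>\<^sub>F y in at x. y \<in> U" using U eventually_at_in_open' by blast
    then show "\<forall>\<^sub>F y in at x. - (Y y o\<^sub>L (((1 / norm (y - x)) *\<^sub>R (X y - X x - X1 (y - x))) o\<^sub>L Y x))
      - ((Y y - Y x) o\<^sub>L (((1 / norm (y - x)) *\<^sub>R X1 (y - x)) o\<^sub>L Y x))
      = (1 / norm (y - x)) *\<^sub>R (Y y - Y x - - (Y x o\<^sub>L (X1 (y - x) o\<^sub>L Y x)))"
    proof eventually_elim
      case (elim y)
      show ?case
        by (intro blinfun_eqI) (simp add: blinfun.bilinear_simps id[OF elim] id[OF U(2)] algebra_simps)
    qed
  qed
  then show ?thesis
    using lin by (simp add: has_derivative_at_within divide_inverse)
qed

text \<open>The derivative of a pointwise inverse \<open>Y\<close> of \<open>X\<close>, written with compositions only, so that its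
regularity can be read off from that of \<open>Y\<close> and of the derivative \<open>X1\<close> of \<open>X\<close>.\<close>

definition inverse_deriv :: "('b::real_normed_vector \<Rightarrow>\<^sub>L 'b) \<Rightarrow> ('a::real_normed_vector \<Rightarrow>\<^sub>L 'b \<Rightarrow>\<^sub>L 'b)
    \<Rightarrow> ('a \<Rightarrow>\<^sub>L 'b \<Rightarrow>\<^sub>L 'b)" where
  "inverse_deriv Y X1 = - (bounded_bilinear.prod_right (o\<^sub>L) Y o\<^sub>L (bounded_bilinear.prod_left (o\<^sub>L) Y o\<^sub>L X1))"

lemma inverse_deriv_apply: "blinfun_apply (inverse_deriv Y X1) = (\<lambda>h. - (Y o\<^sub>L (X1 h o\<^sub>L Y)))"
  by (rule ext) (simp add: inverse_deriv_def uminus_blinfun.rep_eq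
     bounded_bilinear.prod_right.rep_eq[OF bounded_bilinear_blinfun_compose]
     bounded_bilinear.prod_left.rep_eq[OF bounded_bilinear_blinfun_compose])

lemma C11_on_blinfun_inverse:
  fixes X Y :: "'a::real_normed_vector \<Rightarrow> 'b::real_normed_vector \<Rightarrow>\<^sub>L 'b"
  assumes X: "C11_on X U" and U: "open U"
    and inv: "\<And>x. x \<in> U \<Longrightarrow> X x o\<^sub>L Y x = id_blinfun" "\<And>x. x \<in> U \<Longrightarrow> Y x o\<^sub>L X x = id_blinfun"
  shows "C11_on Y U"
proof -
  from X obtain X1 where X1: "\<And>x. x \<in> U \<Longrightarrow> (X has_derivative blinfun_apply (X1 x)) (at x)"
    "locally_lipschitz_on X1 U" by (rule C11_onE) (rule that, auto)
  have Y: "locally_lipschitz_on Y U"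
    by (rule locally_lipschitz_on_blinfun_inverse[OF C11_on_imp_locally_lipschitz[OF X U] U inv])
  note b = bounded_bilinear_blinfun_compose
  have m: "bounded_linear (uminus :: ('a \<Rightarrow>\<^sub>L 'b \<Rightarrow>\<^sub>L 'b) \<Rightarrow> _)"
    by (rule bounded_linear_minus[OF bounded_linear_ident])
  show ?thesis
  proof (rule C11_onI)
    fix x assume x: "x \<in> U"
    show "(Y has_derivative blinfun_apply (inverse_deriv (Y x) (X1 x))) (at x)"
      using has_derivative_blinfun_inverse[OF X1(1)[OF x] locally_lipschitz_on_isCont[OF Y U x] U x inv]
      unfolding inverse_deriv_apply .
  next
    show "locally_lipschitz_on (\<lambda>x. inverse_deriv (Y x) (X1 x)) U"
      unfolding inverse_deriv_def
      by (intro locally_lipschitz_on_linear[OF m] locally_lipschitz_on_bilinear[OF b]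
        locally_lipschitz_on_linear[OF bounded_bilinear.bounded_linear_prod_right[OF b]]
        locally_lipschitz_on_linear[OF bounded_bilinear.bounded_linear_prod_left[OF b]] Y U X1(2))
  qed
qed

lemma C21_on_blinfun_inverse:
  fixes X Y :: "'a::real_normed_vector \<Rightarrow> 'b::real_normed_vector \<Rightarrow>\<^sub>L 'b"
  assumes X: "C21_on X U" and U: "open U"
    and inv: "\<And>x. x \<in> U \<Longrightarrow> X x o\<^sub>L Y x = id_blinfun" "\<And>x. x \<in> U \<Longrightarrow> Y x o\<^sub>L X x = id_blinfun"
  shows "C21_on Y U"
proof -
  from X obtain X1 where X1: "\<And>x. x \<in> U \<Longrightarrow> (X has_derivative blinfun_apply (X1 x)) (at x)"
    "C11_on X1 U" by (rule C21_onE) (rule that, auto)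
  have Y: "C11_on Y U"
    by (rule C11_on_blinfun_inverse[OF C21_on_imp_C11_on[OF X U] U inv])
  note b = bounded_bilinear_blinfun_compose
  have m: "bounded_linear (uminus :: ('a \<Rightarrow>\<^sub>L 'b \<Rightarrow>\<^sub>L 'b) \<Rightarrow> _)"
    by (rule bounded_linear_minus[OF bounded_linear_ident])
  show ?thesis
  proof (rule C21_onI)
    fix x assume x: "x \<in> U"
    show "(Y has_derivative blinfun_apply (inverse_deriv (Y x) (X1 x))) (at x)"
      using has_derivative_blinfun_inverse[OF X1(1)[OF x]
        locally_lipschitz_on_isCont[OF C11_on_imp_locally_lipschitz[OF Y U] U x] U x inv]
      unfolding inverse_deriv_apply .
  next
    show "C11_on (\<lambda>x. inverse_deriv (Y x) (X1 x)) U"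
      unfolding inverse_deriv_def
      by (intro C11_on_linear_compose[OF m] C11_on_bilinear[OF b]
        C11_on_linear_compose[OF bounded_bilinear.bounded_linear_prod_right[OF b]]
        C11_on_linear_compose[OF bounded_bilinear.bounded_linear_prod_left[OF b]] Y U X1(2))
  qed
qed

text \<open>The tubular coordinates below involve the derivatives of the charts, which are one class less
regular than the charts.\<close>

lemma C31_on_derivative:
  assumes "C31_on f U"
  obtains f1 where "\<And>x. x \<in> U \<Longrightarrow> (f has_derivative blinfun_apply (f1 x)) (at x)" "C21_on f1 U"
proof -
  from assms obtain f1 :: "'a \<Rightarrow> 'a \<Rightarrow>\<^sub>L 'b" and f2 :: "'a \<Rightarrow> 'a \<Rightarrow>\<^sub>L 'a \<Rightarrow>\<^sub>L 'b" and f3 :: "'a \<Rightarrow> 'a \<Rightarrow>\<^sub>L 'a \<Rightarrow>\<^sub>L 'a \<Rightarrow>\<^sub>L 'b"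
    where d: "\<forall>x\<in>U. (f has_derivative blinfun_apply (f1 x)) (at x)"
      "\<forall>x\<in>U. (f1 has_derivative blinfun_apply (f2 x)) (at x)"
      "\<forall>x\<in>U. (f2 has_derivative blinfun_apply (f3 x)) (at x)" "locally_lipschitz_on f3 U"
    unfolding C31_on_def by (elim exE conjE)
  have "C11_on f2 U" using d(3,4) by (intro C11_onI[of U f2 f3]) auto
  then have "C21_on f1 U" using d(2) by (intro C21_onI[of U f1 f2]) auto
  then show thesis using d(1) by (intro that[of f1]) auto
qed

section \<open>Limits of quadratically convergent iterations\<close>

lemma has_derivative_lipschitz_taylor:
  fixes f :: "'a::real_normed_vector \<Rightarrow> 'b::real_normed_vector"
  assumes S: "convex S" "y \<in> S" "z \<in> S"
    and der: "\<And>x. x \<in> S \<Longrightarrow> (f has_derivative blinfun_apply (f1 x)) (at x)"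
    and lip: "K-lipschitz_on S f1"
  shows "norm (f z - f y - f1 y (z - y)) \<le> K * (norm (z - y))\<^sup>2"
proof -
  have K: "K \<ge> 0" using lip lipschitz_on_nonneg by blast
  have seg: "closed_segment y z \<subseteq> S" using S closed_segment_subset by blast
  have "norm ((f z - f1 y z) - (f y - f1 y y)) \<le> (K * norm (z - y)) * norm (z - y)"
  proof (rule differentiable_bound[where f = "\<lambda>x. f x - f1 y x" and f' = "\<lambda>x. blinfun_apply (f1 x - f1 y)"
        and S = "closed_segment y z"])
    fix x assume x: "x \<in> closed_segment y z"
    have "((\<lambda>x. f x - f1 y x) has_derivative (\<lambda>h. f1 x h - f1 y h)) (at x within closed_segment y z)"
      using has_derivative_at_withinI[OF der[OF subsetD[OF seg x]]]
      by (intro has_derivative_diff bounded_linear_imp_has_derivative blinfun.bounded_linear_right)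
    then show "((\<lambda>x. f x - f1 y x) has_derivative blinfun_apply (f1 x - f1 y)) (at x within closed_segment y z)"
      by (simp add: minus_blinfun.rep_eq)
    have "norm (f1 x - f1 y) \<le> K * dist x y"
      using lipschitz_onD[OF lip, of x y] seg x S by (auto simp: dist_norm)
    also have "\<dots> \<le> K * norm (z - y)"
      using segment_bound(1)[OF x] K by (simp add: dist_norm mult_left_mono)
    finally show "onorm (blinfun_apply (f1 x - f1 y)) \<le> K * norm (z - y)"
      by (simp add: norm_blinfun.rep_eq)
  qed auto
  then show ?thesis
    by (simp add: blinfun.bilinear_simps power2_eq_square algebra_simps)
qed

text \<open>Interpolation in the manner of Landau: evaluating the Taylor estimate at distance \<open>t\<close> from \<open>y\<close> in an
arbitrary direction bounds the derivative by values of the function.  A good choice of \<open>t\<close> turns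
smallness of \<open>f\<close> into smallness of \<open>f1\<close>.\<close>

lemma derivative_bound_from_values:
  fixes f :: "'a::real_normed_vector \<Rightarrow> 'b::real_normed_vector"
  assumes S: "convex S" "cball y t \<subseteq> S" and t: "t > 0"
    and der: "\<And>x. x \<in> S \<Longrightarrow> (f has_derivative blinfun_apply (f1 x)) (at x)"
    and lip: "K-lipschitz_on S f1"
    and b: "\<And>z. z \<in> cball y t \<Longrightarrow> norm (f z) \<le> b"
  shows "norm (f1 y) \<le> 2 * b / t + K * t"
proof (rule norm_blinfun_bound)
  have K: "K \<ge> 0" using lip lipschitz_on_nonneg by blast
  have b0: "b \<ge> 0" using b[of y] t by (smt (verit) centre_in_cball norm_ge_zero)
  show "0 \<le> 2 * b / t + K * t" using K b0 t by auto
  fix u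
  show "norm (f1 y u) \<le> (2 * b / t + K * t) * norm u"
  proof (cases "u = 0")
    case False
    define h where "h = (t / norm u) *\<^sub>R u"
    have nh: "norm h = t" using False t by (simp add: h_def)
    have y: "y \<in> cball y t" and z: "y + h \<in> cball y t" using t nh by (auto simp: dist_norm)
    have "norm (f (y + h) - f y - f1 y h) \<le> K * t\<^sup>2"
      using has_derivative_lipschitz_taylor[OF S(1) subsetD[OF S(2) y] subsetD[OF S(2) z] der lip] nh by simp
    moreover have "norm (f (y + h)) \<le> b" "norm (f y) \<le> b" using b y z by auto
    moreover have "f1 y h = (f (y + h) - f y) - (f (y + h) - f y - f1 y h)" by simp
    ultimately have "norm (f1 y h) \<le> 2 * b + K * t\<^sup>2"
      by (smt (verit) norm_triangle_ineq4)
    moreover have "norm (f1 y h) = t / norm u * norm (f1 y u)"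
      using t by (simp add: h_def blinfun.scaleR_right)
    ultimately show ?thesis
      using t False by (simp add: field_simps power2_eq_square)
  qed simp
qed

lemma C21_on_ballE:
  assumes "C21_on f U" "open U" "x \<in> U"
  obtains e K f1 f2 where "e > 0" "ball x e \<subseteq> U"
    "\<And>y. y \<in> ball x e \<Longrightarrow> (f has_derivative blinfun_apply (f1 y)) (at y)"
    "\<And>y. y \<in> ball x e \<Longrightarrow> (f1 has_derivative blinfun_apply (f2 y)) (at y)"
    "K-lipschitz_on (ball x e) f" "K-lipschitz_on (ball x e) f1" "K-lipschitz_on (ball x e) f2"
    "\<And>y. y \<in> ball x e \<Longrightarrow> norm (f1 y) \<le> K" "\<And>y. y \<in> ball x e \<Longrightarrow> norm (f2 y) \<le> K"
proof -
  from assms(1) obtain f1 where f1: "\<And>x. x \<in> U \<Longrightarrow> (f has_derivative blinfun_apply (f1 x)) (at x)"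
    "C11_on f1 U" by (rule C21_onE) (rule that, auto)
  from f1(2) obtain f2 where f2: "\<And>x. x \<in> U \<Longrightarrow> (f1 has_derivative blinfun_apply (f2 x)) (at x)"
    "locally_lipschitz_on f2 U" by (rule C11_onE) (rule that, auto)
  obtain a A where a: "a > 0" "ball x a \<subseteq> U" "A-lipschitz_on (ball x a) f"
    using locally_lipschitz_on_ball[OF C21_on_imp_locally_lipschitz[OF assms(1,2)] assms(2,3)] by metis
  obtain b B where b: "b > 0" "B-lipschitz_on (ball x b) f1"
    using locally_lipschitz_on_ball[OF C11_on_imp_locally_lipschitz[OF f1(2) assms(2)] assms(2,3)] by metis
  obtain c C where c: "c > 0" "C-lipschitz_on (ball x c) f2"
    using locally_lipschitz_on_ball[OF f2(2) assms(2,3)] by metis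
  define e where "e = min a (min b c)"
  define K where "K = max (max A (max B C)) (max (norm (f1 x) + B * e) (norm (f2 x) + C * e))"
  have e: "e > 0" "ball x e \<subseteq> U" using a b c by (auto simp: e_def)
  have l: "B-lipschitz_on (ball x e) f1" "C-lipschitz_on (ball x e) f2"
    by (rule lipschitz_on_subset[OF b(2)]; auto simp: e_def)
       (rule lipschitz_on_subset[OF c(2)]; auto simp: e_def)
  show thesis
  proof (rule that[OF e, of f1 f2 K])
    show "K-lipschitz_on (ball x e) f" by (rule lipschitz_on_mono[OF a(3)]) (auto simp: e_def K_def le_max_iff_disj)
    show "K-lipschitz_on (ball x e) f1" by (rule lipschitz_on_mono[OF l(1)]) (auto simp: K_def le_max_iff_disj)
    show "K-lipschitz_on (ball x e) f2" by (rule lipschitz_on_mono[OF l(2)]) (auto simp: K_def le_max_iff_disj)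
    show "norm (f1 y) \<le> K" if "y \<in> ball x e" for y
      using lipschitz_on_ball_bounded[OF l(1) that] by (auto simp: K_def le_max_iff_disj)
    show "norm (f2 y) \<le> K" if "y \<in> ball x e" for y
      using lipschitz_on_ball_bounded[OF l(2) that] by (auto simp: K_def le_max_iff_disj)
  qed (use f1 f2 e in auto)
qed

lemma geometric_increments_converge:
  fixes z :: "nat \<Rightarrow> 'a::banach"
  assumes inc: "\<And>k. norm (z (Suc k) - z k) \<le> (1/2)^k * r"
  shows "z \<longlonglongrightarrow> lim z" "norm (lim z - z 0) \<le> 2 * r"
proof -
  have sm: "summable (\<lambda>k. (1/2::real)^k * r)"
    by (intro summable_mult2 summable_geometric) auto
  have "summable (\<lambda>k. z (Suc k) - z k)"
    by (rule summable_comparison_test[OF _ sm]) (use inc in auto)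
  then have s: "(\<lambda>n. z n - z 0) \<longlonglongrightarrow> (\<Sum>k. z (Suc k) - z k)"
    by (simp add: summable_LIMSEQ sum_lessThan_telescope flip: sum_lessThan_telescope)
  have "z \<longlonglongrightarrow> (\<Sum>k. z (Suc k) - z k) + z 0"
    using tendsto_add[OF s tendsto_const[of "z 0"]] by simp
  then have L: "lim z = (\<Sum>k. z (Suc k) - z k) + z 0" by (rule limI)
  then show "z \<longlonglongrightarrow> lim z" using \<open>z \<longlonglongrightarrow> (\<Sum>k. z (Suc k) - z k) + z 0\<close> by simp
  have "norm (\<Sum>k. z (Suc k) - z k) \<le> (\<Sum>k. (1/2::real)^k * r)"
    by (rule norm_suminf_le[OF inc sm])
  also have "\<dots> = 2 * r"
    using suminf_mult2[OF summable_geometric[of "1/2::real"], of r] suminf_geometric[of "1/2::real"] by simp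
  finally show "norm (lim z - z 0) \<le> 2 * r" by (simp add: L)
qed

text \<open>Steps that shrink quadratically shrink by any prescribed factor \<open>\<rho>\<close> once they are short enough; the
orbit then travels at most twice its first step and cannot leave the ball.\<close>

lemma iterates_near_fixed_point:
  fixes f :: "'a::real_normed_vector \<Rightarrow> 'a"
  assumes e: "e > 0" and lip: "A-lipschitz_on (ball x e) f" and fx: "f x = x"
    and quad: "\<And>y. y \<in> ball x e \<Longrightarrow> f y \<in> ball x e \<Longrightarrow> norm (f (f y) - f y) \<le> C * (norm (f y - y))\<^sup>2"
    and C: "C \<ge> 0" and \<rho>: "0 < \<rho>" "\<rho> \<le> 1/2" and s: "s > 0"
  obtains \<delta> where "0 < \<delta>" "\<delta> \<le> e"
    "\<And>y k. y \<in> ball x \<delta> \<Longrightarrow> (f ^^ k) y \<in> ball x e"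
    "\<And>y k. y \<in> ball x \<delta> \<Longrightarrow> norm (f ((f ^^ k) y) - (f ^^ k) y) \<le> \<rho> ^ k * norm (f y - y)"
    "\<And>y. y \<in> ball x \<delta> \<Longrightarrow> norm (f y - y) \<le> s"
proof -
  have A: "A \<ge> 0" using lip lipschitz_on_nonneg by blast
  \<comment> \<open>The first step has length at most \<open>(A + 1) * \<delta>\<close>; the three terms make it shorter than \<open>s\<close>, short
    enough for contraction by \<open>\<rho>\<close>, and short enough to keep the orbit in the ball.\<close>
  define \<delta> where "\<delta> = min (s / (A + 1)) (min (\<rho> / ((C + 1) * (A + 1))) (e / (4 * (A + 1))))"
  have \<delta>0: "\<delta> > 0" using e \<rho> s A C by (simp add: \<delta>_def)
  have a0: "(A + 1) * \<delta> \<le> s"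
  proof -
    have "\<delta> \<le> s / (A + 1)" by (simp add: \<delta>_def)
    then show ?thesis using A by (simp add: field_simps)
  qed
  have a1: "C * ((A + 1) * \<delta>) \<le> \<rho>"
  proof -
    have "\<delta> \<le> \<rho> / ((C + 1) * (A + 1))" by (simp add: \<delta>_def)
    moreover have "(C + 1) * (A + 1) > 0" using A C by simp
    ultimately have "(C + 1) * ((A + 1) * \<delta>) \<le> \<rho>" by (simp only: pos_le_divide_eq mult_ac)
    moreover have "(A + 1) * \<delta> \<ge> 0" using A \<delta>0 by simp
    ultimately show ?thesis by (simp add: algebra_simps)
  qed
  have a2: "4 * ((A + 1) * \<delta>) \<le> e"
  proof -
    have "\<delta> \<le> e / (4 * (A + 1))" by (simp add: \<delta>_def)
    then show ?thesis using A by (simp add: field_simps)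
  qed
  have Ad: "A * \<delta> \<ge> 0" using A \<delta>0 by simp
  have \<delta>e: "\<delta> < e" using a2 Ad \<delta>0 by (simp add: algebra_simps)
  have r0: "norm (f y - y) \<le> (A + 1) * \<delta>" if y: "y \<in> ball x \<delta>" for y
  proof -
    have "norm (f y - f x) \<le> A * dist y x"
      using lipschitz_onD[OF lip, of y x] y \<delta>e e by (auto simp: dist_norm dist_commute)
    also have "\<dots> \<le> A * \<delta>" using y A by (intro mult_left_mono) (auto simp: dist_commute)
    finally have "norm (f y - f x) \<le> A * \<delta>" .
    moreover have "norm (y - x) \<le> \<delta>" using y by (auto simp: dist_norm norm_minus_commute)
    moreover have "norm (f y - y) \<le> norm (f y - f x) + norm (y - x)"
      using norm_triangle_ineq4[of "f y - f x" "y - x"] fx by simp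
    ultimately show ?thesis unfolding distrib_right by linarith
  qed
  have orbit: "(f ^^ k) y \<in> ball x e \<and> norm (f ((f ^^ k) y) - (f ^^ k) y) \<le> \<rho> ^ k * norm (f y - y)
      \<and> norm ((f ^^ k) y - y) \<le> (2 - 2 * \<rho> ^ k) * norm (f y - y)" if y: "y \<in> ball x \<delta>" for y k
  proof (induction k)
    case 0
    then show ?case using y \<delta>e by auto
  next
    case (Suc k)
    let ?g = "(f ^^ k) y" and ?r = "norm (f y - y)"
    have rk: "norm (f ?g - ?g) \<le> \<rho> ^ k * ?r" using Suc by blast
    have pk: "\<rho> ^ k \<le> 1" using \<rho> by (simp add: power_le_one)
    have close: "norm (f ?g - y) \<le> (2 - 2 * \<rho> ^ Suc k) * ?r"
    proof -
      have "norm (f ?g - y) \<le> norm (f ?g - ?g) + norm (?g - y)"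
        by (metis diff_add_cancel add_diff_eq norm_triangle_ineq)
      also have "\<dots> \<le> \<rho> ^ k * ?r + (2 - 2 * \<rho> ^ k) * ?r" using Suc by auto
      also have "\<dots> = (2 - \<rho> ^ k) * ?r" by (simp add: algebra_simps)
      also have "\<dots> \<le> (2 - 2 * \<rho> ^ Suc k) * ?r"
        using \<rho> mult_left_mono[OF \<rho>(2), of "\<rho> ^ k"] by (intro mult_right_mono) (auto simp: mult_ac)
      finally show ?thesis .
    qed
    have inb: "f ?g \<in> ball x e"
    proof -
      have "norm (f ?g - y) \<le> 2 * ?r"
        by (rule order_trans[OF close]) (intro mult_right_mono, use \<rho> in auto)
      then have "norm (f ?g - y) \<le> 2 * ((A + 1) * \<delta>)" using r0[OF y] by linarith
      moreover have "norm (y - x) < \<delta>" using y by (auto simp: dist_norm norm_minus_commute)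
      moreover have "norm (f ?g - x) \<le> norm (f ?g - y) + norm (y - x)"
        by (metis diff_add_cancel add_diff_eq norm_triangle_ineq)
      ultimately show ?thesis using a2 Ad \<delta>0
        by (simp add: dist_norm norm_minus_commute algebra_simps)
    qed
    have "norm (f (f ?g) - f ?g) \<le> C * (norm (f ?g - ?g))\<^sup>2" using quad inb Suc by blast
    also have "\<dots> = C * norm (f ?g - ?g) * norm (f ?g - ?g)" by (simp add: power2_eq_square)
    also have "\<dots> \<le> \<rho> * (\<rho> ^ k * ?r)"
    proof (rule mult_mono[OF _ rk])
      have "\<rho> ^ k * ?r \<le> 1 * ?r" using pk by (intro mult_right_mono) auto
      then have "norm (f ?g - ?g) \<le> ?r" using rk by simp
      then have "C * norm (f ?g - ?g) \<le> C * ((A + 1) * \<delta>)" using r0[OF y] C by (intro mult_left_mono) auto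
      then show "C * norm (f ?g - ?g) \<le> \<rho>" using a1 by linarith
    qed (use \<rho> in auto)
    finally show ?case using inb close by simp
  qed
  show thesis
  proof (rule that[OF \<delta>0])
    show "norm (f y - y) \<le> s" if "y \<in> ball x \<delta>" for y
      using r0[OF that] a0 by linarith
  qed (use \<delta>e orbit in auto)
qed

lemma has_derivative_blinfun_chain:
  fixes f1 :: "'b::real_normed_vector \<Rightarrow> 'b \<Rightarrow>\<^sub>L 'c::real_normed_vector" and g1 :: "'a::real_normed_vector \<Rightarrow> 'a \<Rightarrow>\<^sub>L 'b"
  assumes "(f1 has_derivative blinfun_apply f2) (at (g x))" "(g has_derivative blinfun_apply (g1 x)) (at x)"
    and "(g1 has_derivative blinfun_apply g2) (at x)"
  shows "((\<lambda>y. f1 (g y) o\<^sub>L g1 y) has_derivative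
     blinfun_apply ((bounded_bilinear.prod_right (o\<^sub>L) (f1 (g x)) o\<^sub>L g2)
       + (bounded_bilinear.prod_left (o\<^sub>L) (g1 x) o\<^sub>L (f2 o\<^sub>L g1 x)))) (at x)"
proof -
  have "((\<lambda>y. f1 (g y)) has_derivative blinfun_apply (f2 o\<^sub>L g1 x)) (at x)"
    using has_derivative_compose[OF assms(2,1)] by (simp add: blinfun_compose.rep_eq o_def)
  from has_derivative_blinfun_bilinear[OF bounded_bilinear_blinfun_compose this assms(3)]
  show ?thesis .
qed

text \<open>The second derivative of a composition \<open>f \<circ> g\<close>, where \<open>a1\<close>, \<open>a2\<close> are the derivatives of \<open>f\<close> at the
image point and \<open>b1\<close>, \<open>b2\<close> those of \<open>g\<close>.\<close>

definition chain_deriv2 :: "('b::real_normed_vector \<Rightarrow>\<^sub>L 'c::real_normed_vector) \<Rightarrow> ('b \<Rightarrow>\<^sub>L 'b \<Rightarrow>\<^sub>L 'c)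
    \<Rightarrow> ('a::real_normed_vector \<Rightarrow>\<^sub>L 'b) \<Rightarrow> ('a \<Rightarrow>\<^sub>L 'a \<Rightarrow>\<^sub>L 'b) \<Rightarrow> ('a \<Rightarrow>\<^sub>L 'a \<Rightarrow>\<^sub>L 'c)" where
  "chain_deriv2 a1 a2 b1 b2 = (bounded_bilinear.prod_right (o\<^sub>L) a1 o\<^sub>L b2)
       + (bounded_bilinear.prod_left (o\<^sub>L) b1 o\<^sub>L (a2 o\<^sub>L b1))"

lemma chain_deriv2_apply: "chain_deriv2 a1 a2 b1 b2 h = (a1 o\<^sub>L b2 h) + (a2 (b1 h) o\<^sub>L b1)"
  by (simp add: chain_deriv2_def plus_blinfun.rep_eq
     bounded_bilinear.prod_right.rep_eq[OF bounded_bilinear_blinfun_compose]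
     bounded_bilinear.prod_left.rep_eq[OF bounded_bilinear_blinfun_compose])

lemma norm_chain_deriv2:
  "norm (chain_deriv2 a1 a2 b1 b2) \<le> norm a1 * norm b2 + norm a2 * norm b1 * norm b1"
proof (rule norm_blinfun_bound)
  fix h
  have "norm (a1 o\<^sub>L b2 h) \<le> norm a1 * (norm b2 * norm h)"
    by (meson norm_blinfun_compose norm_blinfun mult_left_mono norm_ge_zero order_trans)
  moreover have "norm (a2 (b1 h) o\<^sub>L b1) \<le> (norm a2 * (norm b1 * norm h)) * norm b1"
    by (meson norm_blinfun_compose norm_blinfun mult_left_mono mult_right_mono norm_ge_zero order_trans)
  ultimately show "norm (chain_deriv2 a1 a2 b1 b2 h)
      \<le> (norm a1 * norm b2 + norm a2 * norm b1 * norm b1) * norm h"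
    unfolding chain_deriv2_apply
    using norm_triangle_ineq[of "a1 o\<^sub>L b2 h" "a2 (b1 h) o\<^sub>L b1"] by (simp add: algebra_simps)
qed simp

lemma continuous_on_chain_deriv2:
  assumes "continuous_on S a1" "continuous_on S a2" "continuous_on S b1" "continuous_on S b2"
  shows "continuous_on S (\<lambda>x. chain_deriv2 (a1 x) (a2 x) (b1 x) (b2 x))"
proof -
  note b = bounded_bilinear_blinfun_compose
  note c = bounded_bilinear.continuous_on[OF b]
  note l = bounded_linear.continuous_on[OF bounded_bilinear.bounded_linear_prod_left[OF b]]
  note r = bounded_linear.continuous_on[OF bounded_bilinear.bounded_linear_prod_right[OF b]]
  show ?thesis unfolding chain_deriv2_def
    by (intro continuous_on_add c l r assms)
qed

lemma C2_on_cong: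
  assumes "C2_on f U" "open U" "\<And>x. x \<in> U \<Longrightarrow> f x = g x"
  shows "C2_on g U"
proof -
  from assms(1) obtain f1 f2 where d: "\<forall>x\<in>U. (f has_derivative blinfun_apply (f1 x)) (at x)"
    "\<forall>x\<in>U. (f1 has_derivative blinfun_apply (f2 x)) (at x)" "continuous_on U f2"
    unfolding C2_on_def by (elim exE conjE)
  have "\<forall>x\<in>U. (g has_derivative blinfun_apply (f1 x)) (at x)"
    using d(1) has_derivative_transform_within_open[OF _ assms(2)] assms(3) by blast
  then show ?thesis using d(2,3) unfolding C2_on_def by (intro exI[of _ f1] exI[of _ f2]) simp
qed

text \<open>Two applications of termwise differentiation, for the series and for the series of derivatives; the
second derivative is continuous as a uniform limit.\<close>

lemma C2_on_series:
  fixes h :: "nat \<Rightarrow> 'a::real_normed_vector \<Rightarrow> 'b::banach"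
  assumes S: "convex S" "open S"
    and h: "\<And>n x. x \<in> S \<Longrightarrow> (h n has_derivative blinfun_apply (h1 n x)) (at x)"
      "\<And>n x. x \<in> S \<Longrightarrow> (h1 n has_derivative blinfun_apply (h2 n x)) (at x)"
      "\<And>n. continuous_on S (h2 n)"
    and M: "summable M" "\<And>n x. x \<in> S \<Longrightarrow> norm (h1 n x) \<le> M n" "\<And>n x. x \<in> S \<Longrightarrow> norm (h2 n x) \<le> M n"
    and s: "\<And>x. x \<in> S \<Longrightarrow> (\<lambda>n. h n x) sums s x"
  shows "C2_on s S"
proof (cases "S = {}")
  case True
  then show ?thesis unfolding C2_on_def by simp
next
  case False
  then obtain x0 where x0: "x0 \<in> S" by blast
  define s1 s2 where "s1 = (\<lambda>x. \<Sum>n. h1 n x)" and "s2 = (\<lambda>x. \<Sum>n. h2 n x)"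
  have u1: "uniform_limit S (\<lambda>n x. \<Sum>i<n. h1 i x) s1 sequentially"
    unfolding s1_def by (rule Weierstrass_m_test) (use M in auto)
  have u2: "uniform_limit S (\<lambda>n x. \<Sum>i<n. h2 i x) s2 sequentially"
    unfolding s2_def by (rule Weierstrass_m_test) (use M in auto)
  have ev: "\<forall>\<^sub>F n in sequentially. \<forall>x\<in>S. \<forall>k. norm ((\<Sum>i<n. blinfun_apply (H i x) k) - blinfun_apply (s' x) k) \<le> e * norm k"
    if "uniform_limit S (\<lambda>n x. \<Sum>i<n. H i x) s' sequentially" "e > 0"
    for H :: "nat \<Rightarrow> 'a \<Rightarrow> 'a \<Rightarrow>\<^sub>L 'c::real_normed_vector" and s' e
    using uniform_limitD[OF that]
  proof eventually_elim
    case (elim n)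
    show ?case
    proof (intro ballI allI)
      fix x k assume "x \<in> S"
      then have "norm ((\<Sum>i<n. H i x) - s' x) \<le> e" using elim by (simp add: dist_norm less_imp_le)
      then have "norm (((\<Sum>i<n. H i x) - s' x) k) \<le> e * norm k"
        by (meson mult_right_mono norm_blinfun norm_ge_zero order_trans)
      then show "norm ((\<Sum>i<n. H i x k) - s' x k) \<le> e * norm k"
        by (simp add: blinfun.bilinear_simps)
    qed
  qed
  have d1: "(s has_derivative blinfun_apply (s1 x)) (at x)" if x: "x \<in> S" for x
  proof -
    have "\<exists>g. \<forall>x\<in>S. (\<lambda>n. h n x) sums (g x) \<and> (g has_derivative blinfun_apply (s1 x)) (at x within S)"
      by (rule has_derivative_series[OF S(1) has_derivative_at_withinI[OF h(1)] ev[OF u1] x0 s[OF x0]]) auto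
    then obtain g where g: "\<And>x. x \<in> S \<Longrightarrow> (\<lambda>n. h n x) sums (g x)"
      "\<And>x. x \<in> S \<Longrightarrow> (g has_derivative blinfun_apply (s1 x)) (at x within S)" by blast
    have eq: "g y = s y" if "y \<in> S" for y using sums_unique2[OF g(1)[OF that] s[OF that]] .
    have "(g has_derivative blinfun_apply (s1 x)) (at x)"
      using g(2)[OF x] at_within_open[OF x S(2)] by simp
    then show ?thesis by (rule has_derivative_transform_within_open[OF _ S(2) x eq])
  qed
  have d2: "(s1 has_derivative blinfun_apply (s2 x)) (at x)" if x: "x \<in> S" for x
  proof -
    have sm: "(\<lambda>n. h1 n y) sums s1 y" if y: "y \<in> S" for y
      unfolding s1_def by (intro summable_sums summable_comparison_test[OF _ M(1)]) (use M y in auto)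
    have "\<exists>g. \<forall>x\<in>S. (\<lambda>n. h1 n x) sums (g x) \<and> (g has_derivative blinfun_apply (s2 x)) (at x within S)"
      by (rule has_derivative_series[OF S(1) has_derivative_at_withinI[OF h(2)] ev[OF u2] x0 sm[OF x0]]) auto
    then obtain g where g: "\<And>x. x \<in> S \<Longrightarrow> (\<lambda>n. h1 n x) sums (g x)"
      "\<And>x. x \<in> S \<Longrightarrow> (g has_derivative blinfun_apply (s2 x)) (at x within S)" by blast
    have eq: "g y = s1 y" if "y \<in> S" for y using sums_unique2[OF g(1)[OF that] sm[OF that]] .
    have "(g has_derivative blinfun_apply (s2 x)) (at x)"
      using g(2)[OF x] at_within_open[OF x S(2)] by simp
    then show ?thesis by (rule has_derivative_transform_within_open[OF _ S(2) x eq])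
  qed
  have "continuous_on S s2"
    by (rule uniform_limit_theorem[OF _ u2]) (auto intro!: always_eventually continuous_on_sum h(3))
  then show ?thesis using d1 d2 unfolding C2_on_def by (intro exI[of _ s1] exI[of _ s2]) simp
qed

text \<open>Applying the quadratic estimate twice shows that \<open>v\<close> is at most \<open>C\<^sup>3\<close> times the fourth power of the
step length.  Interpolation over distance \<open>s\<^sup>2\<close> bounds the first derivative of \<open>v\<close> by \<open>O(s\<^sup>2)\<close>, and
interpolation over distance \<open>s\<close> then bounds the second derivative by \<open>O(s)\<close>.  Stating this for an
upper bound \<open>s > 0\<close> of the step length covers fixed points, where the step length is \<open>0\<close>.\<close>

lemma iterate_gap_derivatives_small:
  fixes f :: "'a::real_normed_vector \<Rightarrow> 'a"
  defines "v \<equiv> \<lambda>y. f (f (f y)) - f (f y)"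
  assumes lip: "K-lipschitz_on (ball x e) f"
    and quad: "\<And>y. y \<in> ball x e \<Longrightarrow> f y \<in> ball x e \<Longrightarrow> norm (f (f y) - f y) \<le> C * (norm (f y - y))\<^sup>2"
    and C: "C \<ge> 0" and d: "d > 0" "d \<le> e"
    and orbit: "\<And>y. y \<in> ball x d \<Longrightarrow> f y \<in> ball x e" "\<And>y. y \<in> ball x d \<Longrightarrow> f (f y) \<in> ball x e"
    and v1: "\<And>y. y \<in> ball x d \<Longrightarrow> (v has_derivative blinfun_apply (v1 y)) (at y)"
    and v2: "\<And>y. y \<in> ball x d \<Longrightarrow> (v1 has_derivative blinfun_apply (v2 y)) (at y)"
    and lip1: "L-lipschitz_on (ball x d) v1" and lip2: "L-lipschitz_on (ball x d) v2"
  obtains c s0 where "c \<ge> 0" "s0 > 0"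
    "\<And>y s. y \<in> ball x (d/2) \<Longrightarrow> 0 < s \<Longrightarrow> s \<le> s0 \<Longrightarrow> norm (f y - y) \<le> s \<Longrightarrow> norm (v1 y) \<le> c * s"
    "\<And>y s. y \<in> ball x (d/2) \<Longrightarrow> 0 < s \<Longrightarrow> s \<le> s0 \<Longrightarrow> norm (f y - y) \<le> s \<Longrightarrow> norm (v2 y) \<le> c * s"
proof -
  have K: "K \<ge> 0" and L: "L \<ge> 0" using lip lip1 lipschitz_on_nonneg by blast+
  define r where "r = (\<lambda>y. norm (f y - y))"
  have r0: "r y \<ge> 0" for y by (simp add: r_def)
  have v_quartic: "norm (v y) \<le> C ^ 3 * r y ^ 4" if y: "y \<in> ball x d" for y
  proof -
    have ye: "y \<in> ball x e" using y d by auto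
    have a: "norm (f (f y) - f y) \<le> C * (r y)\<^sup>2"
      unfolding r_def by (rule quad[OF ye orbit(1)[OF y]])
    have "norm (v y) \<le> C * (norm (f (f y) - f y))\<^sup>2"
      unfolding v_def by (rule quad[OF orbit[OF y]])
    also have "\<dots> \<le> C * (C * (r y)\<^sup>2)\<^sup>2"
      using a C by (intro mult_left_mono power_mono) auto
    finally show ?thesis by (simp add: power_mult_distrib power2_eq_square power3_eq_cube power4_eq_xxxx mult_ac)
  qed
  have r_lip: "r z \<le> r y + (K + 1) * norm (z - y)" if "y \<in> ball x d" "z \<in> ball x d" for y z
  proof -
    have "norm (f z - f y) \<le> K * norm (z - y)"
      using lipschitz_onD[OF lip, of z y] that d by (auto simp: dist_norm)
    moreover have "f z - z = (f y - y) + ((f z - f y) - (z - y))" by simp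
    then have "r z \<le> r y + (norm (f z - f y) + norm (z - y))"
      unfolding r_def by (metis add_left_mono norm_triangle_ineq norm_triangle_ineq4 order_trans)
    ultimately show ?thesis by (simp add: algebra_simps)
  qed
  have near: "z \<in> ball x d" if "y \<in> ball x (3/4 * d)" "z \<in> cball y t" "t \<le> d/4" for y z t
    using that dist_triangle[of x z y] by auto
  \<comment> \<open>Interpolation over distance \<open>s\<^sup>2\<close>, where \<open>v\<close> is bounded by \<open>C ^ 3 * ((K + 2) * s) ^ 4\<close>.\<close>
  define c1 where "c1 = 2 * C ^ 3 * (K + 2) ^ 4 + L"
  have c1: "c1 \<ge> 0" using C K L by (simp add: c1_def)
  have v1_small: "norm (v1 y) \<le> c1 * s\<^sup>2"
    if y: "y \<in> ball x (3/4 * d)" and s: "0 < s" "s \<le> 1" "s \<le> d/4" and ry: "r y \<le> s" for y s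
  proof -
    have s2: "s\<^sup>2 \<le> s" using s by (simp add: power2_eq_square mult_left_le)
    have yd: "y \<in> ball x d" using y d by auto
    have "norm (v1 y) \<le> 2 * (C ^ 3 * ((K + 2) * s) ^ 4) / s\<^sup>2 + L * s\<^sup>2"
    proof (rule derivative_bound_from_values[OF convex_ball _ _ v1 lip1])
      show "cball y (s\<^sup>2) \<subseteq> ball x d" using near[OF y] s2 s by auto
      show "s\<^sup>2 > 0" using s by simp
      fix z assume z: "z \<in> cball y (s\<^sup>2)"
      then have zd: "z \<in> ball x d" using near[OF y] s2 s by auto
      have "norm (z - y) \<le> s" using z s2 by (auto simp: dist_norm norm_minus_commute)
      then have "(K + 1) * norm (z - y) \<le> (K + 1) * s" using K by (intro mult_left_mono) auto
      then have "r z \<le> (K + 2) * s" using r_lip[OF yd zd] ry by (simp add: algebra_simps)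
      then have "C ^ 3 * r z ^ 4 \<le> C ^ 3 * ((K + 2) * s) ^ 4"
        using r0 C by (intro mult_left_mono power_mono) auto
      then show "norm (v z) \<le> C ^ 3 * ((K + 2) * s) ^ 4" using v_quartic[OF zd] by linarith
    qed
    also have "\<dots> = c1 * s\<^sup>2"
    proof -
      define P where "P = (K + 2) ^ 4"
      have a: "((K + 2) * s) ^ 4 = P * (s\<^sup>2 * s\<^sup>2)"
        by (simp add: P_def power_mult_distrib power4_eq_xxxx power2_eq_square)
      have b: "2 * (X * (P * (t * t))) / t + L * t = (2 * X * P + L) * t" if "t > 0" for X t :: real
        using that by (simp add: field_simps)
      show ?thesis unfolding a c1_def P_def[symmetric] by (rule b) (use s in simp)
    qed
    finally show ?thesis .
  qed
  define c2 where "c2 = 2 * c1 * (K + 2)\<^sup>2 + L"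
  have c2: "c2 \<ge> 0" using c1 K L by (simp add: c2_def)
  \<comment> \<open>Within distance \<open>s\<close> of \<open>y\<close> the step length is at most \<open>(K + 2) * s\<close>.\<close>
  define s0 where "s0 = min 1 (d/4) / (K + 2)"
  have s0: "s0 > 0" using d K by (simp add: s0_def)
  have s0': "(K + 2) * s \<le> 1 \<and> (K + 2) * s \<le> d/4 \<and> s \<le> 1 \<and> s \<le> d/4" if "0 < s" "s \<le> s0" for s
  proof -
    have "s * (K + 2) \<le> min 1 (d/4)" using that(2) K unfolding s0_def by (simp only: pos_le_divide_eq)
    moreover have "s * (K + 2) = s + (K + 1) * s" by (simp add: algebra_simps)
    moreover have "(K + 1) * s \<ge> 0" using K that by simp
    ultimately show ?thesis by (simp add: mult.commute)
  qed
  have half: "y \<in> ball x (3/4 * d)" if "y \<in> ball x (d/2)" for y using that d by auto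
  show thesis
  proof (rule that[of "c1 + c2" s0])
    fix y s assume y: "y \<in> ball x (d/2)" and s: "0 < s" "s \<le> s0" and ry: "norm (f y - y) \<le> s"
    note ss = s0'[OF s]
    have "norm (v1 y) \<le> c1 * s\<^sup>2" using v1_small[OF half[OF y]] s ss ry unfolding r_def by blast
    also have "\<dots> \<le> c1 * s" using ss s c1 by (intro mult_left_mono) (auto simp: power2_eq_square mult_left_le)
    also have "\<dots> \<le> (c1 + c2) * s" using s c2 by (intro mult_right_mono) auto
    finally show "norm (v1 y) \<le> (c1 + c2) * s" .
    have yd: "y \<in> ball x d" using y d by auto
    have "norm (v2 y) \<le> 2 * (c1 * ((K + 2) * s)\<^sup>2) / s + L * s"
    proof (rule derivative_bound_from_values[OF convex_ball _ s(1) v2 lip2])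
      show "cball y s \<subseteq> ball x d" using near[OF half[OF y]] ss by auto
      fix z assume z: "z \<in> cball y s"
      then have zd: "z \<in> ball x d" using near[OF half[OF y]] ss by auto
      have z34: "z \<in> ball x (3/4 * d)" using z y ss dist_triangle[of x z y] by auto
      have "norm (z - y) \<le> s" using z by (auto simp: dist_norm norm_minus_commute)
      then have "(K + 1) * norm (z - y) \<le> (K + 1) * s" using K by (intro mult_left_mono) auto
      then have "r z \<le> (K + 2) * s"
        using r_lip[OF yd zd] ry unfolding r_def by (simp add: algebra_simps)
      then show "norm (v1 z) \<le> c1 * ((K + 2) * s)\<^sup>2"
        using ss s K by (intro v1_small[OF z34]) auto
    qed
    also have "\<dots> = c2 * s"
      using s by (simp add: c2_def power2_eq_square field_simps)
    also have "\<dots> \<le> (c1 + c2) * s" using s c1 by (intro mult_right_mono) auto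
    finally show "norm (v2 y) \<le> (c1 + c2) * s" .
  qed (use c1 c2 s0 in auto)
qed

lemma continuous_on_of_has_derivative:
  assumes "\<And>x. x \<in> S \<Longrightarrow> (f has_derivative f' x) (at x)"
  shows "continuous_on S f"
  using assms by (auto intro!: continuous_at_imp_continuous_on intro: has_derivative_continuous)

text \<open>The base of the second bound is chosen so that \<open>(K + 1)\<^sup>2\<close>, coming from the quadratic term of the
chain rule, and \<open>2 * (K + 1)\<close>, coming from the sum of its two terms, are both absorbed.\<close>

lemma iterate_derivatives_geometric:
  fixes f :: "'a::real_normed_vector \<Rightarrow> 'a"
  assumes orbit: "\<And>y k. y \<in> S \<Longrightarrow> (f ^^ k) y \<in> B"
    and f1: "\<And>y. y \<in> B \<Longrightarrow> (f has_derivative blinfun_apply (f1 y)) (at y)"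
    and f2: "\<And>y. y \<in> B \<Longrightarrow> (f1 has_derivative blinfun_apply (f2 y)) (at y)"
    and cont: "continuous_on B f2"
    and K: "K \<ge> 0" "\<And>y. y \<in> B \<Longrightarrow> norm (f1 y) \<le> K" "\<And>y. y \<in> B \<Longrightarrow> norm (f2 y) \<le> K"
  shows "\<exists>G1 G2. (\<forall>y\<in>S. ((f ^^ k) has_derivative blinfun_apply (G1 y)) (at y)
      \<and> (G1 has_derivative blinfun_apply (G2 y)) (at y)
      \<and> norm (G1 y) \<le> (K + 1) ^ k \<and> norm (G2 y) \<le> ((K + 1)\<^sup>2 + 2 * (K + 1)) ^ k)
    \<and> continuous_on S G2"
proof (induction k)
  case 0
  have id: "(f ^^ 0) = (\<lambda>x. x)" by auto
  show ?case
    by (rule exI[of _ "\<lambda>_. id_blinfun"], rule exI[of _ "\<lambda>_. 0"])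
      (auto simp: id norm_blinfun_id_le zero_blinfun.rep_eq has_derivative_ident simp flip: id_def)
next
  case (Suc k)
  then obtain G1 G2 where H: "(\<forall>y\<in>S. ((f ^^ k) has_derivative blinfun_apply (G1 y)) (at y)
      \<and> (G1 has_derivative blinfun_apply (G2 y)) (at y)
      \<and> norm (G1 y) \<le> (K + 1) ^ k \<and> norm (G2 y) \<le> ((K + 1)\<^sup>2 + 2 * (K + 1)) ^ k)
    \<and> continuous_on S G2" by (elim exE)
  have G: "((f ^^ k) has_derivative blinfun_apply (G1 y)) (at y)"
    "(G1 has_derivative blinfun_apply (G2 y)) (at y)"
    "norm (G1 y) \<le> (K + 1) ^ k" "norm (G2 y) \<le> ((K + 1)\<^sup>2 + 2 * (K + 1)) ^ k"
    if "y \<in> S" for y using H that by auto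
  have G2c: "continuous_on S G2" using H by (rule conjunct2)
  let ?Q = "(K + 1)\<^sup>2 + 2 * (K + 1)"
  let ?g = "f ^^ k"
  define H1 where "H1 = (\<lambda>y. f1 (?g y) o\<^sub>L G1 y)"
  define H2 where "H2 = (\<lambda>y. chain_deriv2 (f1 (?g y)) (f2 (?g y)) (G1 y) (G2 y))"
  have contg: "continuous_on S ?g" "continuous_on S G1"
    by (rule continuous_on_of_has_derivative, rule G, assumption)+
  have contf: "continuous_on B f1"
    by (rule continuous_on_of_has_derivative, rule f2)
  have sub: "?g ` S \<subseteq> B" using orbit by auto
  have "continuous_on S H2" unfolding H2_def
    by (intro continuous_on_chain_deriv2 contg G2c continuous_on_compose2[OF contf contg(1) sub]
        continuous_on_compose2[OF cont contg(1) sub])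
  moreover have "((f ^^ Suc k) has_derivative blinfun_apply (H1 y)) (at y)" if y: "y \<in> S" for y
    using has_derivative_compose[OF G(1)[OF y] f1[OF orbit[OF y]]]
    by (simp add: H1_def blinfun_compose.rep_eq o_def)
  moreover have "(H1 has_derivative blinfun_apply (H2 y)) (at y)" if y: "y \<in> S" for y
    unfolding H1_def H2_def chain_deriv2_def
    by (rule has_derivative_blinfun_chain[OF f2[OF orbit[OF y]] G(1,2)[OF y]])
  moreover have "norm (H1 y) \<le> (K + 1) ^ Suc k" if y: "y \<in> S" for y
  proof -
    have "norm (H1 y) \<le> norm (f1 (?g y)) * norm (G1 y)" unfolding H1_def by (rule norm_blinfun_compose)
    also have "\<dots> \<le> (K + 1) * (K + 1) ^ k"
      using K(2)[OF orbit[OF y, of k]] G(3)[OF y] K(1) by (intro mult_mono) auto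
    finally show ?thesis by simp
  qed
  moreover have "norm (H2 y) \<le> ?Q ^ Suc k" if y: "y \<in> S" for y
  proof -
    have q: "((K + 1) ^ k) * ((K + 1) ^ k) \<le> ?Q ^ k"
      using K(1) by (simp add: power2_eq_square power_mono flip: power_mult_distrib)
    have q0: "?Q ^ k \<ge> 0" using K(1) by simp
    have "norm (H2 y) \<le> norm (f1 (?g y)) * norm (G2 y) + norm (f2 (?g y)) * norm (G1 y) * norm (G1 y)"
      unfolding H2_def by (rule norm_chain_deriv2)
    also have "\<dots> \<le> (K + 1) * ?Q ^ k + (K + 1) * (K + 1) ^ k * (K + 1) ^ k"
      using K(2,3)[OF orbit[OF y, of k]] G(3,4)[OF y] K(1) by (intro add_mono mult_mono) auto
    also have "\<dots> \<le> (K + 1) * ?Q ^ k + (K + 1) * ?Q ^ k"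
      using q K(1) by (simp add: mult.assoc mult_left_mono)
    also have "\<dots> = (2 * (K + 1)) * ?Q ^ k" by (simp add: algebra_simps)
    also have "\<dots> \<le> ?Q * ?Q ^ k" using q0 K(1) by (intro mult_right_mono) auto
    finally show ?thesis by simp
  qed
  ultimately show ?case by (intro exI[of _ H1] exI[of _ H2] conjI ballI)
qed

lemma C2_on_add:
  assumes "C2_on f U" "C2_on g U"
  shows "C2_on (\<lambda>x. f x + g x) U"
proof -
  from assms(1) obtain f1 f2 where f: "\<forall>x\<in>U. (f has_derivative blinfun_apply (f1 x)) (at x)"
    "\<forall>x\<in>U. (f1 has_derivative blinfun_apply (f2 x)) (at x)" "continuous_on U f2"
    unfolding C2_on_def by (elim exE conjE)
  from assms(2) obtain g1 g2 where g: "\<forall>x\<in>U. (g has_derivative blinfun_apply (g1 x)) (at x)"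
    "\<forall>x\<in>U. (g1 has_derivative blinfun_apply (g2 x)) (at x)" "continuous_on U g2"
    unfolding C2_on_def by (elim exE conjE)
  show ?thesis unfolding C2_on_def
    by (rule exI[of _ "\<lambda>x. f1 x + g1 x"], rule exI[of _ "\<lambda>x. f2 x + g2 x"])
       (use f g in \<open>auto intro!: has_derivative_blinfun_add continuous_on_add\<close>)
qed

text \<open>The terms \<open>v \<circ> f\<^sup>k\<close> of the series for the limit, where \<open>v = f\<^sup>3 - f\<^sup>2\<close>, and their first two
derivatives are dominated by a multiple of \<open>(1/2)\<^sup>k\<close>: near \<open>x0\<close> the step lengths decay fast enough
to compensate the growth of the derivatives of \<open>f\<^sup>k\<close>.\<close>

theorem quadratic_iteration_limit_C2:
  fixes f :: "'a::euclidean_space \<Rightarrow> 'a"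
  assumes U: "open U" "x0 \<in> U" and f: "C21_on f U" "f x0 = x0" and C: "C \<ge> 0"
    and quad: "\<And>y. y \<in> U \<Longrightarrow> f y \<in> U \<Longrightarrow> norm (f (f y) - f y) \<le> C * (norm (f y - y))\<^sup>2"
  obtains \<delta> where "\<delta> > 0" "ball x0 \<delta> \<subseteq> U"
    "\<And>y k. y \<in> ball x0 \<delta> \<Longrightarrow> (f ^^ k) y \<in> U"
    "\<And>y. y \<in> ball x0 \<delta> \<Longrightarrow> (\<lambda>k. (f ^^ k) y) \<longlonglongrightarrow> lim (\<lambda>k. (f ^^ k) y)"
    "\<And>y. y \<in> ball x0 \<delta> \<Longrightarrow> lim (\<lambda>k. (f ^^ k) y) \<in> U"
    "\<And>y. y \<in> ball x0 \<delta> \<Longrightarrow> f (lim (\<lambda>k. (f ^^ k) y)) = lim (\<lambda>k. (f ^^ k) y)"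
    "\<And>y. y \<in> ball x0 \<delta> \<Longrightarrow> norm (lim (\<lambda>k. (f ^^ k) y) - y) \<le> 2 * norm (f y - y)"
    "\<And>y. y \<in> ball x0 \<delta> \<Longrightarrow> norm (lim (\<lambda>k. (f ^^ k) y) - f y) \<le> 2 * C * (norm (f y - y))\<^sup>2"
    "C2_on (\<lambda>y. lim (\<lambda>k. (f ^^ k) y)) (ball x0 \<delta>)"
proof -
  obtain e0 K f1 f2 where e0: "e0 > 0" "ball x0 e0 \<subseteq> U"
    and f1: "\<And>y. y \<in> ball x0 e0 \<Longrightarrow> (f has_derivative blinfun_apply (f1 y)) (at y)"
    and f2: "\<And>y. y \<in> ball x0 e0 \<Longrightarrow> (f1 has_derivative blinfun_apply (f2 y)) (at y)"
    and lip: "K-lipschitz_on (ball x0 e0) f" "K-lipschitz_on (ball x0 e0) f2"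
    and bd: "\<And>y. y \<in> ball x0 e0 \<Longrightarrow> norm (f1 y) \<le> K" "\<And>y. y \<in> ball x0 e0 \<Longrightarrow> norm (f2 y) \<le> K"
    using C21_on_ballE[OF f(1) U] by metis
  have K: "K \<ge> 0" using lip lipschitz_on_nonneg by blast
  have quad0: "norm (f (f y) - f y) \<le> C * (norm (f y - y))\<^sup>2"
    if "y \<in> ball x0 e0" "f y \<in> ball x0 e0" for y using quad e0 that by blast
  obtain d0 where d0: "0 < d0" "d0 \<le> e0"
    and orb0: "\<And>y k. y \<in> ball x0 d0 \<Longrightarrow> (f ^^ k) y \<in> ball x0 e0"
    using iterates_near_fixed_point[OF e0(1) lip(1) f(2) quad0 C, of "1/2" 1] by (metis half_gt_zero_iff order_refl zero_less_one)
  define v where "v = (\<lambda>y. f (f (f y)) - f (f y))"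
  have orb0': "f y \<in> ball x0 e0" "f (f y) \<in> ball x0 e0" if "y \<in> ball x0 d0" for y
    using orb0[OF that, of 1] orb0[OF that, of 2] by (simp_all add: numeral_2_eq_2)
  have C21v: "C21_on v (ball x0 d0)"
  proof -
    have e0C: "C21_on f (ball x0 e0)" by (rule C21_on_subset[OF f(1) e0(2)])
    note fe = e0C C21_on_subset[OF e0C subset_ball[OF d0(2)]]
    have ff: "C21_on (\<lambda>y. f (f y)) (ball x0 d0)"
      by (rule C21_on_compose[OF fe(1) _ fe(2)]) (use orb0' in auto)
    have fff: "C21_on (\<lambda>y. f (f (f y))) (ball x0 d0)"
      by (rule C21_on_compose[OF fe(1) _ ff]) (use orb0' in auto)
    show ?thesis unfolding v_def by (rule C21_on_diff[OF fff ff open_ball])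
  qed
  have "x0 \<in> ball x0 d0" using d0 by simp
  then obtain d L v1 v2 where d: "d > 0" "ball x0 d \<subseteq> ball x0 d0"
    and v1: "\<And>y. y \<in> ball x0 d \<Longrightarrow> (v has_derivative blinfun_apply (v1 y)) (at y)"
    and v2: "\<And>y. y \<in> ball x0 d \<Longrightarrow> (v1 has_derivative blinfun_apply (v2 y)) (at y)"
    and vlip: "L-lipschitz_on (ball x0 d) v1" "L-lipschitz_on (ball x0 d) v2"
    using C21_on_ballE[OF C21v open_ball] by metis
  have de0: "d \<le> e0" using d d0 by (simp add: ball_subset_ball_iff)
  have o1: "\<And>y. y \<in> ball x0 d \<Longrightarrow> f y \<in> ball x0 e0" "\<And>y. y \<in> ball x0 d \<Longrightarrow> f (f y) \<in> ball x0 e0"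
    using orb0' d(2) by blast+
  obtain c s0 where c: "c \<ge> 0" and s0: "s0 > 0"
    and small1: "\<And>y s. y \<in> ball x0 (d/2) \<Longrightarrow> 0 < s \<Longrightarrow> s \<le> s0 \<Longrightarrow> norm (f y - y) \<le> s \<Longrightarrow> norm (v1 y) \<le> c * s"
    and small2: "\<And>y s. y \<in> ball x0 (d/2) \<Longrightarrow> 0 < s \<Longrightarrow> s \<le> s0 \<Longrightarrow> norm (f y - y) \<le> s \<Longrightarrow> norm (v2 y) \<le> c * s"
    using iterate_gap_derivatives_small[OF lip(1) quad0 C d(1) de0 o1 v1[unfolded v_def] v2 vlip]
    by blast
  define A where "A = K + 1"
  define Q where "Q = A\<^sup>2 + 2 * A"
  have A1: "A \<ge> 1" using K by (simp add: A_def)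
  have "A\<^sup>2 \<ge> 0" by simp
  then have Q: "Q \<ge> A\<^sup>2" "Q \<ge> A" "Q \<ge> 1" using A1 unfolding Q_def by linarith+
  \<comment> \<open>With this choice \<open>\<rho>\<^sup>k * Q\<^sup>k = (1/2)\<^sup>k\<close>.\<close>
  define \<rho> where "\<rho> = 1 / (2 * Q)"
  have \<rho>: "\<rho> > 0" "\<rho> \<le> 1/2" using Q by (auto simp: \<rho>_def field_simps)
  \<comment> \<open>Below \<open>d/2\<close>, so that the bounds on the derivatives of \<open>v\<close> apply along orbits, and below \<open>e0\<close>,
    so that the limit, which lies only in the closed ball, stays in \<open>ball x0 e0\<close>.\<close>
  define e1 where "e1 = d/4"
  have e1: "e1 > 0" "e1 \<le> e0" using d de0 by (auto simp: e1_def)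
  have e1sub: "ball x0 e1 \<subseteq> ball x0 e0" using e1 by auto
  obtain \<delta> where \<delta>: "0 < \<delta>" "\<delta> \<le> e1"
    and orb: "\<And>y k. y \<in> ball x0 \<delta> \<Longrightarrow> (f ^^ k) y \<in> ball x0 e1"
    and geo: "\<And>y k. y \<in> ball x0 \<delta> \<Longrightarrow> norm (f ((f ^^ k) y) - (f ^^ k) y) \<le> \<rho> ^ k * norm (f y - y)"
    and r0: "\<And>y. y \<in> ball x0 \<delta> \<Longrightarrow> norm (f y - y) \<le> s0"
    using iterates_near_fixed_point[OF e1(1) lipschitz_on_subset[OF lip(1) e1sub] f(2)
        quad0[OF subsetD[OF e1sub] subsetD[OF e1sub]] C \<rho> s0] by blast
  define S where "S = ball x0 \<delta>"
  define g where "g = (\<lambda>y. lim (\<lambda>k. (f ^^ k) y))"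
  have \<rho>k: "\<rho> ^ k \<le> (1/2) ^ k" for k using \<rho> by (intro power_mono) auto
  have conv: "(\<lambda>k. (f ^^ k) y) \<longlonglongrightarrow> g y" and near: "norm (g y - y) \<le> 2 * norm (f y - y)"
    if y: "y \<in> S" for y
  proof -
    have inc: "norm ((f ^^ Suc k) y - (f ^^ k) y) \<le> (1/2) ^ k * norm (f y - y)" for k
      using geo[of y k] mult_right_mono[OF \<rho>k[of k], of "norm (f y - y)"] y by (simp add: S_def)
    from geometric_increments_converge[of "\<lambda>k. (f ^^ k) y", OF inc]
    show "(\<lambda>k. (f ^^ k) y) \<longlonglongrightarrow> g y" "norm (g y - y) \<le> 2 * norm (f y - y)" by (simp_all add: g_def)
  qed
  have near2: "norm (g y - f y) \<le> 2 * C * (norm (f y - y))\<^sup>2" if y: "y \<in> S" for y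
  proof -
    have inc: "norm ((f ^^ Suc (Suc k)) y - (f ^^ Suc k) y) \<le> (1/2) ^ k * (C * (norm (f y - y))\<^sup>2)" for k
    proof -
      have "norm ((f ^^ Suc (Suc k)) y - (f ^^ Suc k) y) \<le> C * (norm (f ((f ^^ k) y) - (f ^^ k) y))\<^sup>2"
        using quad0[of "(f ^^ k) y"] orb[of y k] orb[of y "Suc k"] e1(2) y by (simp add: S_def)
      also have "\<dots> \<le> C * (\<rho> ^ k * norm (f y - y))\<^sup>2"
        using geo[of y k] y C by (intro mult_left_mono power_mono) (auto simp: S_def)
      also have "\<dots> = (\<rho> ^ k)\<^sup>2 * (C * (norm (f y - y))\<^sup>2)" by (simp add: power_mult_distrib)
      also have "\<dots> \<le> (1/2) ^ k * (C * (norm (f y - y))\<^sup>2)"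
      proof (rule mult_right_mono)
        have "(\<rho> ^ k)\<^sup>2 \<le> \<rho> ^ k"
          using \<rho> power_le_one[of \<rho> k] by (simp add: power2_eq_square mult_left_le)
        then show "(\<rho> ^ k)\<^sup>2 \<le> (1/2) ^ k" using \<rho>k[of k] by linarith
      qed (use C in simp)
      finally show ?thesis .
    qed
    have "(\<lambda>k. (f ^^ Suc k) y) \<longlonglongrightarrow> g y" using conv[OF y] by (rule LIMSEQ_Suc)
    then have "lim (\<lambda>k. (f ^^ Suc k) y) = g y" by (rule limI)
    then show ?thesis
      using geometric_increments_converge(2)[of "\<lambda>k. (f ^^ Suc k) y", OF inc] by (simp add: mult.assoc)
  qed
  have ge0: "g y \<in> ball x0 e0" if y: "y \<in> S" for y
  proof -
    have "g y \<in> cball x0 e1"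
      by (rule Lim_in_closed_set[OF closed_cball _ _ conv[OF y]])
         (use orb y in \<open>auto simp: S_def less_imp_le intro!: always_eventually\<close>)
    then show ?thesis using e1 de0 d by (auto simp: e1_def)
  qed
  have fixg: "f (g y) = g y" if y: "y \<in> S" for y
  proof -
    have "isCont f (g y)" using f1[OF ge0[OF y]] has_derivative_continuous by blast
    then have "(\<lambda>k. f ((f ^^ k) y)) \<longlonglongrightarrow> f (g y)" using conv[OF y] isCont_tendsto_compose by blast
    moreover have "(\<lambda>k. f ((f ^^ k) y)) \<longlonglongrightarrow> g y" using LIMSEQ_Suc[OF conv[OF y]] by simp
    ultimately show ?thesis by (rule LIMSEQ_unique)
  qed
  have orbe: "(f ^^ k) y \<in> ball x0 e0" if "y \<in> S" for y k
    using orb[of y k] that e1sub unfolding S_def by blast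
  have "\<exists>G1 G2. (\<forall>y\<in>S. ((f ^^ k) has_derivative blinfun_apply (G1 y)) (at y)
      \<and> (G1 has_derivative blinfun_apply (G2 y)) (at y)
      \<and> norm (G1 y) \<le> A ^ k \<and> norm (G2 y) \<le> Q ^ k) \<and> continuous_on S G2" for k
    unfolding A_def Q_def
    by (rule iterate_derivatives_geometric[OF orbe f1 f2 lipschitz_on_continuous_on[OF lip(2)] K bd])
  then obtain G1 G2 where G: "\<And>k y. y \<in> S \<Longrightarrow> ((f ^^ k) has_derivative blinfun_apply (G1 k y)) (at y)"
      "\<And>k y. y \<in> S \<Longrightarrow> (G1 k has_derivative blinfun_apply (G2 k y)) (at y)"
      "\<And>k y. y \<in> S \<Longrightarrow> norm (G1 k y) \<le> A ^ k" "\<And>k y. y \<in> S \<Longrightarrow> norm (G2 k y) \<le> Q ^ k"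
      "\<And>k. continuous_on S (G2 k)"
    by metis
  have orbd: "(f ^^ k) y \<in> ball x0 (d/2)" "(f ^^ k) y \<in> ball x0 d" if "y \<in> S" for y k
    using orb[of y k] that d by (auto simp: S_def e1_def)
  have C2sum: "C2_on (\<lambda>y. g y - (f ^^ 2) y) S"
  proof (rule C2_on_series[where h = "\<lambda>k y. v ((f ^^ k) y)" and ?h1.0 = "\<lambda>k y. v1 ((f ^^ k) y) o\<^sub>L G1 k y"
        and ?h2.0 = "\<lambda>k y. chain_deriv2 (v1 ((f ^^ k) y)) (v2 ((f ^^ k) y)) (G1 k y) (G2 k y)"
        and M = "\<lambda>k. (1/2) ^ k * (2 * c * s0)"])
    show "convex S" "open S" by (auto simp: S_def)
    show "((\<lambda>y. v ((f ^^ n) y)) has_derivative blinfun_apply (v1 ((f ^^ n) y) o\<^sub>L G1 n y)) (at y)"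
      if y: "y \<in> S" for n y
      using has_derivative_compose[OF G(1)[OF y] v1[OF orbd(2)[OF y]], of n]
      by (simp add: blinfun_compose.rep_eq o_def)
    show "((\<lambda>y. v1 ((f ^^ n) y) o\<^sub>L G1 n y) has_derivative
        blinfun_apply (chain_deriv2 (v1 ((f ^^ n) y)) (v2 ((f ^^ n) y)) (G1 n y) (G2 n y))) (at y)"
      if y: "y \<in> S" for n y
      unfolding chain_deriv2_def
      by (rule has_derivative_blinfun_chain[OF v2[OF orbd(2)[OF y]] G(1)[OF y] G(2)[OF y]])
    show "continuous_on S (\<lambda>y. chain_deriv2 (v1 ((f ^^ n) y)) (v2 ((f ^^ n) y)) (G1 n y) (G2 n y))" for n
    proof -
      have cg: "continuous_on S (f ^^ n)" "continuous_on S (G1 n)"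
        by (rule continuous_on_of_has_derivative, rule G, assumption)+
      have sub: "(f ^^ n) ` S \<subseteq> ball x0 d" using orbd by auto
      show ?thesis
        by (intro continuous_on_chain_deriv2 cg G(5)
          continuous_on_compose2[OF lipschitz_on_continuous_on[OF vlip(1)] cg(1) sub]
          continuous_on_compose2[OF lipschitz_on_continuous_on[OF vlip(2)] cg(1) sub])
    qed
    show "summable (\<lambda>k. (1/2) ^ k * (2 * c * s0))"
      by (intro summable_mult2 summable_geometric) auto
    have small: "norm (v1 ((f ^^ n) y)) \<le> c * (\<rho> ^ n * s0) \<and> norm (v2 ((f ^^ n) y)) \<le> c * (\<rho> ^ n * s0)"
      if y: "y \<in> S" for n y
    proof -
      have s: "0 < \<rho> ^ n * s0" "\<rho> ^ n * s0 \<le> s0"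
        using \<rho> s0 power_le_one[of \<rho> n] by (auto intro: mult_left_le_one_le)
      have "norm (f ((f ^^ n) y) - (f ^^ n) y) \<le> \<rho> ^ n * norm (f y - y)" using geo y by (simp add: S_def)
      also have "\<dots> \<le> \<rho> ^ n * s0" using r0 y \<rho> by (intro mult_left_mono) (auto simp: S_def)
      finally show ?thesis using small1 small2 orbd(1)[OF y] s by blast
    qed
    have \<rho>Q: "\<rho> ^ n * Q ^ n = (1/2) ^ n" for n
      using Q by (simp add: \<rho>_def flip: power_mult_distrib)
    have AQ: "A ^ n \<le> Q ^ n" "A ^ n * A ^ n \<le> Q ^ n" for n
      using Q A1 by (auto intro!: power_mono simp: power2_eq_square simp flip: power_mult_distrib)
    have Q0: "Q ^ n \<ge> 0" for n using Q by simp
    have sn: "c * (\<rho> ^ n * s0) \<ge> 0" for n using c \<rho> s0 by simp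
    have eqn: "c * (\<rho> ^ n * s0) * Q ^ n = (1/2) ^ n * (c * s0)" for n
      unfolding \<rho>Q[symmetric] by simp
    show "norm (v1 ((f ^^ n) y) o\<^sub>L G1 n y) \<le> (1/2) ^ n * (2 * c * s0)" if y: "y \<in> S" for n y
    proof -
      have "norm (v1 ((f ^^ n) y) o\<^sub>L G1 n y) \<le> norm (v1 ((f ^^ n) y)) * norm (G1 n y)"
        by (rule norm_blinfun_compose)
      also have "\<dots> \<le> c * (\<rho> ^ n * s0) * Q ^ n"
        using small[OF y, of n] G(3)[OF y, of n] AQ(1)[of n] sn[of n] by (intro mult_mono) auto
      also have "\<dots> \<le> (1/2) ^ n * (2 * c * s0)" unfolding eqn using c s0 by simp
      finally show ?thesis .
    qed
    show "norm (chain_deriv2 (v1 ((f ^^ n) y)) (v2 ((f ^^ n) y)) (G1 n y) (G2 n y)) \<le> (1/2) ^ n * (2 * c * s0)"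
      if y: "y \<in> S" for n y
    proof -
      have "norm (chain_deriv2 (v1 ((f ^^ n) y)) (v2 ((f ^^ n) y)) (G1 n y) (G2 n y))
          \<le> norm (v1 ((f ^^ n) y)) * norm (G2 n y) + norm (v2 ((f ^^ n) y)) * norm (G1 n y) * norm (G1 n y)"
        by (rule norm_chain_deriv2)
      also have "\<dots> \<le> c * (\<rho> ^ n * s0) * Q ^ n + c * (\<rho> ^ n * s0) * Q ^ n"
      proof (rule add_mono)
        show "norm (v1 ((f ^^ n) y)) * norm (G2 n y) \<le> c * (\<rho> ^ n * s0) * Q ^ n"
          using small[OF y, of n] G(4)[OF y, of n] sn[of n] by (intro mult_mono) auto
        have "norm (G1 n y) * norm (G1 n y) \<le> A ^ n * A ^ n"
          using G(3)[OF y, of n] A1 by (intro mult_mono) auto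
        then have "norm (G1 n y) * norm (G1 n y) \<le> Q ^ n" using AQ(2)[of n] by linarith
        then show "norm (v2 ((f ^^ n) y)) * norm (G1 n y) * norm (G1 n y) \<le> c * (\<rho> ^ n * s0) * Q ^ n"
          using small[OF y, of n] sn[of n] unfolding mult.assoc[of "norm _"] by (intro mult_mono) auto
      qed
      also have "\<dots> = (1/2) ^ n * (2 * c * s0)" unfolding eqn by simp
      finally show ?thesis .
    qed
    show "(\<lambda>n. v ((f ^^ n) y)) sums (g y - (f ^^ 2) y)" if y: "y \<in> S" for y
    proof -
      have "v ((f ^^ n) y) = (f ^^ (Suc n + 2)) y - (f ^^ (n + 2)) y" for n
        by (simp add: v_def)
      then have *: "(\<Sum>i<n. v ((f ^^ i) y)) = (f ^^ (n + 2)) y - (f ^^ 2) y" for n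
        using sum_lessThan_telescope[of "\<lambda>n. (f ^^ (n + 2)) y" n] by (simp add: numeral_2_eq_2)
      show ?thesis unfolding sums_def *
        by (rule tendsto_diff[OF LIMSEQ_ignore_initial_segment[OF conv[OF y]] tendsto_const])
    qed
  qed
  have C2two: "C2_on (f ^^ 2) S"
    unfolding C2_on_def by (rule exI[of _ "G1 2"], rule exI[of _ "G2 2"]) (use G in blast)
  have "C2_on g S"
    by (rule C2_on_cong[OF C2_on_add[OF C2sum C2two]]) (auto simp: S_def)
  show thesis
  proof (rule that[OF \<delta>(1)])
    show "ball x0 \<delta> \<subseteq> U" using \<delta> e1 e0(2) by (meson order_trans subset_ball)
    show "(f ^^ k) y \<in> U" if "y \<in> ball x0 \<delta>" for y k using orb[OF that] e1sub e0(2) by blast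
  qed (use conv ge0 e0(2) fixg near near2 \<open>C2_on g S\<close> in \<open>auto simp: S_def g_def\<close>)
qed

section \<open>Metric projection onto a submanifold\<close>

lemma orthogonal_projection_blinfun:
  fixes S :: "'a::euclidean_space set"
  assumes "subspace S"
  obtains \<pi> :: "'a \<Rightarrow>\<^sub>L 'a" where "\<And>x. \<pi> x \<in> S" "\<And>x. x \<in> S \<Longrightarrow> \<pi> x = x" "\<And>x y. \<pi> x \<bullet> y = x \<bullet> \<pi> y"
proof -
  obtain B where B: "B \<subseteq> S" "pairwise orthogonal B" "\<And>x. x \<in> B \<Longrightarrow> norm x = 1"
    "independent B" "card B = dim S" "span B = S"
    using orthonormal_basis_subspace[OF assms] by metis
  have fin: "finite B" using B(4) independent_imp_finite by blast
  define p where "p = (\<lambda>x. \<Sum>b\<in>B. (x \<bullet> b) *\<^sub>R b)"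
  have bl: "bounded_linear p" unfolding p_def
    by (intro bounded_linear_sum bounded_linear_scaleR_const bounded_linear_inner_left)
  show thesis
  proof (rule that[of "Blinfun p"])
    show "Blinfun p x \<in> S" for x
    proof -
      have "p x \<in> span B" unfolding p_def by (intro span_sum span_scale span_base)
      then show ?thesis using B(6) bounded_linear_Blinfun_apply[OF bl] by simp
    qed
    show "Blinfun p x = x" if "x \<in> S" for x
      unfolding bounded_linear_Blinfun_apply[OF bl] unfolding p_def
      by (rule orthonormal_basis_expand[OF B(2,3) _ fin]) (use that B(6) in auto)
    show "Blinfun p x \<bullet> y = x \<bullet> Blinfun p y" for x y
      unfolding bounded_linear_Blinfun_apply[OF bl] unfolding p_def
      by (simp add: inner_sum_left inner_sum_right mult.commute inner_commute)
  qed
qed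

text \<open>An explicit sum over a basis makes the bounded linear dependence of the adjoint on the operator
evident, which is what regularity of \<open>x \<mapsto> adjoint_blinfun (F x)\<close> requires.\<close>

definition adjoint_blinfun :: "('a::euclidean_space \<Rightarrow>\<^sub>L 'a) \<Rightarrow> ('a \<Rightarrow>\<^sub>L 'a)" where
  "adjoint_blinfun f = (\<Sum>i\<in>Basis. blinfun_scaleR_left i o\<^sub>L blinfun_inner_left (f i))"

lemma bounded_linear_adjoint_blinfun: "bounded_linear adjoint_blinfun"
  unfolding adjoint_blinfun_def
  by (intro bounded_linear_sum
    bounded_linear_compose[OF bounded_bilinear.bounded_linear_right[OF bounded_bilinear_blinfun_compose]]
    bounded_linear_compose[OF bounded_linear_blinfun_inner_left] blinfun.bounded_linear_left)

lemma adjoint_blinfun_inner: "adjoint_blinfun f x \<bullet> y = x \<bullet> f y"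
proof -
  have "adjoint_blinfun f x = (\<Sum>i\<in>Basis. (x \<bullet> f i) *\<^sub>R i)"
    by (simp add: adjoint_blinfun_def blinfun.sum_left blinfun_inner_left.rep_eq)
  then have "adjoint_blinfun f x \<bullet> y = (\<Sum>i\<in>Basis. (x \<bullet> f i) * (y \<bullet> i))"
    by (simp only: inner_sum_left inner_scaleR_left) (simp only: inner_commute[of y])
  also have "\<dots> = x \<bullet> f (\<Sum>i\<in>Basis. (y \<bullet> i) *\<^sub>R i)"
    unfolding blinfun.sum_right blinfun.scaleR_right inner_sum_right inner_scaleR_right by (simp add: mult.commute)
  finally show ?thesis by (simp add: euclidean_representation)
qed

lemma injective_blinfun_inverse:
  fixes X :: "'a::euclidean_space \<Rightarrow>\<^sub>L 'a"
  assumes "\<And>v. X v = 0 \<Longrightarrow> v = 0"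
  obtains Y where "X o\<^sub>L Y = id_blinfun" "Y o\<^sub>L X = id_blinfun"
proof -
  have lin: "linear (blinfun_apply X)" by (simp add: blinfun.bounded_linear_right bounded_linear.linear)
  have "inj (blinfun_apply X)" using assms lin linear_injective_0 by blast
  then obtain f where f: "linear f" "\<And>x. f (X x) = x" "\<And>x. X (f x) = x"
    using linear_injective_isomorphism[OF lin] by blast
  have "bounded_linear f" using f(1) linear_conv_bounded_linear by blast
  then have "blinfun_apply (Blinfun f) = f" by (rule bounded_linear_Blinfun_apply)
  then show thesis
    by (intro that[of "Blinfun f"] blinfun_eqI) (simp_all add: f)
qed

text \<open>Regularity is bootstrapped: the derivative of \<open>g\<close> is \<open>Y \<circ> g\<close>, where \<open>Y\<close> is the pointwise inverse of
the derivative of \<open>f\<close> and hence \<open>C\<^sup>1\<^sup>,\<^sup>1\<close>.  So \<open>Y \<circ> g\<close> is continuous, which makes \<open>g\<close> locally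
Lipschitz, which makes \<open>g\<close> \<open>C\<^sup>1\<^sup>,\<^sup>1\<close>, which makes \<open>g\<close> \<open>C\<^sup>2\<^sup>,\<^sup>1\<close>.\<close>

lemma C21_inverse_function:
  fixes f :: "'a::euclidean_space \<Rightarrow> 'a"
  assumes U: "open U" "x0 \<in> U" and f: "C21_on f U"
    and D: "(f has_derivative D) (at x0)" "\<And>v. D v = 0 \<Longrightarrow> v = 0"
  obtains U' V g where "open U'" "U' \<subseteq> U" "x0 \<in> U'" "open V" "f x0 \<in> V"
    "homeomorphism U' V f g" "C21_on g V"
proof -
  from f obtain f1 where f1: "\<And>x. x \<in> U \<Longrightarrow> (f has_derivative blinfun_apply (f1 x)) (at x)" "C11_on f1 U"
    by (rule C21_onE) (rule that, auto)
  have "blinfun_apply (f1 x0) = D" using has_derivative_unique[OF f1(1)[OF U(2)] D(1)] .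
  then have "\<And>v. f1 x0 v = 0 \<Longrightarrow> v = 0" using D(2) by simp
  then obtain J where J: "J o\<^sub>L f1 x0 = id_blinfun" using injective_blinfun_inverse[of "f1 x0"] by blast
  have cont: "continuous_on U f1"
    using locally_lipschitz_on_isCont[OF C11_on_imp_locally_lipschitz[OF f1(2) U(1)] U(1)]
    by (simp add: continuous_at_imp_continuous_on)
  obtain U' V g g' where g: "open U'" "U' \<subseteq> U" "x0 \<in> U'" "open V" "f x0 \<in> V" "homeomorphism U' V f g"
    "\<And>y. y \<in> V \<Longrightarrow> (g has_derivative (g' y)) (at y)"
    "\<And>y. y \<in> V \<Longrightarrow> g' y = inv (blinfun_apply (f1 (g y)))"
    "\<And>y. y \<in> V \<Longrightarrow> bij (blinfun_apply (f1 (g y)))"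
    using inverse_function_theorem[OF U(1) f1(1) cont U(2) J] by metis
  have gV: "g y \<in> U'" if "y \<in> V" for y using g(6) that by (auto simp: homeomorphism_def)
  have bijU: "bij (blinfun_apply (f1 w))" if "w \<in> U'" for w
  proof -
    have "f w \<in> V" "g (f w) = w" using g(6) that by (auto simp: homeomorphism_def)
    then show ?thesis using g(9) by metis
  qed
  have "\<exists>Y. f1 w o\<^sub>L Y = id_blinfun \<and> Y o\<^sub>L f1 w = id_blinfun" if w: "w \<in> U'" for w
  proof -
    have "\<And>v. f1 w v = 0 \<Longrightarrow> v = 0"
      using bijU[OF w] by (metis bij_def blinfun.zero_right inj_eq)
    then show ?thesis using injective_blinfun_inverse[of "f1 w"] by metis
  qed
  then obtain Y where Y: "\<And>w. w \<in> U' \<Longrightarrow> f1 w o\<^sub>L Y w = id_blinfun" "\<And>w. w \<in> U' \<Longrightarrow> Y w o\<^sub>L f1 w = id_blinfun"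
    by metis
  have C11Y: "C11_on Y U'"
    by (rule C11_on_blinfun_inverse[OF C11_on_subset[OF f1(2) g(2)] g(1) Y])
  have Yd: "(g has_derivative blinfun_apply (Y (g y))) (at y)" if y: "y \<in> V" for y
  proof -
    have "inv (blinfun_apply (f1 (g y))) = blinfun_apply (Y (g y))"
    proof (rule inv_equality)
      show "Y (g y) (f1 (g y) v) = v" "f1 (g y) (Y (g y) v) = v" for v
        using Y[OF gV[OF y]] by (metis blinfun_apply_blinfun_compose blinfun_apply_id_blinfun)+
    qed
    then show ?thesis using g(7,8)[OF y] by simp
  qed
  have contYg: "isCont (\<lambda>y. Y (g y)) y" if y: "y \<in> V" for y
  proof -
    have "isCont Y (g y)"
      using locally_lipschitz_on_isCont[OF C11_on_imp_locally_lipschitz[OF C11Y g(1)] g(1) gV[OF y]] .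
    then show ?thesis using isCont_o2[OF has_derivative_continuous[OF Yd[OF y]]] by blast
  qed
  have img: "g ` V \<subseteq> U'" using gV by blast
  have "locally_lipschitz_on g V"
    by (rule continuous_derivative_imp_locally_lipschitz[OF g(4) Yd contYg])
  then have "locally_lipschitz_on (\<lambda>y. Y (g y)) V"
    by (intro locally_lipschitz_on_compose[OF C11_on_imp_locally_lipschitz[OF C11Y g(1)] g(1) _ g(4) img])
  then have "C11_on g V" using Yd by (intro C11_onI[of V g "\<lambda>y. Y (g y)"])
  then have "C11_on (\<lambda>y. Y (g y)) V" by (rule C11_on_compose[OF C11Y g(1) _ g(4) img])
  then have "C21_on g V" using Yd by (intro C21_onI[of V g "\<lambda>y. Y (g y)"])
  then show thesis using that g(1-6) by blast
qed

text \<open>Along a curve in \<open>M\<close> through \<open>p\<close> the squared distance to \<open>y\<close> is minimal at \<open>p\<close>, so its derivative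
vanishes there.\<close>

lemma tangent_space_orthogonal_to_nearest:
  fixes M :: "'a::euclidean_space set"
  assumes p: "p \<in> M" "\<And>z. z \<in> M \<Longrightarrow> dist y p \<le> dist y z" and v: "v \<in> tangent_space M p"
  shows "(y - p) \<bullet> v = 0"
proof -
  obtain e c c' where e: "e > 0" and c: "c 0 = p" "c' 0 = v"
    "\<forall>t\<in>{-e<..<e}. c t \<in> M \<and> (c has_vector_derivative c' t) (at t)"
    using v unfolding tangent_space_def by blast
  have "(c has_derivative (\<lambda>t. t *\<^sub>R v)) (at 0)"
    using c e by (auto simp: has_vector_derivative_def)
  then have "((\<lambda>t. (y - c t) \<bullet> (y - c t)) has_derivative
      (\<lambda>t. (y - c 0) \<bullet> (0 - t *\<^sub>R v) + (0 - t *\<^sub>R v) \<bullet> (y - c 0))) (at 0)"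
    by (intro has_derivative_inner has_derivative_diff has_derivative_const)
  then have "((\<lambda>t. (y - c t) \<bullet> (y - c t)) has_real_derivative (- 2 * ((y - p) \<bullet> v))) (at 0)"
    unfolding has_field_derivative_def
    by (rule has_derivative_eq_rhs) (auto simp: c inner_commute algebra_simps)
  then have "- 2 * ((y - p) \<bullet> v) = 0"
  proof (rule DERIV_local_min[OF _ e])
    show "\<forall>t. \<bar>0 - t\<bar> < e \<longrightarrow> (y - c 0) \<bullet> (y - c 0) \<le> (y - c t) \<bullet> (y - c t)"
    proof (intro allI impI)
      fix t :: real assume "\<bar>0 - t\<bar> < e"
      then have "t \<in> {-e<..<e}" by auto
      then have "norm (y - p) \<le> norm (y - c t)" using p(2) c(3) by (metis dist_norm)
      then show "(y - c 0) \<bullet> (y - c 0) \<le> (y - c t) \<bullet> (y - c t)"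
        by (simp add: c(1) norm_le)
    qed
  qed
  then show ?thesis by simp
qed

text \<open>A curve in \<open>M\<close> becomes a curve in \<open>L\<close> in the chart, and \<open>L\<close> contains the velocities of its curves;
conversely a straight line in \<open>L\<close> is mapped back to a curve in \<open>M\<close>.\<close>

lemma tangent_space_chart:
  fixes M :: "'a::euclidean_space set" and \<Phi> \<Psi> :: "'a \<Rightarrow> 'a"
  assumes U: "open U" "open V" and hom: "homeomorphism U V \<Phi> \<Psi>"
    and F: "\<And>x. x \<in> U \<Longrightarrow> (\<Phi> has_derivative blinfun_apply (F x)) (at x)"
    and G: "\<And>w. w \<in> V \<Longrightarrow> (\<Psi> has_derivative blinfun_apply (G w)) (at w)" "continuous_on V G"
    and GF: "\<And>x v. x \<in> U \<Longrightarrow> G (\<Phi> x) (F x v) = v"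
    and L: "subspace L" and flat: "\<Phi> ` (U \<inter> M) = V \<inter> L" and p: "p \<in> M" "p \<in> U"
  shows "tangent_space M p = {v. F p v \<in> L}"
proof (intro set_eqI iffI; unfold mem_Collect_eq)
  obtain \<pi> :: "'a \<Rightarrow>\<^sub>L 'a" where \<pi>: "\<And>x. \<pi> x \<in> L" "\<And>x. x \<in> L \<Longrightarrow> \<pi> x = x"
    using orthogonal_projection_blinfun[OF L] by metis
  fix v assume "v \<in> tangent_space M p"
  then obtain e c c' where e: "e > 0" and c: "c 0 = p" "c' 0 = v"
    "\<forall>t\<in>{-e<..<e}. c t \<in> M \<and> (c has_vector_derivative c' t) (at t)"
    unfolding tangent_space_def by blast
  have cd: "(c has_derivative (\<lambda>t. t *\<^sub>R v)) (at 0)"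
    using c e by (auto simp: has_vector_derivative_def)
  then have cc: "isCont c 0" by (rule has_derivative_continuous)
  define q where "q = (\<lambda>t. \<Phi> (c t) - \<pi> (\<Phi> (c t)))"
  have Fc: "(\<Phi> has_derivative blinfun_apply (F p)) (at (c 0))" using F p c by simp
  have d1: "((\<lambda>t. \<Phi> (c t)) has_derivative (\<lambda>t. F p (t *\<^sub>R v))) (at 0)"
    using has_derivative_compose[OF cd Fc] .
  have dq: "(q has_derivative (\<lambda>t. F p (t *\<^sub>R v) - \<pi> (F p (t *\<^sub>R v)))) (at 0)"
    unfolding q_def by (intro has_derivative_diff d1 bounded_linear.has_derivative[OF blinfun.bounded_linear_right])
  have "\<forall>\<^sub>F t in nhds 0. c t \<in> U"
    using topological_tendstoD[OF isCont_tendsto_nhds[OF cc] U(1)] p(2) c(1) by simp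
  moreover have "\<forall>\<^sub>F t::real in nhds 0. t \<in> {-e<..<e}" using e by (intro eventually_nhds_in_open) auto
  ultimately have "\<forall>\<^sub>F t in nhds 0. q t = 0"
  proof eventually_elim
    case (elim t)
    then have "\<Phi> (c t) \<in> L" using c(3) flat by blast
    then show ?case by (simp add: q_def \<pi>)
  qed
  then have ev: "\<forall>\<^sub>F t in at 0. q t = 0" "q 0 = 0"
    by (auto simp: eventually_at_filter elim: eventually_mono dest: eventually_nhds_x_imp_x)
  have "((\<lambda>t. 0) has_derivative (\<lambda>t. F p (t *\<^sub>R v) - \<pi> (F p (t *\<^sub>R v)))) (at 0)"
    by (rule has_derivative_transform_eventually[OF dq ev]) simp
  from has_derivative_unique[OF this has_derivative_const] have "F p (1 *\<^sub>R v) - \<pi> (F p (1 *\<^sub>R v)) = 0" by metis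
  then show "F p v \<in> L" using \<pi>(1)[of "F p v"] by simp
next
  fix v assume v: "F p v \<in> L"
  have pV: "\<Phi> p \<in> V" "\<Phi> p \<in> L" using flat p by blast+
  define l where "l = (\<lambda>t. \<Phi> p + t *\<^sub>R F p v)"
  have lL: "l t \<in> L" for t unfolding l_def using L pV v by (simp add: subspace_add subspace_scale)
  have lc: "continuous_on UNIV l" unfolding l_def by (intro continuous_intros)
  then have "open (l -` V)" using U(2) open_vimage by blast
  moreover have "0 \<in> l -` V" using pV by (simp add: l_def)
  ultimately obtain e where e: "e > 0" "ball 0 e \<subseteq> l -` V" using open_contains_ball by blast
  have lV: "l t \<in> V" if "t \<in> {-e<..<e}" for t using that e(2) by (auto simp: subset_iff dist_norm)
  show "v \<in> tangent_space M p"
    unfolding tangent_space_def mem_Collect_eq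
  proof (intro exI conjI ballI)
    show "e > 0" by fact
    show "\<Psi> (l 0) = p" using hom p by (simp add: l_def homeomorphism_def)
    show "G (l 0) (F p v) = v" using GF p by (simp add: l_def)
    show "continuous_on {-e<..<e} (\<lambda>t. G (l t) (F p v))"
      by (intro continuous_intros continuous_on_compose2[OF G(2) continuous_on_subset[OF lc]]) (use lV in auto)
    fix t assume t: "t \<in> {-e<..<e}"
    have "l t \<in> \<Phi> ` (U \<inter> M)" using flat lV[OF t] lL by blast
    then show "\<Psi> (l t) \<in> M" using hom by (auto simp: homeomorphism_def)
    have "(l has_derivative (\<lambda>s. s *\<^sub>R F p v)) (at t)" unfolding l_def by (auto intro!: derivative_eq_intros)
    from has_derivative_compose[OF this G(1)[OF lV[OF t]]]
    show "((\<lambda>t. \<Psi> (l t)) has_vector_derivative G (l t) (F p v)) (at t)"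
      by (simp add: has_vector_derivative_def blinfun.scaleR_right)
  qed
qed

text \<open>The map \<open>\<Theta> w = \<Psi> (\<pi> w) + (F (\<Psi> (\<pi> w)))\<^sup>T (w - \<pi> w)\<close> parametrises a neighbourhood of \<open>xbar\<close> by a
point \<open>\<pi> w\<close> of the chart of \<open>M\<close> and a normal vector, because the transpose of \<open>F = D\<Phi>\<close> sends the
orthogonal complement of \<open>L\<close> to the normal space.  A nearest point \<open>z\<close> of \<open>y\<close> has \<open>y - z\<close> normal,
so \<open>y\<close> is the image of an explicit \<open>w\<close> with \<open>\<pi> w = \<Phi> z\<close>; injectivity of \<open>\<Theta>\<close> makes \<open>z\<close> unique and equal
to \<open>P y = \<Psi> (\<pi> (\<Theta>\<^sup>-\<^sup>1 y))\<close>.  The same normal frame gives the tangent projection: the operator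
\<open>Z w\<close> maps \<open>L\<close> to the tangent space and its complement to the normal space, hence \<open>Z w \<pi> (Z w)\<^sup>-\<^sup>1\<close> is the
orthogonal projection onto the tangent space.  (The derivative of \<open>P\<close> has the same values on \<open>M\<close>,
but is one class less regular.)\<close>

lemma submanifold_projection_C21:
  fixes M :: "'a::euclidean_space set"
  assumes M: "C31_embedded_submanifold M" and x: "xbar \<in> M"
  obtains \<delta> and P :: "'a \<Rightarrow> 'a" and T :: "'a \<Rightarrow> 'a \<Rightarrow>\<^sub>L 'a" where "\<delta> > 0"
    "C21_on P (ball xbar \<delta>)" "C21_on T (ball xbar \<delta>)"
    "\<And>y. y \<in> ball xbar \<delta> \<Longrightarrow> P y \<in> M"
    "\<And>y z. y \<in> ball xbar \<delta> \<Longrightarrow> z \<in> M \<Longrightarrow> dist y (P y) \<le> dist y z"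
    "\<And>y z. y \<in> ball xbar \<delta> \<Longrightarrow> z \<in> M \<Longrightarrow> (\<And>u. u \<in> M \<Longrightarrow> dist y z \<le> dist y u) \<Longrightarrow> z = P y"
    "\<And>y. y \<in> ball xbar \<delta> \<Longrightarrow> tangent_space M (P y) = {v. T y v = v}"
    "\<And>y v. y \<in> ball xbar \<delta> \<Longrightarrow> T y (T y v) = T y v"
    "\<And>y u v. y \<in> ball xbar \<delta> \<Longrightarrow> T y u \<bullet> v = u \<bullet> T y v"
    "\<And>y. y \<in> ball xbar \<delta> \<Longrightarrow> T y (y - P y) = 0"
proof -
  obtain U V L and \<Phi> \<Psi> :: "'a \<Rightarrow> 'a" where U: "open U" "xbar \<in> U" and V: "open V"
    and hom: "homeomorphism U V \<Phi> \<Psi>" and C31: "C31_on \<Phi> U" "C31_on \<Psi> V"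
    and L: "subspace L" and flat: "\<Phi> ` (U \<inter> M) = V \<inter> L"
    using M x unfolding C31_embedded_submanifold_def by blast
  obtain F where F: "\<And>x. x \<in> U \<Longrightarrow> (\<Phi> has_derivative blinfun_apply (F x)) (at x)" "C21_on F U"
    using C31_on_derivative[OF C31(1)] by metis
  obtain G where G: "\<And>w. w \<in> V \<Longrightarrow> (\<Psi> has_derivative blinfun_apply (G w)) (at w)" "C21_on G V"
    using C31_on_derivative[OF C31(2)] by metis
  have \<Phi>\<Psi>: "\<Psi> (\<Phi> x) = x" "\<Phi> x \<in> V" if "x \<in> U" for x using hom that by (auto simp: homeomorphism_def)
  have \<Psi>\<Phi>: "\<Phi> (\<Psi> w) = w" "\<Psi> w \<in> U" if "w \<in> V" for w using hom that by (auto simp: homeomorphism_def)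
  have GF: "G (\<Phi> x) (F x v) = v" if x: "x \<in> U" for x v
  proof -
    have "((\<lambda>z. \<Psi> (\<Phi> z)) has_derivative (\<lambda>v. G (\<Phi> x) (F x v))) (at x)"
      using has_derivative_compose[OF F(1)[OF x] G(1)[OF \<Phi>\<Psi>(2)[OF x]]] .
    then have "((\<lambda>z. z) has_derivative (\<lambda>v. G (\<Phi> x) (F x v))) (at x)"
      by (rule has_derivative_transform_within_open[OF _ U(1) x \<Phi>\<Psi>(1)])
    from has_derivative_unique[OF this has_derivative_ident] show ?thesis by metis
  qed
  have FG: "F (\<Psi> w) (G w v) = v" if w: "w \<in> V" for w v
  proof -
    have "((\<lambda>z. \<Phi> (\<Psi> z)) has_derivative (\<lambda>v. F (\<Psi> w) (G w v))) (at w)"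
      using has_derivative_compose[OF G(1)[OF w] F(1)[OF \<Psi>\<Phi>(2)[OF w]]] .
    then have "((\<lambda>z. z) has_derivative (\<lambda>v. F (\<Psi> w) (G w v))) (at w)"
      by (rule has_derivative_transform_within_open[OF _ V w \<Psi>\<Phi>(1)])
    from has_derivative_unique[OF this has_derivative_ident] show ?thesis by metis
  qed
  have \<Psi>21: "C21_on \<Psi> V"
    by (rule C21_onI[OF G(1) C21_on_imp_C11_on[OF G(2) V]])
  have contG: "continuous_on V G"
    using locally_lipschitz_on_isCont[OF C21_on_imp_locally_lipschitz[OF G(2) V] V]
    by (simp add: continuous_at_imp_continuous_on)
  have cont\<Phi>: "continuous_on U \<Phi>" using hom by (auto simp: homeomorphism_def)
  have tang: "tangent_space M p = {v. F p v \<in> L}" if "p \<in> M" "p \<in> U" for p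
    by (rule tangent_space_chart[OF U(1) V hom F(1) G(1) contG GF L flat that])

  obtain \<pi> :: "'a \<Rightarrow>\<^sub>L 'a" where \<pi>: "\<And>x. \<pi> x \<in> L" "\<And>x. x \<in> L \<Longrightarrow> \<pi> x = x" "\<And>x y. \<pi> x \<bullet> y = x \<bullet> \<pi> y"
    using orthogonal_projection_blinfun[OF L] by metis
  define \<nu> where "\<nu> = id_blinfun - \<pi>"
  have \<nu>: "\<nu> v = v - \<pi> v" for v by (simp add: \<nu>_def blinfun.bilinear_simps)
  have \<pi>\<pi>: "\<pi> (\<pi> v) = \<pi> v" "\<pi> (\<nu> v) = 0" "\<nu> (\<pi> v) = 0" "\<nu> (\<nu> v) = \<nu> v" for v
    by (simp_all add: \<nu> \<pi> blinfun.bilinear_simps)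
  have \<nu>L: "\<nu> u \<bullet> v = 0" if "v \<in> L" for u v
    using \<pi>(3)[of u v] \<pi>(2)[OF that] by (simp add: \<nu> inner_diff_left)
  let ?ad = adjoint_blinfun
  note adi = adjoint_blinfun_inner

  define Z where "Z = (\<lambda>w. (G w o\<^sub>L \<pi>) + (?ad (F (\<Psi> w)) o\<^sub>L \<nu>))"
  have Zv: "Z w v = G w (\<pi> v) + ?ad (F (\<Psi> w)) (\<nu> v)" for w v
    by (simp add: Z_def blinfun.bilinear_simps)
  have Zinj: "v = 0" if w: "w \<in> V" and z: "Z w v = 0" for w v
  proof -
    have "?ad (F (\<Psi> w)) (\<nu> v) \<bullet> G w (\<pi> v) = 0" by (simp add: adi FG[OF w] \<nu>L \<pi>(1))
    moreover have "?ad (F (\<Psi> w)) (\<nu> v) = - G w (\<pi> v)" using z by (simp add: Zv eq_neg_iff_add_eq_0 add.commute)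
    ultimately have g0: "G w (\<pi> v) = 0" by simp
    then have p0: "\<pi> v = 0" using FG[OF w, of "\<pi> v"] by simp
    have "?ad (F (\<Psi> w)) (\<nu> v) = 0" using z g0 by (simp add: Zv)
    then have "\<nu> v \<bullet> F (\<Psi> w) (G w (\<nu> v)) = 0" using adi[of "F (\<Psi> w)" "\<nu> v"] by simp
    then have "\<nu> v = 0" using FG[OF w] by simp
    then show "v = 0" using p0 by (simp add: \<nu>)
  qed
  have "\<exists>Y. Z w o\<^sub>L Y = id_blinfun \<and> Y o\<^sub>L Z w = id_blinfun" if w: "w \<in> V" for w
    using injective_blinfun_inverse[of "Z w"] Zinj[OF w] by metis
  then obtain Y where Y: "\<And>w. w \<in> V \<Longrightarrow> Z w o\<^sub>L Y w = id_blinfun" "\<And>w. w \<in> V \<Longrightarrow> Y w o\<^sub>L Z w = id_blinfun"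
    by metis
  have Yv: "Z w (Y w v) = v" if "w \<in> V" for w v
    using Y(1)[OF that] by (metis blinfun_apply_blinfun_compose blinfun_apply_id_blinfun)
  have \<Psi>V: "\<Psi> ` V \<subseteq> U" using \<Psi>\<Phi> by blast
  have adF: "C21_on (\<lambda>w. ?ad (F (\<Psi> w))) V"
    by (intro C21_on_linear_compose[OF bounded_linear_adjoint_blinfun] C21_on_compose[OF F(2) U(1) \<Psi>21] V \<Psi>V)
  note cmp = bounded_bilinear_blinfun_compose
  have ZC: "C21_on Z V" unfolding Z_def
    by (intro C21_on_add C21_on_bilinear[OF cmp] G(2) adF V C21_on_const)
  have YC: "C21_on Y V" by (rule C21_on_blinfun_inverse[OF ZC V Y])
  define p where "p = (\<lambda>w. Z w o\<^sub>L (\<pi> o\<^sub>L Y w))"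
  have pC: "C21_on p V" unfolding p_def
    by (intro C21_on_bilinear[OF cmp] ZC YC V C21_on_const)
  have p_in: "F (\<Psi> w) (p w v) \<in> L" if w: "w \<in> V" for w v
    by (simp add: p_def Zv \<pi>\<pi> FG[OF w] \<pi>(1))
  have p_perp: "(v - p w v) \<bullet> u = 0" if w: "w \<in> V" and u: "F (\<Psi> w) u \<in> L" for w u v
  proof -
    have "v - p w v = Z w (Y w v) - Z w (\<pi> (Y w v))" by (simp add: p_def Yv[OF w])
    also have "\<dots> = ?ad (F (\<Psi> w)) (\<nu> (Y w v))"
      by (simp add: Zv \<pi>\<pi> blinfun.zero_right)
    finally show ?thesis using u by (simp add: adi \<nu>L)
  qed
  have p_fix: "p w v = v" if w: "w \<in> V" and v: "F (\<Psi> w) v \<in> L" for w v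
  proof -
    have "F (\<Psi> w) (v - p w v) \<in> L"
      using v p_in[OF w] L by (simp add: blinfun.diff_right subspace_diff)
    from p_perp[OF w this, of v] show ?thesis by simp
  qed
  have p_sym: "p w u \<bullet> v = u \<bullet> p w v" if w: "w \<in> V" for w u v
    using p_perp[OF w p_in[OF w], of u v] p_perp[OF w p_in[OF w], of v u]
    by (simp add: inner_diff_left inner_diff_right inner_commute)

  define w0 where "w0 = \<Phi> xbar"
  have w0: "w0 \<in> V" "w0 \<in> L" "\<Psi> w0 = xbar" using flat U(2) x \<Phi>\<Psi> by (auto simp: w0_def)
  define V' where "V' = blinfun_apply \<pi> -` V"
  have V': "open V'" "w0 \<in> V'" "blinfun_apply \<pi> ` V' \<subseteq> V"
    using V w0 \<pi>(2) unfolding V'_def by (auto intro!: open_vimage continuous_intros)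
  have \<pi>C: "C21_on (blinfun_apply \<pi>) V'" "C21_on (blinfun_apply \<nu>) V'"
    by (intro C21_on_linear blinfun.bounded_linear_right)+
  define \<Theta> where "\<Theta> = (\<lambda>w. \<Psi> (\<pi> w) + ?ad (F (\<Psi> (\<pi> w))) (\<nu> w))"
  have XC: "C21_on (\<lambda>w. ?ad (F (\<Psi> (\<pi> w)))) V'"
    by (rule C21_on_compose[OF adF V \<pi>C(1) V'(1,3)])
  have \<Theta>C: "C21_on \<Theta> V'" unfolding \<Theta>_def
    by (intro C21_on_add C21_on_compose[OF \<Psi>21 V \<pi>C(1) V'(1,3)]
      C21_on_bilinear[OF bounded_bilinear_blinfun_apply XC \<pi>C(2)] V'(1))
  have \<Theta>D: "(\<Theta> has_derivative blinfun_apply (Z w0)) (at w0)"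
  proof -
    from XC obtain X1 where "\<And>w. w \<in> V' \<Longrightarrow> ((\<lambda>w. ?ad (F (\<Psi> (\<pi> w)))) has_derivative blinfun_apply (X1 w)) (at w)"
      "C11_on X1 V'" by (rule C21_onE) (rule that, auto)
    note X1 = this(1)[OF V'(2)]
    have d\<pi>: "(blinfun_apply B has_derivative blinfun_apply B) (at w0)" for B :: "'a \<Rightarrow>\<^sub>L 'a"
      by (intro bounded_linear_imp_has_derivative blinfun.bounded_linear_right)
    have "\<pi> w0 = w0" using \<pi>(2) w0 by blast
    then have G': "(\<Psi> has_derivative blinfun_apply (G w0)) (at (\<pi> w0))" using G(1) w0 by simp
    show ?thesis unfolding \<Theta>_def
    proof (rule has_derivative_eq_rhs)
      show "((\<lambda>w. \<Psi> (\<pi> w) + ?ad (F (\<Psi> (\<pi> w))) (\<nu> w)) has_derivative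
        (\<lambda>h. G w0 (\<pi> h) + (?ad (F (\<Psi> (\<pi> w0))) (\<nu> h) + X1 w0 h (\<nu> w0)))) (at w0)"
        by (intro has_derivative_add has_derivative_compose[OF d\<pi> G']
           bounded_bilinear.FDERIV[OF bounded_bilinear_blinfun_apply X1 d\<pi>])
      show "(\<lambda>h. G w0 (\<pi> h) + (?ad (F (\<Psi> (\<pi> w0))) (\<nu> h) + X1 w0 h (\<nu> w0))) = blinfun_apply (Z w0)"
        using \<open>\<pi> w0 = w0\<close> by (auto simp: Zv \<nu> blinfun.bilinear_simps)
    qed
  qed
  obtain U' W g where g: "open U'" "U' \<subseteq> V'" "w0 \<in> U'" "open W" "\<Theta> w0 \<in> W"
    "homeomorphism U' W \<Theta> g" "C21_on g W"
    using C21_inverse_function[OF V'(1,2) \<Theta>C \<Theta>D Zinj[OF w0(1)]] by metis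
  have \<Theta>w0: "\<Theta> w0 = xbar" using w0 \<pi>(2) by (simp add: \<Theta>_def \<nu> blinfun.bilinear_simps)
  have gW: "g ` W \<subseteq> V'" using g(2,6) by (auto simp: homeomorphism_def)
  define q where "q = (\<lambda>y. \<pi> (g y))"
  have qV: "q ` W \<subseteq> V" using gW V'(3) by (auto simp: q_def)
  have qC: "C21_on q W" unfolding q_def
    by (intro C21_on_linear_compose[OF blinfun.bounded_linear_right] g(4,7))
  define P where "P = (\<lambda>y. \<Psi> (q y))"
  define T where "T = (\<lambda>y. p (q y))"
  have PC: "C21_on P W" and TC: "C21_on T W" unfolding P_def T_def
    by (intro C21_on_compose[OF \<Psi>21 V qC g(4) qV] C21_on_compose[OF pC V qC g(4) qV])+

  \<comment> \<open>The preimage under \<open>\<Theta>\<close> of \<open>y\<close> belonging to a nearest point \<open>z\<close> is \<open>h (z, y)\<close>; by continuity it lies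
    in the domain of injectivity when \<open>z\<close> and \<open>y\<close> are close to \<open>xbar\<close>.\<close>
  define h where "h = (\<lambda>z. \<Phi> (fst z) + ?ad (G (\<Phi> (fst z))) (snd z - fst z))"
  have conth: "continuous_on (U \<times> UNIV) h"
  proof -
    have c1: "continuous_on (U \<times> (UNIV::'a set)) (\<lambda>z. \<Phi> (fst z))"
      by (rule continuous_on_compose2[OF cont\<Phi> continuous_on_fst[OF continuous_on_id]]) auto
    have c2: "continuous_on (U \<times> (UNIV::'a set)) (\<lambda>z. G (\<Phi> (fst z)))"
      by (rule continuous_on_compose2[OF contG c1]) (use \<Phi>\<Psi>(2) in auto)
    have c3: "continuous_on (U \<times> (UNIV::'a set)) (\<lambda>z. ?ad (G (\<Phi> (fst z))))"
      by (rule bounded_linear.continuous_on[OF bounded_linear_adjoint_blinfun c2])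
    show ?thesis unfolding h_def
      by (intro continuous_on_add c1 bounded_bilinear.continuous_on[OF bounded_bilinear_blinfun_apply c3]
        continuous_on_diff continuous_on_fst continuous_on_snd continuous_on_id)
  qed
  define N where "N = (U \<times> UNIV) \<inter> h -` U'"
  have "open N" unfolding N_def
    by (rule continuous_open_preimage[OF conth open_Times[OF U(1) open_UNIV] g(1)])
  moreover have "(xbar, xbar) \<in> N"
    using U(2) g(3) by (simp add: N_def h_def blinfun.bilinear_simps flip: w0_def)
  ultimately obtain A B where AB: "open A" "open B" "xbar \<in> A" "xbar \<in> B" "A \<times> B \<subseteq> N"
    by (rule open_prod_elim) auto
  have xW: "xbar \<in> W" using g(5) \<Theta>w0 by simp
  have "open (A \<inter> U \<inter> (B \<inter> W))" "xbar \<in> A \<inter> U \<inter> (B \<inter> W)" using AB g(4) U xW by auto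
  then obtain \<epsilon> where \<epsilon>: "\<epsilon> > 0" "cball xbar \<epsilon> \<subseteq> A \<inter> U \<inter> (B \<inter> W)"
    by (meson open_contains_cball)
  have nearest: "z = P y"
    if y: "y \<in> ball xbar (\<epsilon>/3)" and z: "z \<in> M" "\<And>u. u \<in> M \<Longrightarrow> dist y z \<le> dist y u" for y z
  proof -
    have "dist y z \<le> dist y xbar" using z(2) x by blast
    moreover have "dist xbar y < \<epsilon>/3" using y by simp
    ultimately have "dist xbar z \<le> \<epsilon>"
      using dist_triangle[of xbar z y] zero_le_dist[of xbar y] dist_commute[of y xbar] by linarith
    then have zz: "z \<in> A" "z \<in> U" using \<epsilon>(2) by auto
    have "y \<in> cball xbar \<epsilon>" using y \<epsilon>(1) by auto
    then have yy: "y \<in> B" "y \<in> W" using \<epsilon>(2) by auto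
    have hU: "h (z, y) \<in> U'" using AB(5) zz yy by (auto simp: N_def)
    define n where "n = ?ad (G (\<Phi> z)) (y - z)"
    have zL: "\<Phi> z \<in> L" "\<Phi> z \<in> V" using flat z(1) zz by blast+
    have perp: "(y - z) \<bullet> v = 0" if "F z v \<in> L" for v
      using tangent_space_orthogonal_to_nearest[OF z, of v] tang[OF z(1) zz(2)] that by simp
    have "n \<bullet> \<pi> v = 0" for v
      unfolding n_def adi using FG[OF zL(2)] \<Phi>\<Psi>(1)[OF zz(2)] \<pi>(1) by (intro perp) simp
    then have "\<pi> n \<bullet> \<pi> n = 0" by (simp add: \<pi>(3) \<pi>\<pi>)
    then have \<pi>n: "\<pi> n = 0" by simp
    have w: "\<pi> (\<Phi> z + n) = \<Phi> z" using zL \<pi>(2) \<pi>n by (simp add: blinfun.bilinear_simps)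
    have "?ad (F z) n = y - z"
    proof (rule vector_eq_ldot[THEN iffD1, rule_format])
      show "u \<bullet> ?ad (F z) n = u \<bullet> (y - z)" for u
        using adi[of "F z" n u] adi[of "G (\<Phi> z)" "y - z" "F z u"] GF[OF zz(2), of u]
        by (simp add: n_def inner_commute)
    qed
    then have "\<Theta> (\<Phi> z + n) = y"
      using w \<Phi>\<Psi>(1)[OF zz(2)] \<pi>n zL \<pi>(2) by (simp add: \<Theta>_def \<nu>)
    moreover have "\<Phi> z + n \<in> U'" using hU by (simp add: h_def n_def)
    ultimately have "g y = \<Phi> z + n" using g(6) by (auto simp: homeomorphism_def)
    then show "z = P y" using w \<Phi>\<Psi>(1)[OF zz(2)] by (simp add: P_def q_def)
  qed
  have exists: "\<exists>z\<in>M. \<forall>u\<in>M. dist y z \<le> dist y u" if y: "y \<in> ball xbar (\<epsilon>/3)" for y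
  proof -
    \<comment> \<open>\<open>M\<close> need not be closed, but its part in a small closed ball is compact, and points of \<open>M\<close>
      outside this ball are farther from \<open>y\<close> than \<open>xbar\<close> is.\<close>
    define K where "K = cball xbar \<epsilon> \<inter> M"
    have sub: "cball xbar \<epsilon> \<subseteq> U" using \<epsilon> by auto
    have "K = cball xbar \<epsilon> \<inter> \<Phi> -` L"
    proof (intro set_eqI iffI)
      fix u assume "u \<in> K" then show "u \<in> cball xbar \<epsilon> \<inter> \<Phi> -` L" using flat sub unfolding K_def by blast
    next
      fix u assume u: "u \<in> cball xbar \<epsilon> \<inter> \<Phi> -` L"
      then have uU: "u \<in> U" using sub by blast
      then have "\<Phi> u \<in> \<Phi> ` (U \<inter> M)" using u flat \<Phi>\<Psi>(2)[OF uU] by simp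
      then obtain u' where "\<Phi> u = \<Phi> u'" "u' \<in> U" "u' \<in> M" by blast
      then show "u \<in> K" using \<Phi>\<Psi>(1) uU u unfolding K_def by (metis IntD1 IntI)
    qed
    moreover have "closed (cball xbar \<epsilon> \<inter> \<Phi> -` L)"
      by (intro continuous_closed_preimage continuous_on_subset[OF cont\<Phi> sub] closed_cball closed_subspace L)
    ultimately have "compact K" unfolding K_def
      by (metis K_def bounded_cball bounded_Int compact_eq_bounded_closed)
    moreover have "xbar \<in> K" using \<epsilon>(1) x by (simp add: K_def)
    ultimately obtain z where z: "z \<in> K" "\<And>u. u \<in> K \<Longrightarrow> dist y z \<le> dist y u"
      using distance_attains_inf[of K y] compact_imp_closed by blast
    have "dist y z \<le> dist y u" if u: "u \<in> M" for u
    proof (cases "u \<in> cball xbar \<epsilon>")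
      case True
      then show ?thesis using z u by (simp add: K_def)
    next
      case False
      have "dist y z \<le> dist y xbar" using z(2) \<open>xbar \<in> K\<close> by blast
      moreover have "dist xbar y < \<epsilon>/3" "\<epsilon> < dist xbar u" using y False by simp_all
      ultimately show ?thesis
        using dist_triangle[of xbar u y] zero_le_dist[of xbar y] dist_commute[of y xbar] by linarith
    qed
    then show ?thesis using z(1) by (auto simp: K_def)
  qed
  have "ball xbar (\<epsilon>/3) \<subseteq> cball xbar \<epsilon>" using \<epsilon>(1) by auto
  then have bW: "ball xbar (\<epsilon>/3) \<subseteq> W" using \<epsilon>(2) by blast
  have PM: "P y \<in> M" and Pmin: "\<And>u. u \<in> M \<Longrightarrow> dist y (P y) \<le> dist y u" if y: "y \<in> ball xbar (\<epsilon>/3)" for y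
    using exists[OF y] nearest[OF y] by metis+
  have qy: "q y \<in> V" if y: "y \<in> ball xbar (\<epsilon>/3)" for y using y bW qV by blast
  have tangP: "tangent_space M (P y) = {v. T y v = v}" if y: "y \<in> ball xbar (\<epsilon>/3)" for y
  proof -
    have "tangent_space M (P y) = {v. F (P y) v \<in> L}"
      by (rule tang[OF PM[OF y]]) (use \<Psi>\<Phi>(2)[OF qy[OF y]] in \<open>simp add: P_def\<close>)
    also have "\<dots> = {v. T y v = v}"
      unfolding T_def P_def using p_fix[OF qy[OF y]] p_in[OF qy[OF y]] by (metis (no_types, lifting))
    finally show ?thesis .
  qed
  show thesis
  proof (rule that[of "\<epsilon>/3" P T])
    show "T y (T y v) = T y v" if y: "y \<in> ball xbar (\<epsilon>/3)" for y v
      unfolding T_def by (rule p_fix[OF qy[OF y] p_in[OF qy[OF y]]])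
    show "T y (y - P y) = 0" if y: "y \<in> ball xbar (\<epsilon>/3)" for y
    proof -
      have "T y (y - P y) \<in> tangent_space M (P y)"
        unfolding tangP[OF y] T_def using p_fix[OF qy[OF y] p_in[OF qy[OF y]]] by simp
      then have "(y - P y) \<bullet> T y (y - P y) = 0"
        using tangent_space_orthogonal_to_nearest[OF PM[OF y] Pmin[OF y]] by blast
      then have "T y (y - P y) \<bullet> T y (y - P y) = 0"
        unfolding T_def p_sym[OF qy[OF y]] p_fix[OF qy[OF y] p_in[OF qy[OF y]]] .
      then show ?thesis by simp
    qed
  qed (use \<epsilon> PC TC bW C21_on_subset PM Pmin nearest tangP p_sym qy in \<open>auto simp: T_def\<close>)
qed

section \<open>The NewtonSLRA map near a transversal intersection\<close>

text \<open>An operator that differs from \<open>X x0\<close> by less than the reciprocal of the norm of its inverse is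
injective, hence invertible in finite dimension.\<close>

lemma C21_blinfun_inverse_near:
  fixes X :: "'a::euclidean_space \<Rightarrow> 'b::euclidean_space \<Rightarrow>\<^sub>L 'b"
  assumes X: "C21_on X U" "open U" "x0 \<in> U" and inj: "\<And>v. X x0 v = 0 \<Longrightarrow> v = 0"
  obtains \<delta> and Y :: "'a \<Rightarrow> 'b \<Rightarrow>\<^sub>L 'b" where "\<delta> > 0" "ball x0 \<delta> \<subseteq> U" "C21_on Y (ball x0 \<delta>)"
    "\<And>x v. x \<in> ball x0 \<delta> \<Longrightarrow> X x (Y x v) = v"
proof -
  obtain Y0 where Y0: "Y0 o\<^sub>L X x0 = id_blinfun" using injective_blinfun_inverse[OF inj] by metis
  have id0: "Y0 (X x0 v) = v" for v using Y0 by (metis blinfun_apply_blinfun_compose blinfun_apply_id_blinfun)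
  obtain e K where e: "e > 0" "ball x0 e \<subseteq> U" "K-lipschitz_on (ball x0 e) X"
    using locally_lipschitz_on_ball[OF C21_on_imp_locally_lipschitz[OF X(1,2)] X(2,3)] by metis
  have K: "K \<ge> 0" using e lipschitz_on_nonneg by blast
  define \<delta> where "\<delta> = min e (1 / (norm Y0 * K + 1))"
  have KN: "norm Y0 * K \<ge> 0" using K by simp
  then have \<delta>: "\<delta> > 0" using e by (simp add: \<delta>_def)
  have sub: "ball x0 \<delta> \<subseteq> ball x0 e" by (auto simp: \<delta>_def)
  have injx: "v = 0" if x: "x \<in> ball x0 \<delta>" and v: "X x v = 0" for x v
  proof (rule ccontr)
    assume v0: "v \<noteq> 0"
    have d1: "dist x x0 < 1 / (norm Y0 * K + 1)" using x by (simp add: \<delta>_def dist_commute)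
    have "dist (X x0) (X x) \<le> K * dist x0 x"
      using lipschitz_onD[OF e(3), of x0 x] x sub e(1) by auto
    then have XX: "norm (X x0 - X x) \<le> K * dist x x0" by (metis dist_norm dist_commute)
    have "norm ((X x0 - X x) v) \<le> norm (X x0 - X x) * norm v" by (rule norm_blinfun)
    also have "\<dots> \<le> K * dist x x0 * norm v" using XX by (rule mult_right_mono) simp
    finally have Xv: "norm ((X x0 - X x) v) \<le> K * dist x x0 * norm v" .
    have "v = Y0 ((X x0 - X x) v)" using id0[of v] v by (simp add: blinfun.diff_left)
    then have "norm v = norm (Y0 ((X x0 - X x) v))" by simp
    also have "\<dots> \<le> norm Y0 * norm ((X x0 - X x) v)" by (rule norm_blinfun)
    also have "\<dots> \<le> norm Y0 * (K * dist x x0 * norm v)" using Xv by (rule mult_left_mono) simp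
    finally have "1 * norm v \<le> (norm Y0 * K * dist x x0) * norm v" by (simp add: mult_ac)
    then have "1 \<le> norm Y0 * K * dist x x0" using v0 by (simp only: mult_le_cancel_right) auto
    also have "\<dots> \<le> norm Y0 * K * (1 / (norm Y0 * K + 1))" using d1 KN by (intro mult_left_mono) auto
    also have "\<dots> < 1" using KN by (simp add: field_simps)
    finally show False by simp
  qed
  have "\<exists>Y. X x o\<^sub>L Y = id_blinfun \<and> Y o\<^sub>L X x = id_blinfun" if "x \<in> ball x0 \<delta>" for x
    using injective_blinfun_inverse[of "X x"] injx[OF that] by metis
  then obtain Y where Y: "\<And>x. x \<in> ball x0 \<delta> \<Longrightarrow> X x o\<^sub>L Y x = id_blinfun"
     "\<And>x. x \<in> ball x0 \<delta> \<Longrightarrow> Y x o\<^sub>L X x = id_blinfun" by metis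
  have \<delta>U: "ball x0 \<delta> \<subseteq> U" using sub e by blast
  show thesis
  proof (rule that[OF \<delta> \<delta>U])
    show "C21_on Y (ball x0 \<delta>)"
      by (rule C21_on_blinfun_inverse[OF C21_on_subset[OF X(1) \<delta>U] open_ball Y])
    show "X x (Y x v) = v" if "x \<in> ball x0 \<delta>" for x v
      using Y(1)[OF that] by (metis blinfun_apply_blinfun_compose blinfun_apply_id_blinfun)
  qed
qed

lemma tangent_space_mono: "M \<subseteq> N \<Longrightarrow> tangent_space M p \<subseteq> tangent_space N p"
  unfolding tangent_space_def by blast

lemma tangent_space_affine_kernel:
  fixes A :: "'a::real_normed_vector \<Rightarrow>\<^sub>L 'b::real_normed_vector"
  assumes v: "v \<in> tangent_space M p" and A: "\<And>z. z \<in> M \<Longrightarrow> A (z - a) = 0"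
  shows "A v = 0"
proof -
  obtain e c c' where e: "e > 0" and c: "c 0 = p" "c' 0 = v"
    "\<forall>t\<in>{-e<..<e}. c t \<in> M \<and> (c has_vector_derivative c' t) (at t)"
    using v unfolding tangent_space_def by blast
  have "(c has_derivative (\<lambda>t. t *\<^sub>R v)) (at 0)"
    using c e by (auto simp: has_vector_derivative_def)
  then have "((\<lambda>t. A (c t - a)) has_derivative (\<lambda>t. A (t *\<^sub>R v - 0))) (at 0)"
    by (intro bounded_linear.has_derivative[OF blinfun.bounded_linear_right] has_derivative_diff has_derivative_const)
  then have "((\<lambda>t. 0) has_derivative (\<lambda>t. A (t *\<^sub>R v - 0))) (at 0)"
    by (rule has_derivative_transform_within_open[where s = "{-e<..<e}"]) (use e c A in auto)
  from has_derivative_unique[OF this has_derivative_const]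
  have "A (1 *\<^sub>R v - 0) = 0" by metis
  then show ?thesis by simp
qed

text \<open>Differentiate \<open>P (c t) = c t\<close> along a curve \<open>c\<close> in \<open>M\<close> with velocity \<open>v\<close>.\<close>

lemma retraction_derivative_on_tangent_space:
  assumes P: "\<And>z. z \<in> M \<Longrightarrow> z \<in> U \<Longrightarrow> P z = z" and U: "open U" "x \<in> U"
    and D: "(P has_derivative D) (at x)" and v: "v \<in> tangent_space M x"
  shows "D v = v"
proof -
  obtain e c c' where e: "e > 0" and c: "c 0 = x" "c' 0 = v"
    "\<forall>t\<in>{-e<..<e}. c t \<in> M \<and> (c has_vector_derivative c' t) (at t)"
    using v unfolding tangent_space_def by blast
  have cd: "(c has_derivative (\<lambda>t. t *\<^sub>R v)) (at 0)"
    using c e by (auto simp: has_vector_derivative_def)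
  then have cc: "isCont c 0" by (rule has_derivative_continuous)
  have d: "((\<lambda>t. P (c t)) has_derivative (\<lambda>t. D (t *\<^sub>R v))) (at 0)"
    using has_derivative_compose[OF cd] D c(1) by blast
  have "\<forall>\<^sub>F t in nhds 0. c t \<in> U"
    using topological_tendstoD[OF isCont_tendsto_nhds[OF cc] U(1)] U(2) c(1) by simp
  moreover have "\<forall>\<^sub>F t::real in nhds 0. t \<in> {-e<..<e}" using e by (intro eventually_nhds_in_open) auto
  ultimately have "\<forall>\<^sub>F t in nhds 0. P (c t) = c t"
    by eventually_elim (use P c(3) in auto)
  then have ev: "\<forall>\<^sub>F t in at 0. P (c t) = c t" "P (c 0) = c 0"
    by (auto simp: eventually_at_filter elim: eventually_mono dest: eventually_nhds_x_imp_x)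
  have "(c has_derivative (\<lambda>t. D (t *\<^sub>R v))) (at 0)"
    by (rule has_derivative_transform_eventually[OF d ev]) simp
  from has_derivative_unique[OF this cd] have "D (1 *\<^sub>R v) = 1 *\<^sub>R v" by metis
  then show ?thesis by simp
qed

text \<open>\<open>A\<close> is the orthogonal projection onto the complement of the direction of \<open>M\<close>; that it is idempotent
and self-adjoint is used for the formula of the projection onto \<open>M1 \<inter> (P y + tangent space)\<close>.\<close>

lemma affine_as_kernel:
  fixes M :: "'a::euclidean_space set"
  assumes M: "affine M" "a \<in> M"
  obtains A :: "'a \<Rightarrow>\<^sub>L 'a" where "\<And>z. z \<in> M \<longleftrightarrow> A (z - a) = 0" "\<And>v. A (A v) = A v" "\<And>u v. A u \<bullet> v = u \<bullet> A v"
proof -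
  define W where "W = (\<lambda>z. - a + z) ` M"
  have W: "subspace W" unfolding W_def by (rule affine_diffs_subspace[OF M])
  have Wm: "z - a \<in> W \<longleftrightarrow> z \<in> M" for z unfolding W_def by force
  obtain \<omega> :: "'a \<Rightarrow>\<^sub>L 'a" where \<omega>: "\<And>x. \<omega> x \<in> W" "\<And>x. x \<in> W \<Longrightarrow> \<omega> x = x" "\<And>x y. \<omega> x \<bullet> y = x \<bullet> \<omega> y"
    using orthogonal_projection_blinfun[OF W] by metis
  show thesis
  proof (rule that[of "id_blinfun - \<omega>"])
    show "z \<in> M \<longleftrightarrow> (id_blinfun - \<omega>) (z - a) = 0" for z
      unfolding Wm[symmetric] using \<omega>(1)[of "z - a"] \<omega>(2)[of "z - a"]
      by (auto simp: blinfun.diff_left)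
    show "(id_blinfun - \<omega>) ((id_blinfun - \<omega>) v) = (id_blinfun - \<omega>) v" for v
      by (simp add: blinfun.bilinear_simps \<omega>)
    show "(id_blinfun - \<omega>) u \<bullet> v = u \<bullet> (id_blinfun - \<omega>) v" for u v
      by (simp add: blinfun.bilinear_simps \<omega>(3) inner_diff_left inner_diff_right)
  qed
qed

lemma closest_point_eqI:
  assumes "x \<in> S" "\<And>z. z \<in> S \<Longrightarrow> dist a x \<le> dist a z"
    and "\<And>z. z \<in> S \<Longrightarrow> (\<And>u. u \<in> S \<Longrightarrow> dist a z \<le> dist a u) \<Longrightarrow> z = x"
  shows "closest_point S a = x"
  unfolding closest_point_def by (rule some_equality) (use assms in blast)+

text \<open>The minimal norm correction \<open>D y\<close> with \<open>A (D y) = - A (P y - xbar)\<close> and \<open>T y (D y) = D y\<close> must be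
orthogonal to the common kernel of \<open>A\<close> and \<open>1 - T y\<close>.  The vector \<open>D y = - T y (A s)\<close> has the last two
properties for every \<open>s\<close>, since \<open>A\<close> and \<open>T y\<close> are self-adjoint; the first one holds if
\<open>(1 - A + A T y A) s = A (P y - xbar)\<close>.  At \<open>xbar\<close> a vector \<open>s\<close> in the kernel of this operator
satisfies \<open>A s = s\<close> and \<open>T s = 0\<close>, so it is orthogonal to both tangent spaces and vanishes by
transversality.

The last estimates prepare the retraction properties: a step that starts on a tangent line of
\<open>M1 \<inter> M2\<close> is quadratically short, and its component along a tangent vector \<open>u\<close> at the base point is
smaller by another factor \<open>norm v\<close>.\<close>

lemma newton_slra_local:
  fixes M1 M2 :: "'a::euclidean_space set" and xbar :: 'a
  assumes M1: "affine M1" and M2: "C31_embedded_submanifold M2" and x: "xbar \<in> M1" "xbar \<in> M2"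
    and trans: "transversal_at M1 M2 xbar"
  obtains \<delta> C C' and A :: "'a \<Rightarrow>\<^sub>L 'a" and T :: "'a \<Rightarrow> 'a \<Rightarrow>\<^sub>L 'a" where "\<delta> > 0" "C \<ge> 0"
    "C21_on (newton_slra M1 M2) (ball xbar \<delta>)"
    "\<And>y. y \<in> ball xbar \<delta> \<Longrightarrow> newton_slra_defined M1 M2 y"
    "\<And>y. y \<in> ball xbar \<delta> \<Longrightarrow> newton_slra M1 M2 y \<in> ball xbar \<delta> \<Longrightarrow>
       norm (newton_slra M1 M2 (newton_slra M1 M2 y) - newton_slra M1 M2 y) \<le> C * (norm (newton_slra M1 M2 y - y))\<^sup>2"
    "\<And>y. y \<in> ball xbar \<delta> \<Longrightarrow> newton_slra M1 M2 y = y \<longleftrightarrow> y \<in> M1 \<inter> M2"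
    "\<And>x v. x \<in> ball xbar \<delta> \<Longrightarrow> x \<in> M1 \<inter> M2 \<Longrightarrow> v \<in> tangent_space (M1 \<inter> M2) x \<Longrightarrow> A v = 0 \<and> T x v = v"
    "\<And>x v. x \<in> ball xbar \<delta> \<Longrightarrow> x \<in> M1 \<inter> M2 \<Longrightarrow> x + v \<in> ball xbar \<delta> \<Longrightarrow> A v = 0 \<Longrightarrow> T x v = v \<Longrightarrow>
       norm (newton_slra M1 M2 (x + v) - (x + v)) \<le> C * (norm v)\<^sup>2"
    "\<And>x v u. x \<in> ball xbar \<delta> \<Longrightarrow> x \<in> M1 \<inter> M2 \<Longrightarrow> x + v \<in> ball xbar \<delta> \<Longrightarrow> A v = 0 \<Longrightarrow>
       A u = 0 \<Longrightarrow> T x u = u \<Longrightarrow>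
       \<bar>(newton_slra M1 M2 (x + v) - (x + v)) \<bullet> u\<bar> \<le> C' * norm (newton_slra M1 M2 (x + v) - (x + v)) * norm v * norm u"
    "C' \<ge> 0"
proof -
  obtain A :: "'a \<Rightarrow>\<^sub>L 'a" where A: "\<And>z. z \<in> M1 \<longleftrightarrow> A (z - xbar) = 0" "\<And>v. A (A v) = A v" "\<And>u v. A u \<bullet> v = u \<bullet> A v"
    using affine_as_kernel[OF M1 x(1)] by metis
  obtain d0 and P :: "'a \<Rightarrow> 'a" and T :: "'a \<Rightarrow> 'a \<Rightarrow>\<^sub>L 'a" where d0: "d0 > 0"
    and PC: "C21_on P (ball xbar d0)" and TC: "C21_on T (ball xbar d0)"
    and PM: "\<And>y. y \<in> ball xbar d0 \<Longrightarrow> P y \<in> M2"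
    and Pmin: "\<And>y z. y \<in> ball xbar d0 \<Longrightarrow> z \<in> M2 \<Longrightarrow> dist y (P y) \<le> dist y z"
    and Puniq: "\<And>y z. y \<in> ball xbar d0 \<Longrightarrow> z \<in> M2 \<Longrightarrow> (\<And>u. u \<in> M2 \<Longrightarrow> dist y z \<le> dist y u) \<Longrightarrow> z = P y"
    and tang: "\<And>y. y \<in> ball xbar d0 \<Longrightarrow> tangent_space M2 (P y) = {v. T y v = v}"
    and TT: "\<And>y v. y \<in> ball xbar d0 \<Longrightarrow> T y (T y v) = T y v"
    and Tsym: "\<And>y u v. y \<in> ball xbar d0 \<Longrightarrow> T y u \<bullet> v = u \<bullet> T y v"
    and Tperp: "\<And>y. y \<in> ball xbar d0 \<Longrightarrow> T y (y - P y) = 0"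
    by (rule submanifold_projection_C21[OF M2 x(2)]) (rule that, (assumption | blast)+)
  have Pfix: "P z = z" if "z \<in> M2" "z \<in> ball xbar d0" for z
    using Puniq[OF that(2,1)] by simp
  have xd0: "xbar \<in> ball xbar d0" using d0 by simp
  have Px: "P xbar = xbar" using Pfix[OF x(2) xd0] .

  define S where "S = (\<lambda>y. (id_blinfun - A) + (A o\<^sub>L (T y o\<^sub>L A)))"
  have Sv: "S y v = (v - A v) + A (T y (A v))" for y v
    by (simp add: S_def blinfun.bilinear_simps)
  note cmp = bounded_bilinear_blinfun_compose
  have SC: "C21_on S (ball xbar d0)" unfolding S_def
    by (intro C21_on_add C21_on_bilinear[OF cmp] TC C21_on_const open_ball)
  have Sinj: "v = 0" if v: "S xbar v = 0" for v
  proof -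
    have "S xbar v \<bullet> v = (v - A v) \<bullet> (v - A v) + T xbar (A v) \<bullet> T xbar (A v)"
    proof -
      have "(v - A v) \<bullet> A v = 0" using A(3)[of "v - A v" v] A(2) by (simp add: blinfun.diff_right A(3) inner_diff_left)
      moreover have "A (T xbar (A v)) \<bullet> v = T xbar (A v) \<bullet> T xbar (A v)"
        using Tsym[OF xd0] TT[OF xd0] A(3) by metis
      ultimately show ?thesis by (simp add: Sv inner_add_left inner_diff_right)
    qed
    then have "(v - A v) \<bullet> (v - A v) + T xbar (A v) \<bullet> T xbar (A v) = 0" using v by simp
    then have "(v - A v) \<bullet> (v - A v) = 0" "T xbar (A v) \<bullet> T xbar (A v) = 0"
      by (smt (verit) inner_ge_zero)+
    then have Av: "A v = v" and Tv: "T xbar v = 0" by auto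
    obtain a b where ab: "v = a + b" "a \<in> tangent_space M1 xbar" "b \<in> tangent_space M2 xbar"
      using trans unfolding transversal_at_def by blast
    have "A a = 0" by (rule tangent_space_affine_kernel[OF ab(2), where a = xbar]) (use A(1) in blast)
    then have va: "v \<bullet> a = 0" using A(3)[of v a] Av by simp
    have "T xbar b = b" using tang[OF xd0] ab(3) Px by auto
    then have vb: "v \<bullet> b = 0" using Tsym[OF xd0, of v b] Tv by simp
    have "v \<bullet> v = v \<bullet> a + v \<bullet> b" using ab(1) by (simp add: inner_add_right)
    then show "v = 0" using va vb by simp
  qed
  obtain d1 and Y :: "'a \<Rightarrow> 'a \<Rightarrow>\<^sub>L 'a" where d1: "d1 > 0" "ball xbar d1 \<subseteq> ball xbar d0" and YC: "C21_on Y (ball xbar d1)"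
    and SY: "\<And>y v. y \<in> ball xbar d1 \<Longrightarrow> S y (Y y v) = v"
    using C21_blinfun_inverse_near[OF SC open_ball xd0 Sinj] by metis
  have xd1: "xbar \<in> ball xbar d1" using d1 by simp

  define E where "E = (\<lambda>y. A (P y - xbar))"
  define \<sigma> where "\<sigma> = (\<lambda>y. Y y (E y))"
  define D where "D = (\<lambda>y. - T y (A (\<sigma> y)))"
  define \<phi> where "\<phi> = (\<lambda>y. P y + D y)"
  have PC1: "C21_on P (ball xbar d1)" and TC1: "C21_on T (ball xbar d1)"
    using C21_on_subset PC TC d1 by blast+
  have \<phi>C: "C21_on \<phi> (ball xbar d1)"
    unfolding \<phi>_def D_def \<sigma>_def E_def
    by (intro C21_on_add C21_on_linear_compose[OF bounded_linear_minus[OF bounded_linear_ident]]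
       C21_on_linear_compose[OF blinfun.bounded_linear_right] C21_on_bilinear[OF bounded_bilinear_blinfun_apply]
       C21_on_diff C21_on_const PC1 TC1 YC open_ball)
  have AD: "A (D y) = - E y" and TD: "T y (D y) = D y" if y: "y \<in> ball xbar d1" for y
  proof -
    have "A (S y (\<sigma> y)) = A (T y (A (\<sigma> y)))"
      by (simp add: Sv blinfun.bilinear_simps A(2))
    moreover have "S y (\<sigma> y) = E y" by (simp add: \<sigma>_def SY[OF y])
    ultimately have "A (T y (A (\<sigma> y))) = E y" by (simp add: E_def A(2))
    then show "A (D y) = - E y" by (simp add: D_def blinfun.minus_right)
    show "T y (D y) = D y" using TT y d1 by (simp add: D_def blinfun.minus_right subset_iff)
  qed
  have D_perp: "D y \<bullet> v = 0" if y: "y \<in> ball xbar d1" and v: "A v = 0" "T y v = v" for y v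
  proof -
    have "T y (A (\<sigma> y)) \<bullet> v = A (\<sigma> y) \<bullet> v" using Tsym[of y "A (\<sigma> y)" v] y d1 v by auto
    also have "\<dots> = 0" using A(3)[of "\<sigma> y" v] v by simp
    finally show ?thesis by (simp add: D_def)
  qed
  have \<phi>_in: "\<phi> y \<in> M1 \<inter> (+) (P y) ` tangent_space M2 (P y)" if y: "y \<in> ball xbar d1" for y
  proof
    have "A (\<phi> y - xbar) = E y + A (D y)" by (simp add: \<phi>_def E_def blinfun.bilinear_simps)
    then show "\<phi> y \<in> M1" using AD[OF y] A(1) by simp
    have "D y \<in> tangent_space M2 (P y)" using tang TD[OF y] y d1 by auto
    then show "\<phi> y \<in> (+) (P y) ` tangent_space M2 (P y)" by (simp add: \<phi>_def)
  qed
  have pyth: "(norm (P y - u))\<^sup>2 = (norm (P y - \<phi> y))\<^sup>2 + (norm (\<phi> y - u))\<^sup>2"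
    if y: "y \<in> ball xbar d1" and u: "u \<in> M1 \<inter> (+) (P y) ` tangent_space M2 (P y)" for y u
  proof -
    have yd0: "y \<in> ball xbar d0" using y d1 by blast
    obtain b where b: "u = P y + b" "T y b = b" using u tang[OF yd0] by auto
    define k where "k = u - \<phi> y"
    have "k = (u - xbar) - (\<phi> y - xbar)" by (simp add: k_def)
    then have "A k = A (u - xbar) - A (\<phi> y - xbar)" by (metis blinfun.diff_right)
    then have "A k = 0" using u \<phi>_in[OF y] A(1) by simp
    moreover have "k = b - D y" by (simp add: k_def b \<phi>_def)
    then have "T y k = k" using b TD[OF y] by (simp add: blinfun.diff_right)
    ultimately have perp: "D y \<bullet> k = 0" using D_perp[OF y] by blast
    have "P y - u = - (D y + k)" by (simp add: k_def \<phi>_def)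
    then have "(norm (P y - u))\<^sup>2 = (norm (D y + k))\<^sup>2" by (metis norm_minus_cancel)
    also have "\<dots> = (norm (D y))\<^sup>2 + (norm k)\<^sup>2" using perp by (simp add: power2_norm_eq_inner inner_add_left inner_add_right inner_commute)
    also have "norm k = norm (\<phi> y - u)" by (simp add: k_def norm_minus_commute)
    also have "norm (D y) = norm (P y - \<phi> y)" by (simp add: \<phi>_def)
    finally show ?thesis .
  qed
  have cpM2: "closest_point M2 y = P y" if y: "y \<in> ball xbar d1" for y
  proof -
    have yd0: "y \<in> ball xbar d0" using y d1 by blast
    show ?thesis by (rule closest_point_eqI[OF PM[OF yd0] Pmin[OF yd0] Puniq[OF yd0]])
  qed
  have newton: "newton_slra M1 M2 y = \<phi> y" if y: "y \<in> ball xbar d1" for y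
    unfolding newton_slra_def Let_def cpM2[OF y]
  proof (rule closest_point_eqI[OF \<phi>_in[OF y]])
    fix u assume u: "u \<in> M1 \<inter> (+) (P y) ` tangent_space M2 (P y)"
    have "(norm (P y - \<phi> y))\<^sup>2 \<le> (norm (P y - u))\<^sup>2" using pyth[OF y u] by simp
    then show "dist (P y) (\<phi> y) \<le> dist (P y) u" by (simp add: dist_norm)
    assume "\<And>u'. u' \<in> M1 \<inter> (+) (P y) ` tangent_space M2 (P y) \<Longrightarrow> dist (P y) u \<le> dist (P y) u'"
    then have "norm (P y - u) \<le> norm (P y - \<phi> y)" using \<phi>_in[OF y] by (metis dist_norm)
    then have "(norm (P y - u))\<^sup>2 \<le> (norm (P y - \<phi> y))\<^sup>2" by (simp add: power_mono)
    then show "u = \<phi> y" using pyth[OF y u] by simp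
  qed
  have defined: "newton_slra_defined M1 M2 y" if y: "y \<in> ball xbar d1" for y
  proof -
    have yd0: "y \<in> ball xbar d0" using y d1 by blast
    show ?thesis unfolding newton_slra_defined_def Let_def cpM2[OF y]
      using \<phi>_in[OF y] PM[OF yd0] Pmin[OF yd0] Puniq[OF yd0] by blast
  qed

  obtain eP K P1 P2 where eP: "eP > 0" "ball xbar eP \<subseteq> ball xbar d1"
    and P1: "\<And>y. y \<in> ball xbar eP \<Longrightarrow> (P has_derivative blinfun_apply (P1 y)) (at y)"
    and "\<And>y. y \<in> ball xbar eP \<Longrightarrow> (P1 has_derivative blinfun_apply (P2 y)) (at y)"
    and Plip: "K-lipschitz_on (ball xbar eP) P" and P1lip: "K-lipschitz_on (ball xbar eP) P1"
    using C21_on_ballE[OF PC1 open_ball xd1] by metis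
  obtain eT KT where eT: "eT > 0" "ball xbar eT \<subseteq> ball xbar d1" and Tlip: "KT-lipschitz_on (ball xbar eT) T"
    using locally_lipschitz_on_ball[OF C21_on_imp_locally_lipschitz[OF TC1 open_ball] open_ball xd1] by metis
  obtain eY KY where eY: "eY > 0" "ball xbar eY \<subseteq> ball xbar d1" and Ylip: "KY-lipschitz_on (ball xbar eY) Y"
    using locally_lipschitz_on_ball[OF C21_on_imp_locally_lipschitz[OF YC open_ball] open_ball xd1] by metis
  have K: "K \<ge> 0" "KT \<ge> 0" using Plip Tlip lipschitz_on_nonneg by blast+
  define \<rho> where "\<rho> = min eP (min eT eY)"
  have \<rho>: "\<rho> > 0" "ball xbar \<rho> \<subseteq> ball xbar eP" "ball xbar \<rho> \<subseteq> ball xbar eT" "ball xbar \<rho> \<subseteq> ball xbar eY"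
    using eP eT eY by (auto simp: \<rho>_def)
  define bT bY where "bT = norm (T xbar) + KT * eT" and "bY = norm (Y xbar) + KY * eY"
  have bT: "norm (T y) \<le> bT" and bY: "norm (Y y) \<le> bY" if "y \<in> ball xbar \<rho>" for y
    using lipschitz_on_ball_bounded[OF Tlip] lipschitz_on_ball_bounded[OF Ylip] that \<rho>
    unfolding bT_def bY_def by blast+
  \<comment> \<open>A radius at which \<open>P\<close> still maps into \<open>ball xbar \<rho>\<close>.\<close>
  define \<delta> where "\<delta> = \<rho> / (K + 1)"
  have \<delta>: "\<delta> > 0" using \<rho> K by (simp add: \<delta>_def)
  have \<delta>\<rho>: "(K + 1) * \<delta> = \<rho>" using K by (simp add: \<delta>_def)
  have \<delta>sub: "ball xbar \<delta> \<subseteq> ball xbar \<rho>"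
  proof (rule subset_ball)
    have "K * \<delta> \<ge> 0" using K \<delta> by simp
    then show "\<delta> \<le> \<rho>" using \<delta>\<rho> by (simp add: algebra_simps)
  qed
  have \<rho>d1: "ball xbar \<rho> \<subseteq> ball xbar d1" using \<rho> eP by blast
  have \<rho>d0: "ball xbar \<rho> \<subseteq> ball xbar d0" using \<rho>d1 d1 by blast
  have P\<rho>: "P y \<in> ball xbar \<rho>" if y: "y \<in> ball xbar \<delta>" for y
  proof -
    have "dist (P xbar) (P y) \<le> K * dist xbar y"
      by (rule lipschitz_onD[OF Plip]) (use eP(1) in simp, use y \<delta>sub \<rho>(2) in blast)
    also have "\<dots> \<le> K * \<delta>" using y K by (intro mult_left_mono) auto
    also have "\<dots> < \<rho>" using \<delta>\<rho> \<delta> by (simp add: algebra_simps)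
    finally show ?thesis using Px by simp
  qed
  have quadP: "norm (z + v - P (z + v)) \<le> K * (norm v)\<^sup>2"
    if z: "z \<in> M2" "z \<in> ball xbar \<rho>" and v: "v \<in> tangent_space M2 z" "z + v \<in> ball xbar \<rho>" for z v
  proof -
    have z': "z \<in> ball xbar eP" "z + v \<in> ball xbar eP" using z v \<rho> by blast+
    have "P1 z v = v"
      by (rule retraction_derivative_on_tangent_space[OF Pfix open_ball _ P1[OF z'(1)] v(1)])
         (use z \<rho>d0 in blast)+
    moreover have "P z = z" using Pfix z \<rho>d0 by blast
    ultimately show ?thesis
      using has_derivative_lipschitz_taylor[OF convex_ball z' P1 P1lip]
      by (simp add: norm_minus_commute algebra_simps)
  qed
  define \<alpha> where "\<alpha> = norm A"
  have bT0: "bT \<ge> 0" and bY0: "bY \<ge> 0" using bT[of xbar] bY[of xbar] \<rho>(1) norm_ge_zero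
    by (meson centre_in_ball order_trans)+
  define \<beta> where "\<beta> = \<alpha> * (bY * \<alpha>)"
  have \<beta>0: "\<beta> \<ge> 0" and \<alpha>0: "\<alpha> \<ge> 0" using bY0 by (simp_all add: \<beta>_def \<alpha>_def)
  have A\<sigma>: "norm (A (\<sigma> y)) \<le> \<beta> * norm (P y - y)" if y: "y \<in> ball xbar \<rho>" "y \<in> M1" for y
  proof -
    have "P y - xbar = (P y - y) + (y - xbar)" by simp
    then have "E y = A (P y - y) + A (y - xbar)" unfolding E_def by (metis blinfun.add_right)
    then have "E y = A (P y - y)" using y A(1) by simp
    then have "norm (E y) \<le> \<alpha> * norm (P y - y)" unfolding \<alpha>_def using norm_blinfun by simp
    then have "norm (\<sigma> y) \<le> bY * (\<alpha> * norm (P y - y))"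
      unfolding \<sigma>_def using norm_blinfun[of "Y y" "E y"] bY[OF y(1)] bY0
      by (meson mult_mono norm_ge_zero order_trans)
    then have "norm (A (\<sigma> y)) \<le> \<alpha> * (bY * (\<alpha> * norm (P y - y)))"
      unfolding \<alpha>_def using norm_blinfun[of A "\<sigma> y"] by (meson mult_left_mono norm_ge_zero order_trans)
    then show ?thesis by (simp add: \<beta>_def mult_ac)
  qed
  have Dbd: "norm (D y) \<le> bT * \<beta> * norm (P y - y)" if y: "y \<in> ball xbar \<rho>" "y \<in> M1" for y
  proof -
    have "norm (D y) \<le> norm (T y) * norm (A (\<sigma> y))" unfolding D_def using norm_blinfun by simp
    also have "\<dots> \<le> bT * (\<beta> * norm (P y - y))" using A\<sigma>[OF y] bT[OF y(1)] bT0 by (intro mult_mono) auto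
    finally show ?thesis by simp
  qed
  have \<phi>bd: "norm (\<phi> y - y) \<le> (bT * \<beta> + 1) * norm (P y - y)" if y: "y \<in> ball xbar \<rho>" "y \<in> M1" for y
  proof -
    have "\<phi> y - y = D y + (P y - y)" by (simp add: \<phi>_def)
    then have "norm (\<phi> y - y) \<le> norm (D y) + norm (P y - y)" by (metis norm_triangle_ineq)
    then show ?thesis using Dbd[OF y] by (simp add: algebra_simps)
  qed
  have orth: "(norm (\<phi> y - y))\<^sup>2 = (norm (D y))\<^sup>2 + (norm (P y - y))\<^sup>2" if y: "y \<in> ball xbar d1" for y
  proof -
    have yd0: "y \<in> ball xbar d0" using y d1 by blast
    have "D y \<bullet> (P y - y) = D y \<bullet> T y (P y - y)" using Tsym[OF yd0, of "D y" "P y - y"] TD[OF y] by simp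
    also have "T y (P y - y) = - T y (y - P y)" by (simp add: blinfun.diff_right)
    finally have o: "D y \<bullet> (P y - y) = 0" using Tperp[OF yd0] by simp
    have "\<phi> y - y = D y + (P y - y)" by (simp add: \<phi>_def)
    then show ?thesis using o by (simp only: power2_norm_eq_inner) (simp add: inner_add_left inner_add_right inner_commute)
  qed
  have Dle: "norm (D y) \<le> norm (\<phi> y - y)" and Ple: "norm (P y - y) \<le> norm (\<phi> y - y)" if y: "y \<in> ball xbar d1" for y
    by (rule power2_le_imp_le; simp add: orth[OF y])+
  define C where "C = (bT * \<beta> + 1) * K"
  have c1: "bT * \<beta> + 1 \<ge> 0" using bT0 \<beta>0 by simp
  have C0: "C \<ge> 0" using c1 K by (simp add: C_def)
  define C' where "C' = (\<beta> + bT * \<beta> + 1) * KT"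
  have C'0: "C' \<ge> 0" using bT0 \<beta>0 K by (simp add: C'_def)
  have bnd: "y \<in> ball xbar d1" "y \<in> ball xbar \<rho>" "y \<in> ball xbar d0" if "y \<in> ball xbar \<delta>" for y
    using that \<delta>sub \<rho>d1 \<rho>d0 by blast+
  show thesis
  proof (rule that[OF \<delta> C0])
    show "C21_on (newton_slra M1 M2) (ball xbar \<delta>)"
      by (rule C21_on_cong[OF C21_on_subset[OF \<phi>C] open_ball]) (use bnd newton in auto)
    show "newton_slra_defined M1 M2 y" if "y \<in> ball xbar \<delta>" for y using defined bnd that by blast
    show "norm (newton_slra M1 M2 (newton_slra M1 M2 y) - newton_slra M1 M2 y) \<le> C * (norm (newton_slra M1 M2 y - y))\<^sup>2"
      if y: "y \<in> ball xbar \<delta>" and fy: "newton_slra M1 M2 y \<in> ball xbar \<delta>" for y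
    proof -
      note yb = bnd[OF y]
      have nf: "newton_slra M1 M2 y = \<phi> y" using newton yb by blast
      define z where "z = \<phi> y"
      have z: "z \<in> ball xbar \<delta>" using fy nf by (simp add: z_def)
      note zb = bnd[OF z]
      have zM1: "z \<in> M1" using \<phi>_in[OF yb(1)] by (simp add: z_def)
      have "D y \<in> tangent_space M2 (P y)" using tang[OF yb(3)] TD[OF yb(1)] by simp
      then have "norm (z - P z) \<le> K * (norm (D y))\<^sup>2"
        using quadP[OF PM[OF yb(3)] P\<rho>[OF y], of "D y"] zb(2) by (simp add: z_def \<phi>_def)
      also have "\<dots> \<le> K * (norm (\<phi> y - y))\<^sup>2"
        using Dle[OF yb(1)] K by (intro mult_left_mono power_mono) auto
      finally have "norm (P z - z) \<le> K * (norm (\<phi> y - y))\<^sup>2" by (simp add: norm_minus_commute)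
      then have "(bT * \<beta> + 1) * norm (P z - z) \<le> C * (norm (\<phi> y - y))\<^sup>2"
        unfolding C_def mult.assoc using c1 by (rule mult_left_mono)
      then have "norm (\<phi> z - z) \<le> C * (norm (\<phi> y - y))\<^sup>2" using \<phi>bd[OF zb(2) zM1] by linarith
      then show ?thesis using nf newton[OF zb(1)] by (simp add: z_def)
    qed
    show "newton_slra M1 M2 y = y \<longleftrightarrow> y \<in> M1 \<inter> M2" if y: "y \<in> ball xbar \<delta>" for y
    proof
      note yb = bnd[OF y]
      assume "newton_slra M1 M2 y = y"
      then have f: "\<phi> y = y" using newton[OF yb(1)] by simp
      then have "P y = y" using Ple[OF yb(1)] by simp
      then show "y \<in> M1 \<inter> M2" using PM[OF yb(3)] \<phi>_in[OF yb(1)] f by auto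
    next
      note yb = bnd[OF y]
      assume "y \<in> M1 \<inter> M2"
      then have "P y = y" "y \<in> M1" using Pfix[OF _ yb(3)] by auto
      then have "norm (\<phi> y - y) \<le> 0" using \<phi>bd[OF yb(2)] by simp
      then show "newton_slra M1 M2 y = y" using newton[OF yb(1)] by simp
    qed
    show "A v = 0 \<and> T z v = v"
      if z: "z \<in> ball xbar \<delta>" "z \<in> M1 \<inter> M2" and v: "v \<in> tangent_space (M1 \<inter> M2) z" for z v
    proof
      have "v \<in> tangent_space M1 z" "v \<in> tangent_space M2 z" using v tangent_space_mono by (metis Int_lower1 Int_lower2 subsetD)+
      then show "A v = 0" using tangent_space_affine_kernel[where a = xbar and A = A] A(1) by blast
      have "P z = z" using Pfix z bnd by blast
      then show "T z v = v" using tang[of z] bnd[OF z(1)] \<open>v \<in> tangent_space M2 z\<close> by simp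
    qed
    have inM1: "z + v \<in> M1" if "z \<in> M1" "A v = 0" for z v
    proof -
      have "z + v - xbar = (z - xbar) + v" by simp
      then show ?thesis using that A(1) by (metis blinfun.add_right add_0)
    qed
    show "norm (newton_slra M1 M2 (z + v) - (z + v)) \<le> C * (norm v)\<^sup>2"
      if z: "z \<in> ball xbar \<delta>" "z \<in> M1 \<inter> M2" and zv: "z + v \<in> ball xbar \<delta>" and v: "A v = 0" "T z v = v" for z v
    proof -
      note zb = bnd[OF z(1)] and wb = bnd[OF zv]
      have "P z = z" using Pfix z zb by blast
      then have "v \<in> tangent_space M2 z" using tang[OF zb(3)] v by simp
      then have "norm (z + v - P (z + v)) \<le> K * (norm v)\<^sup>2" using quadP z zb wb by blast
      then have "norm (P (z + v) - (z + v)) \<le> K * (norm v)\<^sup>2" by (simp only: norm_minus_commute)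
      then have "(bT * \<beta> + 1) * norm (P (z + v) - (z + v)) \<le> C * (norm v)\<^sup>2"
        unfolding C_def mult.assoc using c1 by (rule mult_left_mono)
      moreover have "z + v \<in> M1" using inM1 z v by blast
      ultimately show ?thesis using \<phi>bd[OF wb(2)] newton[OF wb(1)] by fastforce
    qed
    show "\<bar>(newton_slra M1 M2 (z + v) - (z + v)) \<bullet> u\<bar> \<le> C' * norm (newton_slra M1 M2 (z + v) - (z + v)) * norm v * norm u"
      if z: "z \<in> ball xbar \<delta>" "z \<in> M1 \<inter> M2" and zv: "z + v \<in> ball xbar \<delta>" and v: "A v = 0" and u: "A u = 0" "T z u = u" for z v u
    proof -
      note zb = bnd[OF z(1)] and wb = bnd[OF zv]
      define y where "y = z + v"
      note yb = wb[folded y_def]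
      have yM1: "y \<in> M1" using inM1 z v by (simp add: y_def)
      \<comment> \<open>\<open>b\<close> is the part of the step that is normal to \<open>M2\<close> at \<open>P y\<close>; the rest is orthogonal to \<open>M1\<close>.\<close>
      define b where "b = (A (\<sigma> y) - T y (A (\<sigma> y))) + (P y - y)"
      have \<phi>b: "\<phi> y - y = b - A (\<sigma> y)" by (simp add: \<phi>_def D_def b_def)
      have "A (\<sigma> y) \<bullet> u = 0" using A(3) u by simp
      then have 1: "(\<phi> y - y) \<bullet> u = b \<bullet> u" by (simp add: \<phi>b inner_diff_left)
      have "T y (P y) = T y y" using Tperp[OF yb(3)] by (simp add: blinfun.diff_right)
      then have "T y b = 0" by (simp add: b_def blinfun.bilinear_simps TT[OF yb(3)])
      then have "b \<bullet> T y u = 0" using Tsym[OF yb(3), of b u] by simp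
      then have 2: "b \<bullet> u = b \<bullet> ((T z - T y) u)" using u by (simp add: blinfun.diff_left inner_diff_right)
      have "norm b \<le> norm (A (\<sigma> y) + D y) + norm (P y - y)"
        unfolding b_def D_def using norm_triangle_ineq by (metis diff_conv_add_uminus)
      also have "\<dots> \<le> norm (A (\<sigma> y)) + norm (D y) + norm (P y - y)" using norm_triangle_ineq by (intro add_right_mono)
      also have "\<dots> \<le> (\<beta> + bT * \<beta> + 1) * norm (P y - y)"
        using A\<sigma>[OF yb(2) yM1] Dbd[OF yb(2) yM1] by (simp add: algebra_simps)
      also have "\<dots> \<le> (\<beta> + bT * \<beta> + 1) * norm (\<phi> y - y)"
        using Ple[OF yb(1)] bT0 \<beta>0 by (intro mult_left_mono) auto
      finally have nb: "norm b \<le> (\<beta> + bT * \<beta> + 1) * norm (\<phi> y - y)" .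
      have "norm (T z - T y) \<le> KT * norm v"
        using lipschitz_onD[OF Tlip subsetD[OF \<rho>(3) zb(2)] subsetD[OF \<rho>(3) yb(2)]]
        by (simp add: dist_norm y_def)
      then have nT: "norm ((T z - T y) u) \<le> KT * norm v * norm u"
        by (meson mult_right_mono norm_blinfun norm_ge_zero order_trans)
      have "\<bar>(\<phi> y - y) \<bullet> u\<bar> \<le> norm b * norm ((T z - T y) u)"
        unfolding 1 2 by (rule Cauchy_Schwarz_ineq2)
      also have "\<dots> \<le> ((\<beta> + bT * \<beta> + 1) * norm (\<phi> y - y)) * (KT * norm v * norm u)"
        using nb nT bT0 \<beta>0 by (intro mult_mono) auto
      also have "\<dots> = C' * norm (\<phi> y - y) * norm v * norm u" by (simp add: C'_def)
      finally show ?thesis unfolding y_def using newton[OF wb(1)] by simp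
    qed
  qed (rule C'0)
qed

section \<open>The limiting map\<close>

text \<open>This transports the \<open>C\<^sup>2\<close> limit map on the ambient space to the map \<open>(x, \<eta>) \<mapsto> g (x + \<eta>)\<close>, which
thereby extends the retraction to an open set of pairs.\<close>

lemma C2_on_compose_linear:
  fixes f :: "'b::real_normed_vector \<Rightarrow> 'c::real_normed_vector" and l :: "'a::real_normed_vector \<Rightarrow>\<^sub>L 'b"
  assumes "C2_on f V"
  shows "C2_on (\<lambda>x. f (l x)) (blinfun_apply l -` V)"
proof -
  from assms obtain f1 f2 where f: "\<forall>x\<in>V. (f has_derivative blinfun_apply (f1 x)) (at x)"
    "\<forall>x\<in>V. (f1 has_derivative blinfun_apply (f2 x)) (at x)" "continuous_on V f2"
    unfolding C2_on_def by (elim exE conjE)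
  let ?U = "blinfun_apply l -` V"
  have l: "(blinfun_apply l has_derivative blinfun_apply l) (at x)" for x
    by (intro bounded_linear_imp_has_derivative blinfun.bounded_linear_right)
  have c: "(((\<lambda>_. l) :: 'a \<Rightarrow> _) has_derivative blinfun_apply 0) (at x)" for x
    by (simp add: zero_blinfun.rep_eq)
  have lc: "continuous_on ?U (blinfun_apply l)" by (intro continuous_intros)
  have f1c: "continuous_on V f1" by (rule continuous_on_of_has_derivative) (use f in blast)
  show ?thesis unfolding C2_on_def
  proof (rule exI[of _ "\<lambda>x. f1 (l x) o\<^sub>L l"], rule exI[of _ "\<lambda>x. chain_deriv2 (f1 (l x)) (f2 (l x)) l 0"],
      intro conjI ballI)
    fix x assume x: "x \<in> ?U"
    have fx: "(f has_derivative blinfun_apply (f1 (l x))) (at (l x))" using f x by simp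
    show "((\<lambda>x. f (l x)) has_derivative blinfun_apply (f1 (l x) o\<^sub>L l)) (at x)"
      using has_derivative_compose[OF l fx] by (simp add: blinfun_compose.rep_eq o_def)
    have f1x: "(f1 has_derivative blinfun_apply (f2 (l x))) (at (l x))" using f x by simp
    show "((\<lambda>x. f1 (l x) o\<^sub>L l) has_derivative blinfun_apply (chain_deriv2 (f1 (l x)) (f2 (l x)) l 0)) (at x)"
      using has_derivative_blinfun_chain[OF f1x l c] by (simp add: chain_deriv2_def)
  next
    show "continuous_on ?U (\<lambda>x. chain_deriv2 (f1 (l x)) (f2 (l x)) l 0)"
      by (intro continuous_on_chain_deriv2 continuous_on_const continuous_on_compose2[OF f1c lc]
         continuous_on_compose2[OF f(3) lc]) auto
  qed
qed

lemma smallo_of_power_bound: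
  fixes h :: "real \<Rightarrow> real"
  assumes e: "e > 0" and h: "\<And>t. \<bar>t\<bar> < e \<Longrightarrow> \<bar>h t\<bar> \<le> K * \<bar>t\<bar> ^ Suc n"
  shows "h \<in> o[at 0](\<lambda>t. t ^ n)"
proof (rule landau_o.smallI)
  fix c :: real assume c: "c > 0"
  define d where "d = min e (c / (\<bar>K\<bar> + 1))"
  have d: "d > 0" using e c by (simp add: d_def)
  have "norm (h t) \<le> c * norm (t ^ n)" if t: "\<bar>t\<bar> < d" for t
  proof -
    have "\<bar>h t\<bar> \<le> K * \<bar>t\<bar> ^ Suc n" using h t by (simp add: d_def)
    also have "\<dots> = (K * \<bar>t\<bar>) * \<bar>t\<bar> ^ n" by simp
    also have "\<dots> \<le> c * \<bar>t\<bar> ^ n"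
    proof (rule mult_right_mono)
      have "K * \<bar>t\<bar> \<le> (\<bar>K\<bar> + 1) * \<bar>t\<bar>" by (intro mult_right_mono) auto
      also have "\<dots> \<le> (\<bar>K\<bar> + 1) * (c / (\<bar>K\<bar> + 1))" using t by (intro mult_left_mono) (auto simp: d_def)
      also have "\<dots> = c" by simp
      finally show "K * \<bar>t\<bar> \<le> c" .
    qed simp
    finally show ?thesis by (simp add: power_abs)
  qed
  then show "\<forall>\<^sub>F t in at 0. norm (h t) \<le> c * norm (t ^ n)"
    using d unfolding eventually_at by (auto intro!: exI[of _ d])
qed

lemma has_vector_derivative_of_quadratic_bound:
  fixes c :: "real \<Rightarrow> 'a::real_normed_vector"
  assumes e: "e > 0" and c: "\<And>t. \<bar>t\<bar> < e \<Longrightarrow> norm (c t - (x + t *\<^sub>R v)) \<le> K * t\<^sup>2"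
  shows "(c has_vector_derivative v) (at 0)"
proof -
  have c0: "c 0 = x" using c[of 0] e by simp
  have "((\<lambda>t. norm (c t - c 0 - (t - 0) *\<^sub>R v) / norm (t - 0)) \<longlongrightarrow> 0) (at 0)"
  proof (rule tendsto_sandwich[of "\<lambda>_. 0"])
    show "\<forall>\<^sub>F t in at 0. norm (c t - c 0 - (t - 0) *\<^sub>R v) / norm (t - 0) \<le> K * \<bar>t\<bar>"
      unfolding eventually_at
    proof (intro exI[of _ e] conjI ballI impI e)
      fix t :: real assume t: "t \<noteq> 0 \<and> dist t 0 < e"
      then have "norm (c t - c 0 - (t - 0) *\<^sub>R v) \<le> (K * \<bar>t\<bar>) * \<bar>t\<bar>"
        using c[of t] by (simp add: c0 power2_eq_square algebra_simps)
      then show "norm (c t - c 0 - (t - 0) *\<^sub>R v) / norm (t - 0) \<le> K * \<bar>t\<bar>"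
        using t by (simp add: pos_divide_le_eq)
    qed
    show "((\<lambda>t. K * \<bar>t\<bar>) \<longlongrightarrow> 0) (at 0)"
      by (intro tendsto_eq_intros) auto
  qed auto
  then show ?thesis
    unfolding has_vector_derivative_def has_derivative_iff_norm
    by (auto intro!: bounded_linear_scaleR_left)
qed

text \<open>Testing with the projection itself: for \<open>v = closest_point S u\<close> one has \<open>u \<bullet> v = v \<bullet> v\<close>.\<close>

lemma norm_closest_point_subspace_le:
  fixes S :: "'a::euclidean_space set"
  assumes S: "subspace S" and b: "\<And>v. v \<in> S \<Longrightarrow> \<bar>u \<bullet> v\<bar> \<le> B * norm v" and B: "B \<ge> 0"
  shows "norm (closest_point S u) \<le> B"
proof -
  define v where "v = closest_point S u"
  have S': "convex S" "closed S" "0 \<in> S" using S by (auto simp: subspace_imp_convex closed_subspace subspace_0)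
  have v: "v \<in> S" unfolding v_def using closest_point_in_set S'(2,3) by blast
  then have v2: "2 *\<^sub>R v \<in> S" using S by (simp add: subspace_scale)
  have dot: "(u - v) \<bullet> (w - v) \<le> 0" if "w \<in> S" for w
    unfolding v_def by (rule closest_point_dot[OF S'(1,2) that])
  have "(u - v) \<bullet> (0 - v) \<le> 0" "(u - v) \<bullet> (2 *\<^sub>R v - v) \<le> 0"
    by (rule dot[OF S'(3)], rule dot[OF v2])
  moreover have "2 *\<^sub>R v - v = v" by (simp add: scaleR_2)
  ultimately have "u \<bullet> v = v \<bullet> v" by (simp add: inner_diff_left)
  then have "norm v * norm v \<le> B * norm v" using b[OF v] by (simp add: dot_square_norm power2_eq_square)
  then have "norm v \<le> B" using B by (cases "v = 0") (auto simp: mult_le_cancel_right)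
  then show ?thesis by (simp add: v_def)
qed

theorem theorem4:
  fixes M1 M2 :: "'a::euclidean_space set" and xbar :: 'a
  assumes "affine M1"
    and "C31_embedded_submanifold M2"
    and "xbar \<in> M1 \<inter> M2"
    and "transversal_at M1 M2 xbar"
  shows "\<exists>rN>0. \<exists>\<Omega>.
    (\<forall>(x, \<eta>)\<in>retraction_domain (M1 \<inter> M2) \<Omega> rN.
       (\<forall>k. newton_slra_defined M1 M2 ((newton_slra M1 M2 ^^ k) (x + \<eta>))) \<and>
       convergent (\<lambda>k. (newton_slra M1 M2 ^^ k) (x + \<eta>))) \<and>
    second_order_retraction_near (M1 \<inter> M2) xbar \<Omega> rN (newton_slra_limit M1 M2)"
proof -
  define M where "M = M1 \<inter> M2"
  define f where "f = newton_slra M1 M2"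
  have x: "xbar \<in> M1" "xbar \<in> M2" using assms(3) by auto
  obtain \<delta>0 C C' and A :: "'a \<Rightarrow>\<^sub>L 'a" and T :: "'a \<Rightarrow> 'a \<Rightarrow>\<^sub>L 'a" where \<delta>0: "\<delta>0 > 0"
    and C: "C \<ge> 0" and fC: "C21_on f (ball xbar \<delta>0)"
    and fdef: "\<And>y. y \<in> ball xbar \<delta>0 \<Longrightarrow> newton_slra_defined M1 M2 y"
    and quad: "\<And>y. y \<in> ball xbar \<delta>0 \<Longrightarrow> f y \<in> ball xbar \<delta>0 \<Longrightarrow> norm (f (f y) - f y) \<le> C * (norm (f y - y))\<^sup>2"
    and fix_iff: "\<And>y. y \<in> ball xbar \<delta>0 \<Longrightarrow> f y = y \<longleftrightarrow> y \<in> M"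
    and tang_sub: "\<And>x v. x \<in> ball xbar \<delta>0 \<Longrightarrow> x \<in> M \<Longrightarrow> v \<in> tangent_space M x \<Longrightarrow> A v = 0 \<and> T x v = v"
    and step: "\<And>x v. x \<in> ball xbar \<delta>0 \<Longrightarrow> x \<in> M \<Longrightarrow> x + v \<in> ball xbar \<delta>0 \<Longrightarrow> A v = 0 \<Longrightarrow> T x v = v \<Longrightarrow>
       norm (f (x + v) - (x + v)) \<le> C * (norm v)\<^sup>2"
    and step_tangential: "\<And>x v u. x \<in> ball xbar \<delta>0 \<Longrightarrow> x \<in> M \<Longrightarrow> x + v \<in> ball xbar \<delta>0 \<Longrightarrow> A v = 0 \<Longrightarrow>
       A u = 0 \<Longrightarrow> T x u = u \<Longrightarrow>
       \<bar>(f (x + v) - (x + v)) \<bullet> u\<bar> \<le> C' * norm (f (x + v) - (x + v)) * norm v * norm u"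
    and C': "C' \<ge> 0"
    by (rule newton_slra_local[OF assms(1,2) x assms(4), folded f_def M_def]) (rule that, assumption+)
  have x0: "xbar \<in> ball xbar \<delta>0" using \<delta>0 by simp
  have xM: "xbar \<in> M" using x by (simp add: M_def)
  have fx: "f xbar = xbar" using fix_iff[OF x0] xM by blast
  define g where "g = (\<lambda>y. lim (\<lambda>k. (f ^^ k) y))"
  have lim_g: "lim (\<lambda>k. (f ^^ k) y) = g y" for y by (simp add: g_def)
  obtain \<delta> where \<delta>: "\<delta> > 0" and sub: "ball xbar \<delta> \<subseteq> ball xbar \<delta>0"
    and orbit: "\<And>y k. y \<in> ball xbar \<delta> \<Longrightarrow> (f ^^ k) y \<in> ball xbar \<delta>0"
    and conv: "\<And>y. y \<in> ball xbar \<delta> \<Longrightarrow> (\<lambda>k. (f ^^ k) y) \<longlonglongrightarrow> g y"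
    and gin: "\<And>y. y \<in> ball xbar \<delta> \<Longrightarrow> g y \<in> ball xbar \<delta>0"
    and gfix: "\<And>y. y \<in> ball xbar \<delta> \<Longrightarrow> f (g y) = g y"
    and near: "\<And>y. y \<in> ball xbar \<delta> \<Longrightarrow> norm (g y - y) \<le> 2 * norm (f y - y)"
    and near2: "\<And>y. y \<in> ball xbar \<delta> \<Longrightarrow> norm (g y - f y) \<le> 2 * C * (norm (f y - y))\<^sup>2"
    and gC2: "C2_on g (ball xbar \<delta>)"
    by (rule quadratic_iteration_limit_C2[OF open_ball x0 fC fx C quad, unfolded lim_g]) (assumption, assumption, rule that, assumption+)
  have gM: "g y \<in> M" if "y \<in> ball xbar \<delta>" for y using fix_iff gin gfix that by blast
  have gx: "g z = z" if "z \<in> M" "z \<in> ball xbar \<delta>" for z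
  proof -
    have "f z = z" using fix_iff that sub by blast
    then show ?thesis using near[OF that(2)] by simp
  qed
  \<comment> \<open>\<open>E z\<close> is the intersection of the two tangent spaces, which turns out to be the tangent space of
    the intersection.\<close>
  define E where "E = (\<lambda>z. {v. A v = 0 \<and> T z v = v})"
  have Esub: "subspace (E z)" for z
    unfolding E_def subspace_def by (auto simp: blinfun.bilinear_simps)
  have fstep: "norm (f (z + v) - (z + v)) \<le> C * (norm v)\<^sup>2"
    and gstep: "norm (g (z + v) - (z + v)) \<le> 2 * C * (norm v)\<^sup>2"
    if "z \<in> M" "z \<in> ball xbar \<delta>" "v \<in> E z" "z + v \<in> ball xbar \<delta>" for z v
  proof -
    show *: "norm (f (z + v) - (z + v)) \<le> C * (norm v)\<^sup>2"
      using step[of z v] that sub unfolding E_def by blast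
    show "norm (g (z + v) - (z + v)) \<le> 2 * C * (norm v)\<^sup>2" using near[OF that(4)] * by linarith
  qed
  have room: "\<exists>e>0. \<forall>t. \<bar>t\<bar> < e \<longrightarrow> z + t *\<^sub>R v \<in> ball xbar \<delta>" if "z \<in> ball xbar \<delta>" for z v
  proof -
    have "open ((\<lambda>t. z + t *\<^sub>R v) -` ball xbar \<delta>)" by (intro open_vimage open_ball continuous_intros)
    moreover have "0 \<in> (\<lambda>t. z + t *\<^sub>R v) -` ball xbar \<delta>" using that by simp
    ultimately obtain e where "e > 0" "ball 0 e \<subseteq> (\<lambda>t. z + t *\<^sub>R v) -` ball xbar \<delta>"
      using open_contains_ball by blast
    then show ?thesis by (intro exI[of _ e]) (auto simp: subset_iff dist_norm)
  qed
  have tang: "tangent_space M z = E z" if z: "z \<in> M" "z \<in> ball xbar \<delta>" for z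
  proof (intro set_eqI iffI)
    fix v assume "v \<in> tangent_space M z"
    then show "v \<in> E z" using tang_sub z sub unfolding E_def by blast
  next
    fix v assume v: "v \<in> E z"
    obtain e where e: "e > 0" "\<And>t. \<bar>t\<bar> < e \<Longrightarrow> z + t *\<^sub>R v \<in> ball xbar \<delta>" using room[OF z(2)] by blast
    from gC2 obtain g1 g2 where g1: "\<forall>y\<in>ball xbar \<delta>. (g has_derivative blinfun_apply (g1 y)) (at y)"
      "\<forall>y\<in>ball xbar \<delta>. (g1 has_derivative blinfun_apply (g2 y)) (at y)"
      unfolding C2_on_def by (elim exE conjE)
    \<comment> \<open>The limiting map itself produces a curve in the intersection with the prescribed velocity.\<close>
    define c where "c = (\<lambda>t. g (z + t *\<^sub>R v))"
    have cd: "(c has_vector_derivative g1 (z + t *\<^sub>R v) v) (at t)" if t: "\<bar>t\<bar> < e" for t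
    proof -
      have l: "((\<lambda>t. z + t *\<^sub>R v) has_derivative (\<lambda>s. s *\<^sub>R v)) (at t)" by (auto intro!: derivative_eq_intros)
      have "(g has_derivative blinfun_apply (g1 (z + t *\<^sub>R v))) (at (z + t *\<^sub>R v))" using g1(1) e(2)[OF t] by blast
      from has_derivative_compose[OF l this] show ?thesis
        by (simp add: c_def has_vector_derivative_def blinfun.scaleR_right)
    qed
    have "(c has_vector_derivative v) (at 0)"
    proof (rule has_vector_derivative_of_quadratic_bound[OF e(1)])
      fix t assume t: "\<bar>t\<bar> < e"
      have "t *\<^sub>R v \<in> E z" using v Esub by (simp add: subspace_scale)
      from gstep[OF z this e(2)[OF t]]
      show "norm (c t - (z + t *\<^sub>R v)) \<le> (2 * C * (norm v)\<^sup>2) * t\<^sup>2"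
        by (simp add: c_def power_mult_distrib mult_ac)
    qed
    moreover have "(c has_vector_derivative g1 z v) (at 0)" using cd[of 0] e(1) by simp
    ultimately have g1v: "g1 z v = v" by (rule vector_derivative_unique_at[rotated])
    have g1c: "continuous_on (ball xbar \<delta>) g1" by (rule continuous_on_of_has_derivative) (use g1(2) in blast)
    show "v \<in> tangent_space M z"
      unfolding tangent_space_def mem_Collect_eq
    proof (intro exI conjI ballI)
      show "e > 0" by fact
      show "c 0 = z" using gx z by (simp add: c_def)
      show "g1 (z + 0 *\<^sub>R v) v = v" using g1v by simp
      have "continuous_on {-e<..<e} (\<lambda>t. g1 (z + t *\<^sub>R v))"
        by (rule continuous_on_compose2[OF g1c]) (use e(2) in \<open>auto intro!: continuous_intros simp: abs_less_iff\<close>)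
      then show "continuous_on {-e<..<e} (\<lambda>t. g1 (z + t *\<^sub>R v) v)"
        by (intro continuous_intros)
      fix t assume "t \<in> {-e<..<e}"
      then have t: "\<bar>t\<bar> < e" by auto
      show "c t \<in> M" unfolding c_def by (rule gM[OF e(2)[OF t]])
      show "(c has_vector_derivative g1 (z + t *\<^sub>R v) v) (at t)" by (rule cd[OF t])
    qed
  qed
  define \<Omega> where "\<Omega> = M \<inter> ball xbar (\<delta>/2)"
  define r where "r = \<delta>/2"
  have r: "r > 0" using \<delta> by (simp add: r_def)
  have half: "ball xbar (\<delta>/2) \<subseteq> ball xbar \<delta>" using \<delta> by (intro subset_ball) simp
  have dom: "z + \<eta> \<in> ball xbar \<delta>" if "(z, \<eta>) \<in> retraction_domain M \<Omega> r" for z \<eta>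
  proof -
    have "dist xbar z < \<delta>/2" "norm \<eta> < \<delta>/2" using that by (auto simp: retraction_domain_def \<Omega>_def r_def)
    moreover have "dist xbar (z + \<eta>) \<le> dist xbar z + norm \<eta>"
      using dist_triangle[of xbar "z + \<eta>" z] by (simp add: dist_norm)
    ultimately show ?thesis by simp
  qed
  have psi: "newton_slra_limit M1 M2 (z, \<eta>) = g (z + \<eta>)" for z \<eta>
    by (simp add: newton_slra_limit_def g_def f_def)

  have "second_order_retraction_near M xbar \<Omega> r (newton_slra_limit M1 M2)"
    unfolding second_order_retraction_near_def
  proof (intro conjI ballI r)
    show "openin (top_of_set M) \<Omega>" unfolding \<Omega>_def by (simp add: openin_open_Int)
    show "xbar \<in> \<Omega>" using xM \<delta> by (simp add: \<Omega>_def)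
    show "newton_slra_limit M1 M2 ` retraction_domain M \<Omega> r \<subseteq> M"
    proof (intro image_subsetI)
      fix q assume q: "q \<in> retraction_domain M \<Omega> r"
      obtain z \<eta> where "q = (z, \<eta>)" by (cases q)
      then show "newton_slra_limit M1 M2 q \<in> M" using gM dom q psi by metis
    qed
    show "C2_map_on_subset (newton_slra_limit M1 M2) (retraction_domain M \<Omega> r)"
      unfolding C2_map_on_subset_def
    proof
      fix q assume q: "q \<in> retraction_domain M \<Omega> r"
      define l :: "('a \<times> 'a) \<Rightarrow>\<^sub>L 'a" where "l = fst_blinfun + snd_blinfun"
      have l: "l (z, \<eta>) = z + \<eta>" for z \<eta> by (simp add: l_def blinfun.bilinear_simps)
      show "\<exists>U h. open U \<and> q \<in> U \<and> C2_on h U \<and> (\<forall>q\<in>U \<inter> retraction_domain M \<Omega> r. h q = newton_slra_limit M1 M2 q)"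
      proof (intro exI conjI ballI)
        show "open (blinfun_apply l -` ball xbar \<delta>)" by (intro open_vimage open_ball continuous_intros)
        show "C2_on (\<lambda>q. g (l q)) (blinfun_apply l -` ball xbar \<delta>)" by (rule C2_on_compose_linear[OF gC2])
        show "q \<in> blinfun_apply l -` ball xbar \<delta>" using dom q l by (cases q) auto
        show "g (l q') = newton_slra_limit M1 M2 q'" for q' by (cases q') (simp add: psi l)
      qed
    qed
    fix z \<eta> assume z: "z \<in> \<Omega>" and \<eta>: "\<eta> \<in> tangent_space M z"
    have zM: "z \<in> M" "z \<in> ball xbar \<delta>" using z half by (auto simp: \<Omega>_def)
    have \<eta>E: "\<eta> \<in> E z" using \<eta> tang[OF zM] by simp
    have tE: "t *\<^sub>R \<eta> \<in> E z" for t using \<eta>E Esub by (simp add: subspace_scale)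
    show "newton_slra_limit M1 M2 (z, 0) = z" using gx[OF zM] by (simp add: psi)
    obtain e where e: "e > 0" "\<And>t. \<bar>t\<bar> < e \<Longrightarrow> z + t *\<^sub>R \<eta> \<in> ball xbar \<delta>" using room[OF zM(2)] by blast
    have "(\<lambda>t. norm (g (z + t *\<^sub>R \<eta>) - (z + t *\<^sub>R \<eta>))) \<in> o[at 0](\<lambda>t. t ^ 1)"
    proof (rule smallo_of_power_bound[OF e(1)])
      fix t assume t: "\<bar>t\<bar> < e"
      have "norm (g (z + t *\<^sub>R \<eta>) - (z + t *\<^sub>R \<eta>)) \<le> 2 * C * (norm (t *\<^sub>R \<eta>))\<^sup>2"
        by (rule gstep[OF zM tE e(2)[OF t]])
      then show "\<bar>norm (g (z + t *\<^sub>R \<eta>) - (z + t *\<^sub>R \<eta>))\<bar> \<le> (2 * C * (norm \<eta>)\<^sup>2) * \<bar>t\<bar> ^ Suc 1"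
        by (simp add: power_mult_distrib power2_eq_square mult_ac)
    qed
    then show "(\<lambda>t. norm (newton_slra_limit M1 M2 (z, t *\<^sub>R \<eta>) - (z + t *\<^sub>R \<eta>))) \<in> o[at 0](\<lambda>t. t)"
      by (simp add: psi)
    define n where "n = norm \<eta>"
    define K where "K = 2 * C * (C * n\<^sup>2)\<^sup>2 + C' * (C * n\<^sup>2) * n"
    have n: "n \<ge> 0" by (simp add: n_def)
    have "(\<lambda>t. norm (closest_point (tangent_space M z) (g (z + t *\<^sub>R \<eta>) - (z + t *\<^sub>R \<eta>)))) \<in> o[at 0](\<lambda>t. t ^ 2)"
    proof (rule smallo_of_power_bound[where e = "min e 1"])
      show "min e 1 > 0" using e by simp
      fix t :: real assume t: "\<bar>t\<bar> < min e 1"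
      define y where "y = z + t *\<^sub>R \<eta>"
      have y: "y \<in> ball xbar \<delta>" using e(2)[of t] t by (simp add: y_def)
      have K0: "K * \<bar>t\<bar> ^ Suc 2 \<ge> 0" using C C' n by (simp add: K_def)
      have nt: "norm (t *\<^sub>R \<eta>) = \<bar>t\<bar> * n" by (simp add: n_def)
      have r0: "norm (f y - y) \<le> C * (\<bar>t\<bar> * n)\<^sup>2"
        using fstep[OF zM tE y[unfolded y_def]] unfolding nt y_def .
      have r1: "norm (g y - f y) \<le> 2 * C * (C * (\<bar>t\<bar> * n)\<^sup>2)\<^sup>2"
        using near2[OF y] r0 C by (smt (verit, ccfv_SIG) mult_left_mono norm_ge_zero power_mono)
      \<comment> \<open>The two contributions to \<open>g y - y\<close> are of order \<open>t\<^sup>4\<close> and \<open>t\<^sup>3\<close>.\<close>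
      have t4: "\<bar>t\<bar> ^ 4 \<le> \<bar>t\<bar> ^ 3" using t by (intro power_decreasing) auto
      have "norm (closest_point (E z) (g y - y)) \<le> K * \<bar>t\<bar> ^ Suc 2"
      proof (rule norm_closest_point_subspace_le[OF Esub _ K0])
        fix u assume u: "u \<in> E z"
        have "\<bar>(f y - y) \<bullet> u\<bar> \<le> C' * norm (f y - y) * (\<bar>t\<bar> * n) * norm u"
          using step_tangential[of z "t *\<^sub>R \<eta>" u] zM sub y u tE[of t] unfolding E_def nt y_def by blast
        also have "\<dots> \<le> C' * (C * (\<bar>t\<bar> * n)\<^sup>2) * (\<bar>t\<bar> * n) * norm u"
          using r0 C' n by (intro mult_right_mono mult_left_mono) auto
        finally have a: "\<bar>(f y - y) \<bullet> u\<bar> \<le> C' * (C * (\<bar>t\<bar> * n)\<^sup>2) * (\<bar>t\<bar> * n) * norm u" .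
        have b: "\<bar>(g y - f y) \<bullet> u\<bar> \<le> 2 * C * (C * (\<bar>t\<bar> * n)\<^sup>2)\<^sup>2 * norm u"
          using Cauchy_Schwarz_ineq2[of "g y - f y" u] mult_right_mono[OF r1, of "norm u"] by simp
        have "(g y - y) \<bullet> u = (g y - f y) \<bullet> u + (f y - y) \<bullet> u" by (simp add: inner_diff_left)
        then have "\<bar>(g y - y) \<bullet> u\<bar> \<le> (2 * C * (C * (\<bar>t\<bar> * n)\<^sup>2)\<^sup>2 + C' * (C * (\<bar>t\<bar> * n)\<^sup>2) * (\<bar>t\<bar> * n)) * norm u"
          using a b by (simp add: distrib_right)
        also have "\<dots> \<le> K * \<bar>t\<bar> ^ Suc 2 * norm u"
        proof (rule mult_right_mono)
          have "2 * C * (C * (\<bar>t\<bar> * n)\<^sup>2)\<^sup>2 = (2 * C * (C * n\<^sup>2)\<^sup>2) * \<bar>t\<bar> ^ 4"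
            by (simp add: power_mult_distrib power2_eq_square power4_eq_xxxx mult_ac)
          also have "\<dots> \<le> (2 * C * (C * n\<^sup>2)\<^sup>2) * \<bar>t\<bar> ^ 3" using t4 C by (intro mult_left_mono) auto
          finally have a4: "2 * C * (C * (\<bar>t\<bar> * n)\<^sup>2)\<^sup>2 \<le> (2 * C * (C * n\<^sup>2)\<^sup>2) * \<bar>t\<bar> ^ 3" .
          have a3: "C' * (C * (\<bar>t\<bar> * n)\<^sup>2) * (\<bar>t\<bar> * n) = (C' * (C * n\<^sup>2) * n) * \<bar>t\<bar> ^ 3"
            by (simp add: power_mult_distrib power2_eq_square power3_eq_cube mult_ac)
          have "Suc 2 = 3" by simp
          then show "2 * C * (C * (\<bar>t\<bar> * n)\<^sup>2)\<^sup>2 + C' * (C * (\<bar>t\<bar> * n)\<^sup>2) * (\<bar>t\<bar> * n) \<le> K * \<bar>t\<bar> ^ Suc 2"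
            using a4 by (simp only: K_def distrib_right a3 add_le_cancel_right)
        qed simp
        finally show "\<bar>(g y - y) \<bullet> u\<bar> \<le> K * \<bar>t\<bar> ^ Suc 2 * norm u" .
      qed
      then show "\<bar>norm (closest_point (tangent_space M z) (g (z + t *\<^sub>R \<eta>) - (z + t *\<^sub>R \<eta>)))\<bar> \<le> K * \<bar>t\<bar> ^ Suc 2"
        using tang[OF zM] by (simp add: y_def)
    qed
    then show "(\<lambda>t. norm (closest_point (tangent_space M z) (newton_slra_limit M1 M2 (z, t *\<^sub>R \<eta>) - (z + t *\<^sub>R \<eta>)))) \<in> o[at 0](\<lambda>t. t\<^sup>2)"
      by (simp add: psi)
  qed
  moreover have "(\<forall>k. newton_slra_defined M1 M2 ((newton_slra M1 M2 ^^ k) (z + \<eta>))) \<and>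
       convergent (\<lambda>k. (newton_slra M1 M2 ^^ k) (z + \<eta>))"
    if "(z, \<eta>) \<in> retraction_domain M \<Omega> r" for z \<eta>
    using fdef orbit[OF dom[OF that]] conv[OF dom[OF that]] unfolding f_def convergent_def by blast
  ultimately show ?thesis using r unfolding M_def by blast
qed

end
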